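(* Let $k$ be a field of characteristic zero and let $h(x)=\prod_{j=1}^d x_j^{N_j}f(x)\in k[x_1,\dots,x_d]$, $N_j\in\mathbb N$, with no $x_j$ dividing $f$, be non-degenerate with respect to all compact faces of its Newton polyhedron. Let $\omega=\prod_{j=1}^d x_j^{\nu_j-1}dx_1\wedge\cdots\wedge dx_d$, $\nu_j\ge1$, with $\nu_j=1$ whenever $N_j=0$. Then $$Z_{DL}(h,\omega,T)=\sum_{\tau\in CF(h)}L_\tau(h)\,S_{\Delta_\tau}(h,\omega,T),$$ where $L_\tau(h)=\mathbb L^{-d}\big((\mathbb L-1)^d-[N_\tau]\big)+\mathbb L^{-d}(\mathbb L-1)[N_\tau]\dfrac{\mathbb L^{-1}T}{1-\mathbb L^{-1}T}$.
   Context: $K_0(\mathrm{Var}_k)$ is the Grothendieck ring of $k$-varieties, $\mathbb L=[\mathbb A^1_k]$, $\mathcal M_k=K_0(\mathrm{Var}_k)[\mathbb L^{-1}]$; $\mu$ is the motivic measure on arcs of $X=\mathbb A^d_k$. For an arc $\varphi$ at the origin, $\mathrm{ord}(\omega\circ\varphi)=\mathrm{ord}_t\prod_j\varphi_j^{\nu_j-1}$; with $V_{n,m}$ the set of arcs at $0$ with $\mathrm{ord}_t(h\circ\varphi)=n$, $\mathrm{ord}(\omega\circ\varphi)=m$, $Z_{DL}(h,\omega,T)=\sum_{n\in\mathbb N}\big(\sum_{m}\mathbb L^{-m}\mu(V_{n,m})\big)T^n$. The Newton polyhedron $\Gamma(h)$ is the convex hull of $\bigcup_{a\in\mathrm{supp}(h)}(a+\mathbb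 R_{\ge0}^d)$; $CF(h)$ is the set of its compact faces; for $\tau\in CF(h)$, $h_\tau=\sum_{a\in\tau}c_ax^a$. Non-degenerate means: for each $\tau\in CF(h)$ the subscheme of the torus $\mathbb G_{m,k}^d$ defined by $\partial h_\tau/\partial x_1=\dots=\partial h_\tau/\partial x_d=0$ is empty. For $\mathbf k\in\mathbb R_{\ge0}^d$ put $m_h(\mathbf k)=\min_{x\in\Gamma(h)}\mathbf k\cdot x$, $\sigma_\omega(\mathbf k)=\sum\nu_jk_j$, $F(\mathbf k)=\{x\in\Gamma(h):\mathbf k\cdot x=m_h(\mathbf k)\}$, $\Delta_\tau=\{\mathbf k\in\mathbb R_{\ge0}^d:F(\mathbf k)=\tau\}$, $S_{\Delta_\tau}(h,\omega,T)=\sum_{\mathbf k\in\mathbb Z_{>0}^d\cap\Delta_\tau}\mathbb L^{-\sigma_\omega(\mathbf k)}T^{m_h(\mathbf k)}$. $N_\tau$ is the subvariety $\{h_\tau=0\}$ of $\mathbb G^d_{m,k}$ and $[N_\tau]$ its class. *)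

theory Defs
  imports
    "HOL-Analysis.Analysis"
    "HOL-Algebra.Algebraic_Closure_Type"
    "HOL-Library.Poly_Mapping"
begin

no_notation Polynomials.var (\<open>X\<index>\<close>)


section \<open>Polynomials in several variables\<close>

text \<open>
  A polynomial over \<open>'k\<close> in variables indexed by \<open>'i\<close> is a finitely supported map from
  exponents to coefficients, with the convolution product of \<open>Poly_Mapping\<close>.
\<close>

type_synonym ('i, 'k) mpoly = "('i \<Rightarrow>\<^sub>0 nat) \<Rightarrow>\<^sub>0 'k"

definition mvar :: "'i \<Rightarrow> ('i, 'k::comm_ring_1) mpoly" where
  "mvar i = Poly_Mapping.single (Poly_Mapping.single i 1) 1"

text \<open>Evaluation at \<open>x\<close>, the coefficients being mapped by \<open>c\<close>.\<close>

definition mp_eval ::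
    "('k \<Rightarrow> 'r::comm_ring_1) \<Rightarrow> ('i, 'k::comm_ring_1) mpoly \<Rightarrow> ('i \<Rightarrow> 'r) \<Rightarrow> 'r" where
  "mp_eval c p x =
     (\<Sum>a\<in>Poly_Mapping.keys p. c (poly_mapping.lookup p a) * (\<Prod>i\<in>Poly_Mapping.keys a. x i ^ poly_mapping.lookup a i))"

definition mp_deriv :: "'i \<Rightarrow> ('i, 'k::comm_ring_1) mpoly \<Rightarrow> ('i, 'k) mpoly" where
  "mp_deriv i p = (\<Sum>a\<in>Poly_Mapping.keys p. Poly_Mapping.single (a - Poly_Mapping.single i 1)
                                  (of_nat (poly_mapping.lookup a i) * poly_mapping.lookup p a))"


section \<open>Varieties over a field of characteristic zero\<close>

text \<open>
  A variety over \<open>k\<close> (reduced separated scheme of finite type) is represented, in the classical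
  way, by the set of its points over the algebraic closure \<open>K\<close> of \<open>k\<close>, with the \<open>k\<close>-Zariski
  topology (closed sets cut out by equations over \<open>k\<close>) and the sheaf of \<open>k\<close>-regular \<open>K\<close>-valued
  functions.  The maps of such spaces that are continuous and pull regular functions back to regular
  functions are exactly the morphisms of the corresponding \<open>k\<close>-schemes.
  Functions on \<open>U\<close> are made unique as HOL functions by \<open>extensional U\<close>.
\<close>

record ('p, 'v) fspace =
  ztop :: "'p topology"
  reg :: "'p set \<Rightarrow> ('p \<Rightarrow> 'v) set"

definition fspace_morphism ::
    "('p, 'v) fspace \<Rightarrow> ('q, 'v) fspace \<Rightarrow> ('p \<Rightarrow> 'q) \<Rightarrow> bool" where
  "fspace_morphism X Y u \<longleftrightarrow>
     continuous_map (ztop X) (ztop Y) u \<and>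
     (\<forall>V g. openin (ztop Y) V \<and> g \<in> reg Y V \<longrightarrow>
        restrict (g \<circ> u) (u -` V \<inter> topspace (ztop X))
          \<in> reg X (u -` V \<inter> topspace (ztop X)))"

definition fspace_iso :: "('p, 'v) fspace \<Rightarrow> ('q, 'v) fspace \<Rightarrow> bool" where
  "fspace_iso X Y \<longleftrightarrow>
     (\<exists>u v. fspace_morphism X Y u \<and> fspace_morphism Y X v \<and>
        (\<forall>p\<in>topspace (ztop X). v (u p) = p) \<and> (\<forall>q\<in>topspace (ztop Y). u (v q) = q))"

text \<open>
  The structure induced on a subset \<open>S\<close>: regular functions are those which are locally
  restrictions of regular functions of \<open>X\<close>.  For \<open>S\<close> closed this is the reduced subvariety.
\<close>

definition fsub :: "('p, 'v) fspace \<Rightarrow> 'p set \<Rightarrow> ('p, 'v) fspace" where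
  "fsub X S =
     \<lparr> ztop = subtopology (ztop X) S,
       reg = (\<lambda>V. {f \<in> extensional V. openin (subtopology (ztop X) S) V \<and>
                (\<forall>p\<in>V. \<exists>W g. openin (ztop X) W \<and> p \<in> W \<and> g \<in> reg X W \<and>
                          (\<forall>q\<in>W \<inter> V. f q = g q))}) \<rparr>"

text \<open>
  Affine space with coordinates indexed by \<open>I\<close>; its points are the families that vanish
  outside \<open>I\<close>.  The topology has the sets \<open>b \<noteq> 0\<close> as a basis, and regular functions are
  locally quotients of polynomials over \<open>k\<close>.
\<close>

definition aff_points :: "'i set \<Rightarrow> ('i \<Rightarrow> 'k::field_char_0 alg_closure) set" where
  "aff_points I = {x. \<forall>i. i \<notin> I \<longrightarrow> x i = 0}"

definition zariski :: "'i set \<Rightarrow> ('i \<Rightarrow> 'k::field_char_0 alg_closure) topology" where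
  "zariski I = topology_generated_by
     (range (\<lambda>b :: ('i, 'k) mpoly. {x \<in> aff_points I. mp_eval to_ac b x \<noteq> 0}))"

definition aff_space ::
    "'i set \<Rightarrow> ('i \<Rightarrow> 'k::field_char_0 alg_closure, 'k alg_closure) fspace" where
  "aff_space I =
     \<lparr> ztop = zariski I,
       reg = (\<lambda>U. {f \<in> extensional U. openin (zariski I) U \<and>
                (\<forall>p\<in>U. \<exists>W (a :: ('i, 'k) mpoly) b. openin (zariski I) W \<and> p \<in> W \<and> W \<subseteq> U \<and>
                    (\<forall>q\<in>W. mp_eval to_ac b q \<noteq> 0 \<and>
                            f q = mp_eval to_ac a q / mp_eval to_ac b q))}) \<rparr>"

text \<open>
  The product: on a rectangle \<open>U \<times> V\<close> take the functions \<open>\<Sum>\<^sub>i f\<^sub>i(x) g\<^sub>i(y)\<close>; their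
  non-vanishing loci generate the topology, and regular functions are locally their quotients.
\<close>

definition biregular ::
    "('p, 'v::field) fspace \<Rightarrow> ('q, 'v) fspace \<Rightarrow> 'p set \<Rightarrow> 'q set \<Rightarrow> ('p \<times> 'q \<Rightarrow> 'v) set" where
  "biregular X Y U V =
     {F. \<exists>(n::nat) f g. (\<forall>i<n. f i \<in> reg X U \<and> g i \<in> reg Y V) \<and>
                       F = (\<lambda>(x, y). \<Sum>i<n. f i x * g i y)}"

definition prod_topology_Z ::
    "('p, 'v::field) fspace \<Rightarrow> ('q, 'v) fspace \<Rightarrow> ('p \<times> 'q) topology" where
  "prod_topology_Z X Y = topology_generated_by
     {{z \<in> U \<times> V. F z \<noteq> 0} | U V F.
        openin (ztop X) U \<and> openin (ztop Y) V \<and> F \<in> biregular X Y U V}"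

definition fprod ::
    "('p, 'v::field) fspace \<Rightarrow> ('q, 'v) fspace \<Rightarrow> ('p \<times> 'q, 'v) fspace" where
  "fprod X Y =
     \<lparr> ztop = prod_topology_Z X Y,
       reg = (\<lambda>W. {f \<in> extensional W. openin (prod_topology_Z X Y) W \<and>
                (\<forall>z\<in>W. \<exists>U V a b. openin (ztop X) U \<and> openin (ztop Y) V \<and> z \<in> U \<times> V \<and>
                    a \<in> biregular X Y U V \<and> b \<in> biregular X Y U V \<and> b z \<noteq> 0 \<and>
                    (\<forall>q\<in>W \<inter> U \<times> V. b q \<noteq> 0 \<longrightarrow> f q = a q / b q))}) \<rparr>"

text \<open>
  The first condition says that \<open>reg\<close> is a sheaf of functions.  Affine varieties are
  the closed subsets of affine spaces.
\<close>

definition is_variety :: "('p, 'k::field_char_0 alg_closure) fspace \<Rightarrow> bool" where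
  "is_variety X \<longleftrightarrow>
     reg X = reg (fsub X (topspace (ztop X))) \<and>
     (\<exists>\<U>. finite \<U> \<and> \<Union>\<U> = topspace (ztop X) \<and>
        (\<forall>U\<in>\<U>. openin (ztop X) U \<and>
           (\<exists>(n::nat) Z. closedin (zariski {..<n}) Z \<and>
              fspace_iso (fsub X U) (fsub (aff_space {..<n}) Z)))) \<and>
     closedin (ztop (fprod X X)) {(p, p) | p. p \<in> topspace (ztop X)}"

text \<open>
  A type containing a copy of every variety: a variety over \<open>k\<close> has at most as many points
  as \<open>K\<close> has elements.
\<close>

typedef (overloaded) 'k variety =
  "{X :: (nat \<Rightarrow> 'k::field_char_0 alg_closure, 'k alg_closure) fspace. is_variety X}"
proof -
  let ?T = "discrete_topology {} :: (nat \<Rightarrow> 'k alg_closure) topology"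
  let ?X = "\<lparr> ztop = ?T, reg = (\<lambda>V. if V = {} then {\<lambda>_. undefined} else {}) \<rparr>
              :: (nat \<Rightarrow> 'k alg_closure, 'k alg_closure) fspace"
  have *: "subtopology ?T {} = ?T" by simp
  have "is_variety ?X"
    unfolding is_variety_def
  proof (intro conjI)
    show "reg ?X = reg (fsub ?X (topspace (ztop ?X)))"
      by (rule ext) (auto simp: fsub_def extensional_def)
    show "\<exists>\<U>. finite \<U> \<and> \<Union>\<U> = topspace (ztop ?X) \<and>
        (\<forall>U\<in>\<U>. openin (ztop ?X) U \<and>
           (\<exists>(n::nat) Z. closedin (zariski {..<n}) Z \<and>
              fspace_iso (fsub ?X U) (fsub (aff_space {..<n}) Z)))"
      by (rule exI[of _ "{}"]) auto
    have "{(p, p) | p. p \<in> topspace (ztop ?X)} = {}" by simp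
    then show "closedin (ztop (fprod ?X ?X)) {(p, p) | p. p \<in> topspace (ztop ?X)}"
      by (metis closedin_empty)
  qed
  then show ?thesis by blast
qed

text \<open>Krull dimension; for a variety the lengths of chains are bounded.\<close>

definition irreducible_closedin :: "'p topology \<Rightarrow> 'p set \<Rightarrow> bool" where
  "irreducible_closedin T Z \<longleftrightarrow> closedin T Z \<and> Z \<noteq> {} \<and>
     (\<forall>A B. closedin T A \<and> closedin T B \<and> Z \<subseteq> A \<union> B \<longrightarrow> Z \<subseteq> A \<or> Z \<subseteq> B)"

definition krull_dim :: "'p topology \<Rightarrow> nat" where
  "krull_dim T = Sup {n. \<exists>Z. (\<forall>i\<le>n. irreducible_closedin T (Z i)) \<and> (\<forall>i<n. Z i \<subset> Z (Suc i))}"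

definition var_dim :: "'k::field_char_0 variety \<Rightarrow> nat" where
  "var_dim X = krull_dim (ztop (Rep_variety X))"


section \<open>The Grothendieck ring of varieties\<close>

text \<open>
  The commutative ring presented by one generator for every variety, and relations for
  isomorphism, closed subvarieties, products and the point.  The classes of rings used below
  do not contain the axiom \<open>0 \<noteq> 1\<close>, so that the ring structures come without a proof
  that the Grothendieck ring is nontrivial.
\<close>

type_synonym 'k variety_poly = "('k variety \<Rightarrow>\<^sub>0 nat) \<Rightarrow>\<^sub>0 int"

definition K0_relators :: "'k::field_char_0 variety_poly set" where
  "K0_relators =
     {mvar X - mvar Y | X Y. fspace_iso (Rep_variety X) (Rep_variety Y)} \<union>
     {mvar X - mvar Y - mvar W | X Y W. \<exists>Z. closedin (ztop (Rep_variety X)) Z \<and>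
        fspace_iso (Rep_variety Y) (fsub (Rep_variety X) Z) \<and>
        fspace_iso (Rep_variety W)
          (fsub (Rep_variety X) (topspace (ztop (Rep_variety X)) - Z))} \<union>
     {mvar X * mvar Y - mvar W | X Y W.
        fspace_iso (Rep_variety W) (fprod (Rep_variety X) (Rep_variety Y))} \<union>
     {mvar X - 1 | X. fspace_iso (Rep_variety X) (aff_space ({} :: nat set))}"

text \<open>A commutative ring as a module over itself: the span of a set is the ideal generated by it.\<close>

interpretation self_module: Modules.module "(*) :: 'a \<Rightarrow> 'a \<Rightarrow> 'a::comm_ring_1"
  by standard (simp_all add: algebra_simps)

quotient_type (overloaded) 'k K0 = "'k::field_char_0 variety_poly" /
    "\<lambda>a b. a - b \<in> self_module.span K0_relators"
proof (rule equivpI)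
  show "reflp (\<lambda>a b :: 'k variety_poly. a - b \<in> self_module.span K0_relators)"
    by (simp add: reflp_def self_module.span_zero)
  show "symp (\<lambda>a b :: 'k variety_poly. a - b \<in> self_module.span K0_relators)"
    by (metis (no_types, lifting) sympI self_module.span_neg minus_diff_eq)
  show "transp (\<lambda>a b :: 'k variety_poly. a - b \<in> self_module.span K0_relators)"
  proof (rule transpI)
    fix a b c :: "'k variety_poly"
    assume "a - b \<in> self_module.span K0_relators" "b - c \<in> self_module.span K0_relators"
    from self_module.span_add[OF this] show "a - c \<in> self_module.span K0_relators" by simp
  qed
qed

instantiation K0 :: (field_char_0) "{comm_ring, comm_monoid_mult}"
begin

lift_definition zero_K0 :: "'a K0" is 0 .
lift_definition one_K0 :: "'a K0" is 1 .
lift_definition plus_K0 :: "'a K0 \<Rightarrow> 'a K0 \<Rightarrow> 'a K0" is "(+)"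
  by (metis (no_types, lifting) add_diff_add self_module.span_add)
lift_definition uminus_K0 :: "'a K0 \<Rightarrow> 'a K0" is uminus
  by (metis (no_types, lifting) self_module.span_neg minus_diff_minus)
lift_definition minus_K0 :: "'a K0 \<Rightarrow> 'a K0 \<Rightarrow> 'a K0" is "(-)"
proof -
  fix a b c d :: "'a variety_poly"
  assume "a - b \<in> self_module.span K0_relators" "c - d \<in> self_module.span K0_relators"
  from self_module.span_diff[OF this] show "a - c - (b - d) \<in> self_module.span K0_relators"
    by (simp add: algebra_simps)
qed
lift_definition times_K0 :: "'a K0 \<Rightarrow> 'a K0 \<Rightarrow> 'a K0" is "(*)"
proof -
  fix a b c d :: "'a variety_poly"
  assume "a - b \<in> self_module.span K0_relators" "c - d \<in> self_module.span K0_relators"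
  then have "c * (a - b) + b * (c - d) \<in> self_module.span K0_relators"
    by (intro self_module.span_add self_module.span_scale)
  then show "a * c - b * d \<in> self_module.span K0_relators" by (simp add: algebra_simps)
qed

instance
proof
  have eqI: "a - b \<in> self_module.span K0_relators" if "a = b" for a b :: "'a variety_poly"
    using that by (simp add: self_module.span_zero)
  fix x y z :: "'a K0"
  show "x + y + z = x + (y + z)" by transfer (rule eqI, rule add.assoc)
  show "x + y = y + x" by transfer (rule eqI, rule add.commute)
  show "0 + x = x" by transfer (rule eqI, rule add_0)
  show "- x + x = 0" by transfer (rule eqI, rule left_minus)
  show "x - y = x + - y" by transfer (rule eqI, rule diff_conv_add_uminus)
  show "x * y * z = x * (y * z)" by transfer (rule eqI, rule mult.assoc)
  show "x * y = y * x" by transfer (rule eqI, rule mult.commute)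
  show "1 * x = x" by transfer (rule eqI, rule mult_1)
  show "(x + y) * z = x * z + y * z" by transfer (rule eqI, rule distrib_right)
qed

end

text \<open>
  The class of a variety, given over an arbitrary type of points, is that of an
  isomorphic copy in the type \<open>variety\<close>.
\<close>

definition K0_class :: "('p, 'k::field_char_0 alg_closure) fspace \<Rightarrow> 'k K0" where
  "K0_class X = abs_K0 (mvar (SOME Y. fspace_iso (Rep_variety Y) X))"

definition K0_L :: "'k::field_char_0 K0" where
  "K0_L = K0_class (aff_space (UNIV :: unit set))"


lifting_forget K0.lifting


section \<open>Inverting the class of the affine line\<close>

definition Mk_eq :: "'k::field_char_0 K0 \<times> nat \<Rightarrow> 'k K0 \<times> nat \<Rightarrow> bool" where
  "Mk_eq = (\<lambda>(a, m) (b, n). \<exists>r. K0_L ^ r * (a * K0_L ^ n) = K0_L ^ r * (b * K0_L ^ m))"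

quotient_type (overloaded) 'k Mk = "'k::field_char_0 K0 \<times> nat" / Mk_eq
proof (rule equivpI)
  show "reflp (Mk_eq :: 'k K0 \<times> nat \<Rightarrow> _)" by (auto simp: reflp_def Mk_eq_def)
  show "symp (Mk_eq :: 'k K0 \<times> nat \<Rightarrow> _)" by (rule sympI) (auto simp: Mk_eq_def, metis)
  show "transp (Mk_eq :: 'k K0 \<times> nat \<Rightarrow> _)"
  proof (rule transpI, clarify)
    fix a b c :: "'k K0" and m n p
    let ?L = "K0_L :: 'k K0"
    assume "Mk_eq (a, m) (b, n)" "Mk_eq (b, n) (c, p)"
    then obtain r s where r: "?L ^ r * (a * ?L ^ n) = ?L ^ r * (b * ?L ^ m)"
      and s: "?L ^ s * (b * ?L ^ p) = ?L ^ s * (c * ?L ^ n)"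
      by (auto simp: Mk_eq_def)
    have "?L ^ (r + s + n) * (a * ?L ^ p) = (?L ^ r * (a * ?L ^ n)) * (?L ^ s * ?L ^ p)"
      by (simp add: power_add ac_simps)
    also have "\<dots> = (?L ^ r * (b * ?L ^ m)) * (?L ^ s * ?L ^ p)"
      by (simp only: r)
    also have "\<dots> = (?L ^ s * (b * ?L ^ p)) * (?L ^ r * ?L ^ m)"
      by (simp add: ac_simps)
    also have "\<dots> = (?L ^ s * (c * ?L ^ n)) * (?L ^ r * ?L ^ m)"
      by (simp only: s)
    also have "\<dots> = ?L ^ (r + s + n) * (c * ?L ^ m)"
      by (simp add: power_add ac_simps)
    finally show "Mk_eq (a, m) (c, p)" by (auto simp: Mk_eq_def)
  qed
qed

instantiation Mk :: (field_char_0) "{comm_ring, comm_monoid_mult}"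
begin

lift_definition zero_Mk :: "'a Mk" is "(0, 0)" .
lift_definition one_Mk :: "'a Mk" is "(1, 0)" .
lift_definition plus_Mk :: "'a Mk \<Rightarrow> 'a Mk \<Rightarrow> 'a Mk" is
  "\<lambda>(a, m) (b, n). (a * K0_L ^ n + b * K0_L ^ m, m + n)"
proof (clarify)
  fix a a' b b' :: "'a K0" and m m' n n'
  let ?L = "K0_L :: 'a K0"
  assume "Mk_eq (a, m) (a', m')" "Mk_eq (b, n) (b', n')"
  then obtain r s where r: "?L ^ r * (a * ?L ^ m') = ?L ^ r * (a' * ?L ^ m)"
    and s: "?L ^ s * (b * ?L ^ n') = ?L ^ s * (b' * ?L ^ n)"
    by (auto simp: Mk_eq_def)
  have "?L ^ (r + s) * ((a * ?L ^ n + b * ?L ^ m) * ?L ^ (m' + n'))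
      = (?L ^ r * (a * ?L ^ m')) * (?L ^ s * ?L ^ n * ?L ^ n')
        + (?L ^ s * (b * ?L ^ n')) * (?L ^ r * ?L ^ m * ?L ^ m')"
    by (simp add: power_add algebra_simps)
  also have "\<dots> = ?L ^ (r + s) * ((a' * ?L ^ n' + b' * ?L ^ m') * ?L ^ (m + n))"
    unfolding r s by (simp add: power_add algebra_simps)
  finally show "Mk_eq (a * ?L ^ n + b * ?L ^ m, m + n) (a' * ?L ^ n' + b' * ?L ^ m', m' + n')"
    by (auto simp: Mk_eq_def)
qed
lift_definition uminus_Mk :: "'a Mk \<Rightarrow> 'a Mk" is "\<lambda>(a, m). (- a, m)"
  by (auto simp: Mk_eq_def)
definition minus_Mk :: "'a Mk \<Rightarrow> 'a Mk \<Rightarrow> 'a Mk" where "minus_Mk x y = x + (- y)"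
lift_definition times_Mk :: "'a Mk \<Rightarrow> 'a Mk \<Rightarrow> 'a Mk" is
  "\<lambda>(a, m) (b, n). (a * b, m + n)"
proof (clarify)
  fix a a' b b' :: "'a K0" and m m' n n'
  let ?L = "K0_L :: 'a K0"
  assume "Mk_eq (a, m) (a', m')" "Mk_eq (b, n) (b', n')"
  then obtain r s where r: "?L ^ r * (a * ?L ^ m') = ?L ^ r * (a' * ?L ^ m)"
    and s: "?L ^ s * (b * ?L ^ n') = ?L ^ s * (b' * ?L ^ n)"
    by (auto simp: Mk_eq_def)
  have "?L ^ (r + s) * (a * b * ?L ^ (m' + n'))
      = (?L ^ r * (a * ?L ^ m')) * (?L ^ s * (b * ?L ^ n'))"
    by (simp add: power_add ac_simps)
  also have "\<dots> = ?L ^ (r + s) * (a' * b' * ?L ^ (m + n))"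
    unfolding r s by (simp add: power_add ac_simps)
  finally show "Mk_eq (a * b, m + n) (a' * b', m' + n')" by (auto simp: Mk_eq_def)
qed

instance
proof
  fix x y z :: "'a Mk"
  show "x + y + z = x + (y + z)"
    by transfer (auto simp: Mk_eq_def power_add algebra_simps)
  show "x + y = y + x" by transfer (auto simp: Mk_eq_def power_add algebra_simps)
  show "0 + x = x" by transfer (auto simp: Mk_eq_def)
  show "- x + x = 0" by transfer (auto simp: Mk_eq_def algebra_simps)
  show "x - y = x + - y" by (simp add: minus_Mk_def)
  show "x * y * z = x * (y * z)" by transfer (auto simp: Mk_eq_def ac_simps)
  show "x * y = y * x" by transfer (auto simp: Mk_eq_def ac_simps)
  show "1 * x = x" by transfer (auto simp: Mk_eq_def)
  show "(x + y) * z = x * z + y * z"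
    by transfer (auto simp: Mk_eq_def power_add algebra_simps)
qed

end

lift_definition Mk_of_K0 :: "'k::field_char_0 K0 \<Rightarrow> 'k Mk" is "\<lambda>a. (a, 0)" .

lift_definition Mk_Linv :: "'k::field_char_0 Mk" is "(1, 1)" .

lemma Mk_L_Linv: "Mk_of_K0 K0_L * Mk_Linv = (1 :: 'k::field_char_0 Mk)"
  by transfer (auto simp: Mk_eq_def)


section \<open>The completion\<close>

text \<open>
  The infinite sums live in the completion of \<open>Mk\<close> with respect to the usual dimension
  filtration: step \<open>m\<close> is generated as an additive group by the \<open>[S] L\<^sup>-\<^sup>i\<close> with
  \<open>dim S - i \<le> -m\<close>.  The rule \<open>mult\<close> adds nothing to this, since
  \<open>[S][S'] = [S \<times> S']\<close> and \<open>dim (S \<times> S') = dim S + dim S'\<close>; having it in the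
  definition makes the filtration multiplicative without dimension theory.
\<close>

inductive Mk_fil :: "int \<Rightarrow> 'k::field_char_0 Mk \<Rightarrow> bool" where
  gen: "int (var_dim S) - int i \<le> - m \<Longrightarrow>
          Mk_fil m (Mk_of_K0 (abs_K0 (mvar S)) * Mk_Linv ^ i)"
| zero: "Mk_fil m 0"
| add: "Mk_fil m a \<Longrightarrow> Mk_fil m b \<Longrightarrow> Mk_fil m (a + b)"
| uminus: "Mk_fil m a \<Longrightarrow> Mk_fil m (- a)"
| mult: "Mk_fil m a \<Longrightarrow> Mk_fil n b \<Longrightarrow> Mk_fil (m + n) (a * b)"

lemma Mk_fil_diff: "Mk_fil m a \<Longrightarrow> Mk_fil m b \<Longrightarrow> Mk_fil m (a - b)"
  by (metis Mk_fil.add Mk_fil.uminus diff_conv_add_uminus)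

lemma Mk_fil_mono: "Mk_fil m a \<Longrightarrow> m' \<le> m \<Longrightarrow> Mk_fil m' a"
proof (induction arbitrary: m' rule: Mk_fil.induct)
  case (gen S i m)
  then show ?case by (intro Mk_fil.gen) linarith
next
  case (mult m a n b)
  have "Mk_fil (m' - n) a" by (rule mult.IH(1)) (use mult.prems in linarith)
  from Mk_fil.mult[OF this mult.hyps(2)] show ?case by simp
qed (auto intro: Mk_fil.intros)

lemma Mk_of_K0_hom:
  "Mk_of_K0 0 = 0" "Mk_of_K0 1 = 1" "Mk_of_K0 (a + b) = Mk_of_K0 a + Mk_of_K0 b"
  "Mk_of_K0 (- a) = - Mk_of_K0 a" "Mk_of_K0 (a * b) = Mk_of_K0 a * Mk_of_K0 b"
  by (transfer; auto simp: Mk_eq_def)+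

lemma Mk_fil_one: "\<exists>c. Mk_fil c (1 :: 'k::field_char_0 Mk)"
proof -
  have "Mk_fil c (Mk_of_K0 K0_L * Mk_Linv ^ 1 :: 'k Mk)"
    if "c = 1 - int (var_dim (SOME Y. fspace_iso (Rep_variety Y)
          (aff_space (UNIV :: unit set) :: (_, 'k alg_closure) fspace)))" for c
    unfolding K0_L_def K0_class_def that by (rule Mk_fil.gen) simp
  then show ?thesis unfolding power_one_right Mk_L_Linv by blast
qed

lemma Mk_fil_Linv: "\<exists>c. Mk_fil c (Mk_Linv :: 'k::field_char_0 Mk)"
proof -
  have "Mk_fil c (Mk_of_K0 K0_L * Mk_Linv ^ 2 :: 'k Mk)"
    if "c = 2 - int (var_dim (SOME Y. fspace_iso (Rep_variety Y)
          (aff_space (UNIV :: unit set) :: (_, 'k alg_closure) fspace)))" for c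
    unfolding K0_L_def K0_class_def that by (rule Mk_fil.gen) simp
  moreover have "Mk_of_K0 K0_L * Mk_Linv ^ 2 = (Mk_Linv :: 'k Mk)"
    by (metis Mk_L_Linv mult.assoc mult.left_neutral power2_eq_square)
  ultimately show ?thesis by metis
qed

lemma Mk_fil_add_ex:
  assumes "\<exists>c. Mk_fil c a" "\<exists>c. Mk_fil c b"
  shows "\<exists>c. Mk_fil c (a + b)"
proof -
  obtain c d where "Mk_fil c a" "Mk_fil d b" using assms by blast
  then have "Mk_fil (min c d) a" "Mk_fil (min c d) b" by (auto intro: Mk_fil_mono)
  then show ?thesis by (blast intro: Mk_fil.add)
qed

lemma Mk_fil_mult_ex: "\<exists>c. Mk_fil c a \<Longrightarrow> \<exists>c. Mk_fil c b \<Longrightarrow> \<exists>c. Mk_fil c (a * b)"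
  by (blast intro: Mk_fil.mult)

lemma Mk_fil_power_ex: "\<exists>c. Mk_fil c a \<Longrightarrow> \<exists>c. Mk_fil c (a ^ n)"
  by (induction n) (auto intro: Mk_fil_one Mk_fil_mult_ex)

definition K0_bounded :: "'k::field_char_0 variety_poly \<Rightarrow> bool" where
  "K0_bounded p \<longleftrightarrow> (\<exists>c. Mk_fil c (Mk_of_K0 (abs_K0 p)))"

lemma K0_bounded_closed:
  fixes p q :: "'k::field_char_0 variety_poly"
  shows
  "K0_bounded 0" "K0_bounded 1" "K0_bounded (mvar S)"
  "K0_bounded p \<Longrightarrow> K0_bounded q \<Longrightarrow> K0_bounded (p + q)"
  "K0_bounded p \<Longrightarrow> K0_bounded (- p)"
  "K0_bounded p \<Longrightarrow> K0_bounded q \<Longrightarrow> K0_bounded (p * q)"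
proof -
  have h: "abs_K0 0 = 0" "abs_K0 1 = 1" "abs_K0 (p + q) = abs_K0 p + abs_K0 q"
    "abs_K0 (- p) = - abs_K0 p" "abs_K0 (p * q) = abs_K0 p * abs_K0 q"
    for p q :: "'k variety_poly"
    by (simp_all add: zero_K0_def one_K0_def plus_K0.abs_eq uminus_K0.abs_eq times_K0.abs_eq)
  show "K0_bounded 0" "K0_bounded 1"
    unfolding K0_bounded_def h Mk_of_K0_hom by (auto intro: Mk_fil.zero Mk_fil_one)
  have "Mk_fil (- int (var_dim S)) (Mk_of_K0 (abs_K0 (mvar S)) * Mk_Linv ^ 0)"
    by (rule Mk_fil.gen) simp
  then show "K0_bounded (mvar S)" unfolding K0_bounded_def by auto
  show "K0_bounded p \<Longrightarrow> K0_bounded q \<Longrightarrow> K0_bounded (p + q)"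
    unfolding K0_bounded_def h Mk_of_K0_hom by (rule Mk_fil_add_ex)
  show "K0_bounded p \<Longrightarrow> K0_bounded (- p)"
    unfolding K0_bounded_def h Mk_of_K0_hom by (blast intro: Mk_fil.uminus)
  show "K0_bounded p \<Longrightarrow> K0_bounded q \<Longrightarrow> K0_bounded (p * q)"
    unfolding K0_bounded_def h Mk_of_K0_hom by (rule Mk_fil_mult_ex)
qed

lemma mpoly_induct:
  assumes "P 0" "\<And>a b f. P f \<Longrightarrow> P (Poly_Mapping.single a b + f)"
  shows "P f"
proof (induction f rule: update_induct)
  case (update f a b)
  then have "Poly_Mapping.update a b f = Poly_Mapping.single a b + f"
    by (intro poly_mapping_eqI)
       (auto simp: lookup_update lookup_add lookup_single when_def in_keys_iff)
  then show ?case using assms(2) update by simp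
qed (rule assms(1))

lemma K0_bounded_all: "K0_bounded (p :: 'k::field_char_0 variety_poly)"
proof -
  have nat: "K0_bounded (of_nat n :: 'k variety_poly)" for n
    by (induction n) (auto intro: K0_bounded_closed)
  have const: "K0_bounded (of_int z :: 'k variety_poly)" for z
    by (cases z rule: int_cases2) (auto intro: K0_bounded_closed nat)
  have var: "K0_bounded (Poly_Mapping.single (Poly_Mapping.single S n) 1 :: 'k variety_poly)" for S n
  proof (induction n)
    case (Suc n)
    have "Poly_Mapping.single (Poly_Mapping.single S (Suc n)) 1 =
        mvar S * (Poly_Mapping.single (Poly_Mapping.single S n) 1 :: 'k variety_poly)"
      by (simp add: mvar_def mult_single flip: single_add)
    then show ?case using Suc K0_bounded_closed by metis
  qed (simp add: K0_bounded_closed)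
  have mon: "K0_bounded (Poly_Mapping.single a 1 :: 'k variety_poly)" for a
  proof (induction a rule: mpoly_induct)
    case (2 S n f)
    have "Poly_Mapping.single (Poly_Mapping.single S n + f) 1 =
        Poly_Mapping.single (Poly_Mapping.single S n) 1 * (Poly_Mapping.single f 1 :: 'k variety_poly)"
      by (simp add: mult_single)
    then show ?case using K0_bounded_closed(6)[OF var 2] by simp
  qed (simp add: K0_bounded_closed)
  show ?thesis
  proof (induction p rule: mpoly_induct)
    case (2 a z f)
    have "Poly_Mapping.single a z = of_int z * (Poly_Mapping.single a 1 :: 'k variety_poly)"
      by (simp add: mult_single flip: single_of_int)
    then have "K0_bounded (Poly_Mapping.single a z)"
      using K0_bounded_closed(6)[OF const mon] by simp
    then show ?case using 2 by (rule K0_bounded_closed)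
  qed (rule K0_bounded_closed)
qed

lemma Mk_fil_bounded: "\<exists>c. Mk_fil c (x :: 'k::field_char_0 Mk)"
proof -
  obtain a n where x: "x = abs_Mk (a, n)"
    by (metis Quotient_abs_rep[OF Quotient_Mk] surj_pair)
  have pw: "Mk_Linv ^ n = abs_Mk (1, n)" for n
    by (induction n)
       (simp_all add: one_Mk_def Mk_Linv_def times_Mk.abs_eq)
  have "x = Mk_of_K0 a * Mk_Linv ^ n"
    by (simp add: x pw Mk_of_K0.abs_eq times_Mk.abs_eq)
  moreover obtain p where "a = abs_K0 p" by (metis Quotient_abs_rep[OF Quotient_K0])
  ultimately show ?thesis
    using K0_bounded_all[of p] Mk_fil_mult_ex Mk_fil_power_ex Mk_fil_Linv
    unfolding K0_bounded_def by metis
qed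

lifting_forget Mk.lifting

definition Mk_cauchy :: "(nat \<Rightarrow> 'k::field_char_0 Mk) \<Rightarrow> bool" where
  "Mk_cauchy s \<longleftrightarrow> (\<forall>N. \<exists>n0. \<forall>i\<ge>n0. \<forall>j\<ge>n0. Mk_fil N (s i - s j))"

definition Mk_null :: "(nat \<Rightarrow> 'k::field_char_0 Mk) \<Rightarrow> bool" where
  "Mk_null s \<longleftrightarrow> (\<forall>N. \<exists>n0. \<forall>i\<ge>n0. Mk_fil N (s i))"

lemma Mk_cauchy_const: "Mk_cauchy (\<lambda>_. c)"
  by (simp add: Mk_cauchy_def Mk_fil.zero)

lemma Mk_null_zero: "Mk_null (\<lambda>_. 0)"
  by (simp add: Mk_null_def Mk_fil.zero)

lemma Mk_null_uminus: "Mk_null s \<Longrightarrow> Mk_null (\<lambda>i. - s i)"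
  unfolding Mk_null_def by (meson Mk_fil.uminus)

lemma Mk_null_add:
  assumes "Mk_null s" "Mk_null t" shows "Mk_null (\<lambda>i. s i + t i)"
  unfolding Mk_null_def
proof
  fix N
  obtain m n where "\<forall>i\<ge>m. Mk_fil N (s i)" "\<forall>i\<ge>n. Mk_fil N (t i)"
    using assms unfolding Mk_null_def by blast
  then have "\<forall>i\<ge>max m n. Mk_fil N (s i + t i)" by (simp add: Mk_fil.add)
  then show "\<exists>n0. \<forall>i\<ge>n0. Mk_fil N (s i + t i)" by blast
qed

lemma Mk_cauchy_uminus:
  assumes "Mk_cauchy s" shows "Mk_cauchy (\<lambda>i. - s i)"
proof -
  have "Mk_fil N (- s i - - s j)" if "Mk_fil N (s i - s j)" for N i j
    using Mk_fil.uminus[OF that] by simp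
  then show ?thesis using assms unfolding Mk_cauchy_def by meson
qed

lemma Mk_cauchy_add:
  assumes "Mk_cauchy s" "Mk_cauchy t" shows "Mk_cauchy (\<lambda>i. s i + t i)"
  unfolding Mk_cauchy_def
proof
  fix N
  obtain m n where "\<forall>i\<ge>m. \<forall>j\<ge>m. Mk_fil N (s i - s j)" "\<forall>i\<ge>n. \<forall>j\<ge>n. Mk_fil N (t i - t j)"
    using assms unfolding Mk_cauchy_def by meson
  then have "\<forall>i\<ge>max m n. \<forall>j\<ge>max m n. Mk_fil N ((s i + t i) - (s j + t j))"
    by (metis Mk_fil.add add_diff_add max.bounded_iff)
  then show "\<exists>n0. \<forall>i\<ge>n0. \<forall>j\<ge>n0. Mk_fil N ((s i + t i) - (s j + t j))" by blast
qed

lemma Mk_cauchy_bounded: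
  assumes "Mk_cauchy s" shows "\<exists>c n0. \<forall>i\<ge>n0. Mk_fil c (s i)"
proof -
  obtain n0 where n0: "\<And>i j. i \<ge> n0 \<Longrightarrow> j \<ge> n0 \<Longrightarrow> Mk_fil 0 (s i - s j)"
    using assms unfolding Mk_cauchy_def by meson
  obtain c where c: "Mk_fil c (s n0)" using Mk_fil_bounded by blast
  have "Mk_fil (min c 0) (s i)" if "i \<ge> n0" for i
  proof -
    have "Mk_fil (min c 0) (s n0 + (s i - s n0))"
      using c n0[OF that order_refl] by (intro Mk_fil.add) (auto elim: Mk_fil_mono)
    then show ?thesis by simp
  qed
  then show ?thesis by blast
qed

lemma Mk_null_mult:
  assumes "Mk_cauchy s" "Mk_null t" shows "Mk_null (\<lambda>i. s i * t i)"
  unfolding Mk_null_def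
proof
  fix N
  obtain c m where c: "\<forall>i\<ge>m. Mk_fil c (s i)" using Mk_cauchy_bounded assms(1) by blast
  obtain n where n: "\<forall>i\<ge>n. Mk_fil (N - c) (t i)" using assms(2) unfolding Mk_null_def by blast
  have "Mk_fil N (s i * t i)" if "i \<ge> max m n" for i
    using Mk_fil.mult[of c "s i" "N - c" "t i"] c n that by simp
  then show "\<exists>n0. \<forall>i\<ge>n0. Mk_fil N (s i * t i)" by blast
qed

lemma Mk_cauchy_mult:
  assumes "Mk_cauchy s" "Mk_cauchy t" shows "Mk_cauchy (\<lambda>i. s i * t i)"
  unfolding Mk_cauchy_def
proof
  fix N
  obtain c m where c: "\<forall>i\<ge>m. Mk_fil c (s i)" using Mk_cauchy_bounded assms(1) by blast
  obtain d n where d: "\<forall>i\<ge>n. Mk_fil d (t i)" using Mk_cauchy_bounded assms(2) by blast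
  obtain p where p: "\<forall>i\<ge>p. \<forall>j\<ge>p. Mk_fil (N - d) (s i - s j)"
    using assms(1) unfolding Mk_cauchy_def by meson
  obtain q where q: "\<forall>i\<ge>q. \<forall>j\<ge>q. Mk_fil (N - c) (t i - t j)"
    using assms(2) unfolding Mk_cauchy_def by meson
  let ?n = "max (max m n) (max p q)"
  have "Mk_fil N (s i * t i - s j * t j)" if "i \<ge> ?n" "j \<ge> ?n" for i j
  proof -
    have "Mk_fil (c + (N - c)) (s i * (t i - t j))" "Mk_fil (N - d + d) ((s i - s j) * t j)"
      by (rule Mk_fil.mult; use that c d p q in simp)+
    then have "Mk_fil N (s i * (t i - t j) + (s i - s j) * t j)"
      by (intro Mk_fil.add) simp_all
    then show ?thesis by (simp add: algebra_simps)
  qed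
  then show "\<exists>n0. \<forall>i\<ge>n0. \<forall>j\<ge>n0. Mk_fil N (s i * t i - s j * t j)" by blast
qed

definition Mhat_eq :: "(nat \<Rightarrow> 'k::field_char_0 Mk) \<Rightarrow> (nat \<Rightarrow> 'k Mk) \<Rightarrow> bool" where
  "Mhat_eq s t \<longleftrightarrow> Mk_cauchy s \<and> Mk_cauchy t \<and> Mk_null (\<lambda>i. s i - t i)"

lemma Mhat_eq_refl: "Mk_cauchy s \<Longrightarrow> Mhat_eq s s"
  by (simp add: Mhat_eq_def Mk_null_zero)

quotient_type (overloaded) 'k Mhat = "nat \<Rightarrow> 'k::field_char_0 Mk" / partial: Mhat_eq
proof (rule part_equivpI)
  show "\<exists>s :: nat \<Rightarrow> 'k Mk. Mhat_eq s s" using Mhat_eq_refl Mk_cauchy_const by blast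
  show "symp (Mhat_eq :: (nat \<Rightarrow> 'k Mk) \<Rightarrow> _)"
  proof (rule sympI)
    fix s t :: "nat \<Rightarrow> 'k Mk"
    assume *: "Mhat_eq s t"
    then have "Mk_null (\<lambda>i. - (s i - t i))" by (intro Mk_null_uminus) (simp add: Mhat_eq_def)
    with * show "Mhat_eq t s" by (simp add: Mhat_eq_def)
  qed
  show "transp (Mhat_eq :: (nat \<Rightarrow> 'k Mk) \<Rightarrow> _)"
  proof (rule transpI)
    fix s t u :: "nat \<Rightarrow> 'k Mk"
    assume *: "Mhat_eq s t" "Mhat_eq t u"
    then have "Mk_null (\<lambda>i. (s i - t i) + (t i - u i))"
      by (intro Mk_null_add) (simp_all add: Mhat_eq_def)
    with * show "Mhat_eq s u" by (simp add: Mhat_eq_def)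
  qed
qed

instantiation Mhat :: (field_char_0) "{comm_ring, comm_monoid_mult}"
begin

lift_definition zero_Mhat :: "'a Mhat" is "\<lambda>_. 0" by (intro Mhat_eq_refl Mk_cauchy_const)
lift_definition one_Mhat :: "'a Mhat" is "\<lambda>_. 1" by (intro Mhat_eq_refl Mk_cauchy_const)
lift_definition plus_Mhat :: "'a Mhat \<Rightarrow> 'a Mhat \<Rightarrow> 'a Mhat" is "\<lambda>s t i. s i + t i"
proof -
  fix s s' t t' :: "nat \<Rightarrow> 'a Mk"
  assume *: "Mhat_eq s s'" "Mhat_eq t t'"
  then have "Mk_null (\<lambda>i. (s i - s' i) + (t i - t' i))"
    by (intro Mk_null_add) (simp_all add: Mhat_eq_def)
  with * show "Mhat_eq (\<lambda>i. s i + t i) (\<lambda>i. s' i + t' i)"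
    by (simp add: Mhat_eq_def Mk_cauchy_add add_diff_add)
qed
lift_definition uminus_Mhat :: "'a Mhat \<Rightarrow> 'a Mhat" is "\<lambda>s i. - s i"
proof -
  fix s s' :: "nat \<Rightarrow> 'a Mk"
  assume *: "Mhat_eq s s'"
  then have "Mk_null (\<lambda>i. - (s i - s' i))" by (intro Mk_null_uminus) (simp add: Mhat_eq_def)
  with * show "Mhat_eq (\<lambda>i. - s i) (\<lambda>i. - s' i)"
    by (simp add: Mhat_eq_def Mk_cauchy_uminus minus_diff_minus)
qed
definition minus_Mhat :: "'a Mhat \<Rightarrow> 'a Mhat \<Rightarrow> 'a Mhat" where "minus_Mhat x y = x + (- y)"
lift_definition times_Mhat :: "'a Mhat \<Rightarrow> 'a Mhat \<Rightarrow> 'a Mhat" is "\<lambda>s t i. s i * t i"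
proof -
  fix s s' t t' :: "nat \<Rightarrow> 'a Mk"
  assume *: "Mhat_eq s s'" "Mhat_eq t t'"
  then have "Mk_null (\<lambda>i. t i * (s i - s' i) + s' i * (t i - t' i))"
    by (intro Mk_null_add Mk_null_mult) (simp_all add: Mhat_eq_def)
  moreover have "t i * (s i - s' i) + s' i * (t i - t' i) = s i * t i - s' i * t' i" for i
    by (simp add: algebra_simps)
  ultimately show "Mhat_eq (\<lambda>i. s i * t i) (\<lambda>i. s' i * t' i)"
    using * by (simp add: Mhat_eq_def Mk_cauchy_mult)
qed

instance
proof
  have eqI: "Mhat_eq s t" if "Mk_cauchy s" "s = t" for s t :: "nat \<Rightarrow> 'a Mk"
    using that by (simp add: Mhat_eq_refl)
  have c: "Mk_cauchy s" if "Mhat_eq s s" for s :: "nat \<Rightarrow> 'a Mk"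
    using that by (simp add: Mhat_eq_def)
  note cs = c Mk_cauchy_add Mk_cauchy_mult Mk_cauchy_uminus Mk_cauchy_const
  fix x y z :: "'a Mhat"
  show "x + y + z = x + (y + z)" by transfer (rule eqI, intro cs, auto simp: add.assoc)
  show "x + y = y + x" by transfer (rule eqI, intro cs, auto simp: add.commute)
  show "0 + x = x" by transfer (rule eqI, intro cs, auto)
  show "- x + x = 0" by transfer (rule eqI, intro cs, auto)
  show "x - y = x + - y" by (simp add: minus_Mhat_def)
  show "x * y * z = x * (y * z)" by transfer (rule eqI, intro cs, auto simp: mult.assoc)
  show "x * y = y * x" by transfer (rule eqI, intro cs, auto simp: mult.commute)
  show "1 * x = x" by transfer (rule eqI, intro cs, auto)
  show "(x + y) * z = x * z + y * z" by transfer (rule eqI, intro cs, auto simp: distrib_right)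
qed

end

lift_definition Mhat_of_Mk :: "'k::field_char_0 Mk \<Rightarrow> 'k Mhat" is "\<lambda>a _. a"
  by (intro Mhat_eq_refl Mk_cauchy_const)

text \<open>The closures of the steps of the filtration are a neighbourhood basis of \<open>0\<close>.\<close>

definition Mhat_fil :: "int \<Rightarrow> 'k::field_char_0 Mhat \<Rightarrow> bool" where
  "Mhat_fil N x \<longleftrightarrow> (\<exists>s. Mk_cauchy s \<and> x = abs_Mhat s \<and> (\<forall>i. Mk_fil N (s i)))"

lemma Mhat_fil_zero: "Mhat_fil N 0"
  unfolding Mhat_fil_def zero_Mhat_def using Mk_cauchy_const Mk_fil.zero by blast

lemma Mhat_fil_add: "Mhat_fil N x \<Longrightarrow> Mhat_fil N y \<Longrightarrow> Mhat_fil N (x + y)"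
  unfolding Mhat_fil_def
  by (metis (no_types, lifting) Mhat_eq_refl Mk_cauchy_add Mk_fil.add plus_Mhat.abs_eq)

lemma Mhat_fil_uminus: "Mhat_fil N x \<Longrightarrow> Mhat_fil N (- x)"
  unfolding Mhat_fil_def
  by (metis (no_types, lifting) Mhat_eq_refl Mk_cauchy_uminus Mk_fil.uminus uminus_Mhat.abs_eq)

lemma Mhat_fil_mono: "Mhat_fil N x \<Longrightarrow> M \<le> N \<Longrightarrow> Mhat_fil M x"
  unfolding Mhat_fil_def using Mk_fil_mono by blast

lemma Mhat_fil_separated:
  assumes "\<And>N. Mhat_fil N x" shows "x = 0"
proof -
  obtain s where s: "Mk_cauchy s" "x = abs_Mhat s"
    using assms unfolding Mhat_fil_def by blast
  have "Mk_null s"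
    unfolding Mk_null_def
  proof
    fix N
    obtain t where t: "Mk_cauchy t" "x = abs_Mhat t" "\<And>i. Mk_fil N (t i)"
      using assms unfolding Mhat_fil_def by blast
    have "Mhat_eq s t"
      using s t Mhat_eq_refl Quotient_rel[OF Quotient_Mhat] by metis
    then obtain n0 where n0: "\<And>i. i \<ge> n0 \<Longrightarrow> Mk_fil N (s i - t i)"
      unfolding Mhat_eq_def Mk_null_def by blast
    have "Mk_fil N (s i)" if "i \<ge> n0" for i
      using Mk_fil.add[OF n0[OF that] t(3)[of i]] by simp
    then show "\<exists>n0. \<forall>i\<ge>n0. Mk_fil N (s i)" by blast
  qed
  then have "Mhat_eq s (\<lambda>_. 0)" using s by (simp add: Mhat_eq_def Mk_cauchy_const)
  then show ?thesis unfolding s(2) zero_Mhat_def by (rule Quotient_rel_abs[OF Quotient_Mhat])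
qed

instantiation Mhat :: (field_char_0) t2_space
begin

definition open_Mhat :: "'a Mhat set \<Rightarrow> bool" where
  "open_Mhat U \<longleftrightarrow> (\<forall>x\<in>U. \<exists>N. \<forall>y. Mhat_fil N (y - x) \<longrightarrow> y \<in> U)"

instance
proof
  show "open (UNIV :: 'a Mhat set)" by (simp add: open_Mhat_def)
next
  fix S T :: "'a Mhat set"
  assume S: "open S" and T: "open T"
  show "open (S \<inter> T)"
    unfolding open_Mhat_def
  proof
    fix x assume "x \<in> S \<inter> T"
    then obtain M N where "\<forall>y. Mhat_fil M (y - x) \<longrightarrow> y \<in> S" "\<forall>y. Mhat_fil N (y - x) \<longrightarrow> y \<in> T"
      using S T unfolding open_Mhat_def by blast
    then have "\<forall>y. Mhat_fil (max M N) (y - x) \<longrightarrow> y \<in> S \<inter> T"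
      by (metis Int_iff Mhat_fil_mono max.cobounded1 max.cobounded2)
    then show "\<exists>N. \<forall>y. Mhat_fil N (y - x) \<longrightarrow> y \<in> S \<inter> T" by blast
  qed
next
  fix K :: "'a Mhat set set"
  assume "\<forall>S\<in>K. open S"
  then show "open (\<Union>K)" unfolding open_Mhat_def by (meson Union_iff)
next
  fix x y :: "'a Mhat"
  assume "x \<noteq> y"
  then obtain N where N: "\<not> Mhat_fil N (y - x)" using Mhat_fil_separated by (metis eq_iff_diff_eq_0)
  have o: "open {z. Mhat_fil N (z - a)}" for a :: "'a Mhat"
    unfolding open_Mhat_def
  proof
    fix z assume "z \<in> {z. Mhat_fil N (z - a)}"
    then have "Mhat_fil N (w - a)" if "Mhat_fil N (w - z)" for w
      using Mhat_fil_add[OF that, of "z - a"] by simp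
    then show "\<exists>M. \<forall>w. Mhat_fil M (w - z) \<longrightarrow> w \<in> {z. Mhat_fil N (z - a)}" by blast
  qed
  have "False" if "Mhat_fil N (z - x)" "Mhat_fil N (z - y)" for z
    using Mhat_fil_add[OF that(1) Mhat_fil_uminus[OF that(2)]] N by simp
  then have "{z. Mhat_fil N (z - x)} \<inter> {z. Mhat_fil N (z - y)} = {}" by blast
  then show "\<exists>U V. open U \<and> open V \<and> x \<in> U \<and> y \<in> V \<and> U \<inter> V = {}"
    using o Mhat_fil_zero
    by (intro exI[of _ "{z. Mhat_fil N (z - x)}"] exI[of _ "{z. Mhat_fil N (z - y)}"]) auto
qed

end

lifting_forget Mhat.lifting

definition mclass :: "('p, 'k::field_char_0 alg_closure) fspace \<Rightarrow> 'k Mhat" where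
  "mclass X = Mhat_of_Mk (Mk_of_K0 (K0_class X))"

definition LL :: "'k::field_char_0 Mhat" where
  "LL = Mhat_of_Mk (Mk_of_K0 K0_L)"

definition Linv :: "'k::field_char_0 Mhat" where
  "Linv = Mhat_of_Mk Mk_Linv"


section \<open>Arcs on affine space and the motivic zeta function\<close>

text \<open>Constructible subsets of affine space, and their classes.\<close>

definition locally_closedin :: "'p topology \<Rightarrow> 'p set \<Rightarrow> bool" where
  "locally_closedin T S \<longleftrightarrow> (\<exists>U C. openin T U \<and> closedin T C \<and> S = U \<inter> C)"

definition constructible :: "'i set \<Rightarrow> ('i \<Rightarrow> 'k::field_char_0 alg_closure) set \<Rightarrow> bool" where
  "constructible I C \<longleftrightarrow> (\<exists>\<P>. finite \<P> \<and> \<Union>\<P> = C \<and> (\<forall>S\<in>\<P>. locally_closedin (zariski I) S))"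

definition constructible_class ::
    "'i set \<Rightarrow> ('i \<Rightarrow> 'k::field_char_0 alg_closure) set \<Rightarrow> 'k K0" where
  "constructible_class I C =
     (THE c. \<exists>\<P>. finite \<P> \<and> disjoint \<P> \<and> \<Union>\<P> = C \<and>
               (\<forall>S\<in>\<P>. locally_closedin (zariski I) S) \<and>
               c = (\<Sum>S\<in>\<P>. K0_class (fsub (aff_space I) S)))"

text \<open>
  Arcs on \<open>d\<close>-dimensional affine space, \<open>d = CARD('n)\<close>, with coefficients in the algebraic
  closure of \<open>k\<close>.  Their truncations at level \<open>n\<close> are the points of an affine space of dimension
  \<open>(n + 1) d\<close>.
\<close>

type_synonym ('n, 'k) arc = "'n \<Rightarrow> 'k alg_closure fps"

definition arc_trunc :: "nat \<Rightarrow> ('n, 'k::field_char_0) arc \<Rightarrow> ('n \<times> nat \<Rightarrow> 'k alg_closure)" where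
  "arc_trunc n \<gamma> = (\<lambda>(j, i). if i \<le> n then fps_nth (\<gamma> j) i else 0)"

text \<open>
  The motivic measure of a cylinder, normalised so that the set of all arcs has measure
  \<open>1\<close>.  The value is meaningful for cylinders only, and does not depend on the level \<open>n\<close>; the
  sets \<open>contact_arcs\<close> below are cylinders.
\<close>

definition motivic_measure :: "('n::finite, 'k::field_char_0) arc set \<Rightarrow> 'k Mk" where
  "motivic_measure A =
     (THE c. \<exists>n C. constructible (UNIV \<times> {..n}) C \<and> A = {\<gamma>. arc_trunc n \<gamma> \<in> C} \<and>
               c = Mk_of_K0 (constructible_class (UNIV \<times> {..n}) C)
                     * Mk_Linv ^ ((n + 1) * CARD('n)))"

definition has_order :: "'a::zero fps \<Rightarrow> nat \<Rightarrow> bool" where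
  "has_order F n \<longleftrightarrow> F \<noteq> 0 \<and> subdegree F = n"

text \<open>
  \<open>h \<circ> \<gamma>\<close> and \<open>\<omega> \<circ> \<gamma>\<close>, where \<open>\<nu>\<close> is the family of exponents (plus one)
  of the differential form \<open>\<omega>\<close>.
\<close>

definition comp_arc ::
    "('n, 'k::field_char_0) mpoly \<Rightarrow> ('n, 'k) arc \<Rightarrow> 'k alg_closure fps" where
  "comp_arc h \<gamma> = mp_eval (\<lambda>c. fps_const (to_ac c)) h \<gamma>"

definition form_arc :: "('n::finite \<Rightarrow> nat) \<Rightarrow> ('n, 'k::field_char_0) arc \<Rightarrow> 'k alg_closure fps" where
  "form_arc \<nu> \<gamma> = (\<Prod>j\<in>UNIV. \<gamma> j ^ (\<nu> j - 1))"

definition contact_arcs ::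
    "('n::finite, 'k::field_char_0) mpoly \<Rightarrow> ('n \<Rightarrow> nat) \<Rightarrow> nat \<Rightarrow> nat \<Rightarrow> ('n, 'k) arc set" where
  "contact_arcs h \<nu> n m =
     {\<gamma>. (\<forall>j. fps_nth (\<gamma> j) 0 = 0) \<and> has_order (comp_arc h \<gamma>) n \<and> has_order (form_arc \<nu> \<gamma>) m}"

definition Z_DL ::
    "('n::finite, 'k::field_char_0) mpoly \<Rightarrow> ('n \<Rightarrow> nat) \<Rightarrow> 'k Mhat fps" where
  "Z_DL h \<nu> = Abs_fps (\<lambda>n. \<Sum>\<^sub>\<infinity>m. Linv ^ m * Mhat_of_Mk (motivic_measure (contact_arcs h \<nu> n m)))"


section \<open>Newton polyhedra\<close>

definition exponent_vec :: "('n::finite \<Rightarrow>\<^sub>0 nat) \<Rightarrow> real ^ 'n" where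
  "exponent_vec a = (\<chi> i. real (poly_mapping.lookup a i))"

definition newton_polyhedron :: "('n::finite, 'k::zero) mpoly \<Rightarrow> (real ^ 'n) set" where
  "newton_polyhedron h =
     convex hull (\<Union>a\<in>Poly_Mapping.keys h. {exponent_vec a + v | v. \<forall>i. 0 \<le> v $ i})"

text \<open>
  The empty face has to be left out: its face polynomial is \<open>0\<close>, which would make every
  polynomial degenerate.
\<close>

definition compact_faces :: "('n::finite, 'k::zero) mpoly \<Rightarrow> (real ^ 'n) set set" where
  "compact_faces h = {\<tau>. \<tau> face_of newton_polyhedron h \<and> \<tau> \<noteq> {} \<and> compact \<tau>}"

definition face_poly ::
    "('n::finite, 'k::comm_ring_1) mpoly \<Rightarrow> (real ^ 'n) set \<Rightarrow> ('n, 'k) mpoly" where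
  "face_poly h \<tau> =
     (\<Sum>a | a \<in> Poly_Mapping.keys h \<and> exponent_vec a \<in> \<tau>.
        Poly_Mapping.single a (poly_mapping.lookup h a))"

definition torus :: "('n \<Rightarrow> 'k::field_char_0 alg_closure) set" where
  "torus = {x. \<forall>i. x i \<noteq> 0}"

text \<open>
  A subscheme of the torus is empty iff it has no point over the algebraic closure.
\<close>

definition nondegenerate :: "('n::finite, 'k::field_char_0) mpoly \<Rightarrow> bool" where
  "nondegenerate h \<longleftrightarrow>
     (\<forall>\<tau>\<in>compact_faces h.
        {x \<in> torus. \<forall>i. mp_eval to_ac (mp_deriv i (face_poly h \<tau>)) x = 0} = {})"

definition newton_min :: "('n::finite, 'k::zero) mpoly \<Rightarrow> real ^ 'n \<Rightarrow> real" where
  "newton_min h k = (INF x\<in>newton_polyhedron h. k \<bullet> x)"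

definition newton_face :: "('n::finite, 'k::zero) mpoly \<Rightarrow> real ^ 'n \<Rightarrow> (real ^ 'n) set" where
  "newton_face h k = {x \<in> newton_polyhedron h. k \<bullet> x = newton_min h k}"

definition dual_cone ::
    "('n::finite, 'k::zero) mpoly \<Rightarrow> (real ^ 'n) set \<Rightarrow> (real ^ 'n) set" where
  "dual_cone h \<tau> = {k. (\<forall>i. 0 \<le> k $ i) \<and> newton_face h k = \<tau>}"

definition nat_vec :: "('n::finite \<Rightarrow> nat) \<Rightarrow> real ^ 'n" where
  "nat_vec k = (\<chi> i. real (k i))"

text \<open>The sum over the cone need not be finite in a given degree of \<open>T\<close>.\<close>

definition S_series ::
    "('n::finite, 'k::field_char_0) mpoly \<Rightarrow> ('n \<Rightarrow> nat) \<Rightarrow> (real ^ 'n) set \<Rightarrow> 'k Mhat fps" where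
  "S_series h \<nu> \<tau> = Abs_fps (\<lambda>n.
     \<Sum>\<^sub>\<infinity>k\<in>{k. (\<forall>i. 0 < k i) \<and> nat_vec k \<in> dual_cone h \<tau> \<and> newton_min h (nat_vec k) = real n}.
       Linv ^ (\<Sum>j\<in>UNIV. \<nu> j * k j))"

definition N_class :: "('n::finite, 'k::field_char_0) mpoly \<Rightarrow> (real ^ 'n) set \<Rightarrow> 'k Mhat" where
  "N_class h \<tau> =
     mclass (fsub (aff_space UNIV) {x \<in> torus. mp_eval to_ac (face_poly h \<tau>) x = 0})"

text \<open>\<open>geom_fps c = 1 / (1 - c T)\<close>\<close>

definition geom_fps :: "'a::monoid_mult \<Rightarrow> 'a fps" where
  "geom_fps c = Abs_fps (\<lambda>n. c ^ n)"

lemma geom_fps_inverse: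
  fixes c :: "'a::{comm_ring, comm_monoid_mult}"
  shows "(1 - fps_const c * fps_X) * geom_fps c = 1"
proof (rule fps_ext)
  fix n
  have X: "fps_nth (fps_const c * fps_X) i = (if i = 1 then c else 0)" for i
    by (simp add: fps_mult_left_const_nth)
  show "fps_nth ((1 - fps_const c * fps_X) * geom_fps c) n = fps_nth 1 n"
  proof (cases n)
    case 0
    then show ?thesis by (simp add: fps_mult_nth X geom_fps_def)
  next
    case (Suc m)
    have "fps_nth ((1 - fps_const c * fps_X) * geom_fps c) n =
        (\<Sum>i\<in>{0, 1}. fps_nth (1 - fps_const c * fps_X) i * c ^ (n - i))"
      unfolding fps_mult_nth geom_fps_def fps_nth_Abs_fps
      by (rule sum.mono_neutral_right) (auto simp: X Suc)
    also have "\<dots> = 0" by (simp add: X Suc)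
    finally show ?thesis using Suc by simp
  qed
qed

definition L_series :: "('n::finite, 'k::field_char_0) mpoly \<Rightarrow> (real ^ 'n) set \<Rightarrow> 'k Mhat fps" where
  "L_series h \<tau> =
     fps_const (Linv ^ CARD('n) * ((LL - 1) ^ CARD('n) - N_class h \<tau>)) +
     fps_const (Linv ^ CARD('n) * (LL - 1) * N_class h \<tau>) *
       ((fps_const Linv * fps_X) * geom_fps Linv)"

end

(* Let an arc have orders k_1, ..., k_d >= 1, so that its j-th component is t^(k_j) u_j with u_j a
   unit. Then h of the arc is t^m (h_tau(u(0)) + O(t)), where m is the minimum of k on the Newton
   polyhedron and tau the face where it is attained. If h_tau(u(0)) is nonzero, the contact order is
   m. Otherwise some partial derivative of h_tau is invertible at u(0), and the coefficient of
   t^(m+i) is, for every i >= 1, linear with invertible coefficient in a coordinate of u that does not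
   enter the lower coefficients; eliminating these coordinates one after the other computes the
   measure of the arcs of contact order m + l with h.

   If some N_j = 0, then infinitely many k contribute to one power of T. Orders are therefore capped:
   the orders larger than a bound B >= n are not distinguished. The pieces with a capped order are
   computed by the same elimination, in affine instead of punctured lines; they are L^(-B) times
   elements of a finite set and vanish in the limit B -> infinity.

   Additivity of the class under decompositions into locally closed sets, without which the motivic
   measure is not well defined, needs that such sets are varieties, and this rests on Hilbert's basis
   theorem. *)
theory Submission
  imports Defs
begin

text \<open>Which partial derivative of h_tau is invertible varies from point to point, so the zeros
  of h_tau are stratified by the set of partial derivatives that do not vanish; on one stratum the
  same variable serves for every elimination. The cap B is at least n because an exponent of weight
  at most n then cannot involve a variable of capped order: h_tau does not contain these variables,
  setting them to 1 leads back into the torus, and non-degeneracy applies. The same bound forces N_j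
  = 0, hence nu_j = 1, for a capped variable, so that omega has a definite order although that of
  the component is unknown. Classes and measure are given by choice and by definite description. To
  make them computable, all sets are treated as subsets of spaces of families, with a structure that
  depends on the set alone, and the isomorphisms are explicit changes of coordinates; the product
  relation is applied only when one factor is a line. The left side does not depend on B, so a
  constant is compared with sums over growing boxes of orders.\<close>

(* As a simp rule it reverses mult.assoc, so that algebra_simps would loop. *)
declare self_module.scale_scale [simp del]


section \<open>Polynomial functions\<close>

text \<open>The target ring is arbitrary: points over the algebraic closure and tuples of power
  series are both substituted.\<close>

definition monomial_at :: "('i \<Rightarrow>\<^sub>0 nat) \<Rightarrow> ('i \<Rightarrow> 'r::comm_ring_1) \<Rightarrow> 'r" where
  "monomial_at a x = (\<Prod>i\<in>Poly_Mapping.keys a. x i ^ poly_mapping.lookup a i)"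

lemma monomial_at_superset:
  assumes "finite A" "Poly_Mapping.keys a \<subseteq> A"
  shows "monomial_at a x = (\<Prod>i\<in>A. x i ^ poly_mapping.lookup a i)"
  unfolding monomial_at_def by (rule prod.mono_neutral_left) (use assms in \<open>auto simp: in_keys_iff\<close>)

lemma monomial_at_add: "monomial_at (a + b) x = monomial_at a x * monomial_at b x"
proof -
  let ?A = "Poly_Mapping.keys a \<union> Poly_Mapping.keys b"
  have "monomial_at (a + b) x = (\<Prod>i\<in>?A. x i ^ poly_mapping.lookup (a + b) i)"
    by (rule monomial_at_superset) (use Poly_Mapping.keys_add[of a b] in auto)
  also have "\<dots> = (\<Prod>i\<in>?A. x i ^ poly_mapping.lookup a i) * (\<Prod>i\<in>?A. x i ^ poly_mapping.lookup b i)"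
    by (simp add: lookup_add power_add prod.distrib)
  also have "\<dots> = monomial_at a x * monomial_at b x"
    by (simp add: monomial_at_superset[of ?A])
  finally show ?thesis .
qed

lemma monomial_at_0 [simp]: "monomial_at 0 x = 1"
  by (simp add: monomial_at_def)

lemma monomial_at_single [simp]: "monomial_at (Poly_Mapping.single i n) x = x i ^ n"
  by (cases "n = 0") (simp_all add: monomial_at_def)

locale coeff_hom =
  fixes c :: "'k::comm_ring_1 \<Rightarrow> 'r::comm_ring_1"
  assumes c_0 [simp]: "c 0 = 0" and c_1 [simp]: "c 1 = 1"
    and c_add: "c (a + b) = c a + c b" and c_mult: "c (a * b) = c a * c b"
begin

lemma eval_superset:
  assumes "finite A" "Poly_Mapping.keys p \<subseteq> A"
  shows "mp_eval c p x = (\<Sum>a\<in>A. c (poly_mapping.lookup p a) * monomial_at a x)"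
  unfolding mp_eval_def monomial_at_def[symmetric]
  by (rule sum.mono_neutral_left) (use assms in \<open>auto simp: in_keys_iff\<close>)

lemma eval_add: "mp_eval c (p + q) x = mp_eval c p x + mp_eval c q x"
proof -
  let ?A = "Poly_Mapping.keys p \<union> Poly_Mapping.keys q"
  have "mp_eval c (p + q) x = (\<Sum>a\<in>?A. c (poly_mapping.lookup (p + q) a) * monomial_at a x)"
    by (rule eval_superset) (use Poly_Mapping.keys_add[of p q] in auto)
  also have "\<dots> = (\<Sum>a\<in>?A. c (poly_mapping.lookup p a) * monomial_at a x)
      + (\<Sum>a\<in>?A. c (poly_mapping.lookup q a) * monomial_at a x)"
    by (simp add: lookup_add c_add distrib_right sum.distrib)
  also have "\<dots> = mp_eval c p x + mp_eval c q x"
    by (simp add: eval_superset[of ?A])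
  finally show ?thesis .
qed

lemma eval_single: "mp_eval c (Poly_Mapping.single a r) x = c r * monomial_at a x"
  by (subst eval_superset[of "{a}"]) auto

lemma eval_0 [simp]: "mp_eval c 0 x = 0"
  by (simp add: mp_eval_def)

lemma eval_mvar [simp]: "mp_eval c (mvar i) x = x i"
  by (simp add: mvar_def eval_single)

lemma eval_mult: "mp_eval c (p * q) x = mp_eval c p x * mp_eval c q x"
proof (induction p rule: mpoly_induct)
  case (2 a r p)
  have "mp_eval c (Poly_Mapping.single a r * q) x = mp_eval c (Poly_Mapping.single a r) x * mp_eval c q x"
  proof (induction q rule: mpoly_induct)
    case (2 b s q)
    have "mp_eval c (Poly_Mapping.single a r * (Poly_Mapping.single b s + q)) x
        = c (r * s) * monomial_at (a + b) x + mp_eval c (Poly_Mapping.single a r * q) x"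
      unfolding distrib_left mult_single eval_add eval_single ..
    also have "\<dots> = (c r * monomial_at a x) * (c s * monomial_at b x) + (c r * monomial_at a x) * mp_eval c q x"
      unfolding 2 monomial_at_add c_mult eval_single by (simp only: mult_ac)
    finally show ?case unfolding eval_add eval_single distrib_left .
  qed simp
  then show ?case using 2 unfolding distrib_right eval_add by simp
qed simp

lemma eval_sum: "mp_eval c (\<Sum>i\<in>A. p i) x = (\<Sum>i\<in>A. mp_eval c (p i) x)"
  by (induction A rule: infinite_finite_induct) (simp_all add: eval_add)

lemma eval_uminus: "mp_eval c (- p) x = - mp_eval c p x"
  by (metis add_eq_0_iff eval_0 eval_add neg_eq_iff_add_eq_0)

end

interpretation to_ac: coeff_hom "to_ac :: 'k::field_char_0 \<Rightarrow> 'k alg_closure"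
  by standard simp_all

interpretation fps_ac: coeff_hom "\<lambda>c :: 'k::field_char_0. fps_const (to_ac c)"
  by standard (simp_all add: fps_const_add fps_const_mult)

text \<open>Functions instead of polynomials: varieties are given by their points, so only values
  matter, and substitution becomes composition. The index type may be infinite.\<close>

definition PF :: "(('i \<Rightarrow> 'k::field_char_0 alg_closure) \<Rightarrow> 'k alg_closure) set" where
  "PF = range (mp_eval to_ac)"

lemma PF_const: "(\<lambda>_. to_ac c) \<in> PF"
  unfolding PF_def by (rule range_eqI[of _ _ "Poly_Mapping.single 0 c"]) (auto simp: to_ac.eval_single)

lemma PF_0: "(\<lambda>_. 0) \<in> PF" and PF_1: "(\<lambda>_. 1) \<in> PF"
  using PF_const[of 0] PF_const[of 1] by simp_all

lemma PF_var: "(\<lambda>x. x i) \<in> PF"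
  unfolding PF_def by (rule range_eqI[of _ _ "mvar i"]) auto

lemma PF_I: "(\<And>x. f x = mp_eval to_ac p x) \<Longrightarrow> f \<in> PF"
  unfolding PF_def by (rule range_eqI[of _ _ p]) auto

lemma PF_E: "f \<in> PF \<Longrightarrow> (\<And>p. f = mp_eval to_ac p \<Longrightarrow> thesis) \<Longrightarrow> thesis"
  unfolding PF_def by blast

lemma PF_add: "f \<in> PF \<Longrightarrow> g \<in> PF \<Longrightarrow> (\<lambda>x. f x + g x) \<in> PF"
  by (elim PF_E, rule PF_I[of _ "p + q" for p q]) (simp only: to_ac.eval_add)

lemma PF_mult: "f \<in> PF \<Longrightarrow> g \<in> PF \<Longrightarrow> (\<lambda>x. f x * g x) \<in> PF"
  by (elim PF_E, rule PF_I[of _ "p * q" for p q]) (simp only: to_ac.eval_mult)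

lemma PF_uminus: "f \<in> PF \<Longrightarrow> (\<lambda>x. - f x) \<in> PF"
  by (elim PF_E, rule PF_I[of _ "- p" for p]) (simp only: to_ac.eval_uminus)

lemma PF_diff: "f \<in> PF \<Longrightarrow> g \<in> PF \<Longrightarrow> (\<lambda>x. f x - g x) \<in> PF"
  using PF_add[OF _ PF_uminus, of f g] by simp

lemma PF_sum: "(\<And>i. i \<in> A \<Longrightarrow> f i \<in> PF) \<Longrightarrow> (\<lambda>x. \<Sum>i\<in>A. f i x) \<in> PF"
  by (induction A rule: infinite_finite_induct) (auto intro: PF_0 PF_add)

lemma PF_prod: "(\<And>i. i \<in> A \<Longrightarrow> f i \<in> PF) \<Longrightarrow> (\<lambda>x. \<Prod>i\<in>A. f i x) \<in> PF"
  by (induction A rule: infinite_finite_induct) (auto intro: PF_1 PF_mult)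

lemma PF_power: "f \<in> PF \<Longrightarrow> (\<lambda>x. f x ^ n) \<in> PF"
  by (induction n) (auto intro: PF_1 PF_mult)

lemma PF_mp_eval: "mp_eval to_ac p \<in> PF"
  by (simp add: PF_def)

text \<open>The closure principle behind all substitutions: a set of functions that contains the
  constants from \<open>k\<close> and is closed under sums and products contains every polynomial in
  its members. It is applied to \<open>PF\<close>, to \<open>locrat\<close>, to the functions
  represented in a Noetherian ring and to sums of products on a product space.\<close>

lemma PF_compose_in:
  assumes g: "g \<in> PF" and const: "\<And>c. (\<lambda>_. to_ac c) \<in> R"
    and add: "\<And>f1 f2. f1 \<in> R \<Longrightarrow> f2 \<in> R \<Longrightarrow> (\<lambda>x. f1 x + f2 x) \<in> R"
    and mult: "\<And>f1 f2. f1 \<in> R \<Longrightarrow> f2 \<in> R \<Longrightarrow> (\<lambda>x. f1 x * f2 x) \<in> R"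
    and u: "\<And>i. (\<lambda>x. u x i) \<in> R"
  shows "(\<lambda>x. g (u x)) \<in> R"
proof -
  have 0: "(\<lambda>_. 0) \<in> R" and 1: "(\<lambda>_. 1) \<in> R" using const[of 0] const[of 1] by simp_all
  have pow: "(\<lambda>x. u x i ^ n) \<in> R" for i n
  proof (induction n)
    case (Suc n)
    from mult[OF u Suc] show ?case by simp
  qed (simp add: 1)
  have prod: "(\<lambda>x. \<Prod>i\<in>A. u x i ^ n i) \<in> R" for A n
  proof (induction A rule: infinite_finite_induct)
    case (insert i A)
    from mult[OF pow insert(3)] insert(1,2) show ?case by simp
  qed (simp_all add: 1)
  have sum: "(\<lambda>x. \<Sum>a\<in>A. to_ac (l a) * (\<Prod>i\<in>Poly_Mapping.keys a. u x i ^ poly_mapping.lookup a i)) \<in> R" for A l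
  proof (induction A rule: infinite_finite_induct)
    case (insert a A)
    from add[OF mult[OF const prod] insert(3)] insert(1,2) show ?case by simp
  qed (simp_all add: 0)
  obtain p where "g = mp_eval to_ac p" using g by (rule PF_E)
  then show ?thesis
    using sum[of "poly_mapping.lookup p" "Poly_Mapping.keys p"] by (simp add: mp_eval_def)
qed

lemma PF_compose:
  assumes "g \<in> PF" "\<And>i. (\<lambda>x. u x i) \<in> PF" shows "(\<lambda>x. g (u x)) \<in> PF"
  using assms(1)
proof (rule PF_compose_in)
  show "(\<lambda>_. to_ac c) \<in> PF" for c by (rule PF_const)
qed (rule PF_add PF_mult assms(2); assumption?)+

lemmas PF_intros = PF_const PF_0 PF_1 PF_var PF_add PF_mult PF_uminus PF_diff PF_sum PF_prod
  PF_power PF_mp_eval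


section \<open>Quasi-affine spaces\<close>

text \<open>The topology induced on an arbitrary set S of points by non-vanishing loci. No ambient
  affine space enters, so that open, closed and locally closed subsets are treated alike.\<close>

definition zopen :: "('i \<Rightarrow> 'k::field_char_0 alg_closure) set \<Rightarrow> ('i \<Rightarrow> 'k alg_closure) set \<Rightarrow> bool" where
  "zopen S V \<longleftrightarrow> V \<subseteq> S \<and> (\<forall>p\<in>V. \<exists>b\<in>PF. b p \<noteq> 0 \<and> (\<forall>q\<in>S. b q \<noteq> 0 \<longrightarrow> q \<in> V))"

lemma zopenI:
  "V \<subseteq> S \<Longrightarrow> (\<And>p. p \<in> V \<Longrightarrow> \<exists>b\<in>PF. b p \<noteq> 0 \<and> (\<forall>q\<in>S. b q \<noteq> 0 \<longrightarrow> q \<in> V)) \<Longrightarrow> zopen S V"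
  by (auto simp: zopen_def)

lemma zopenE:
  assumes "zopen S V" "p \<in> V"
  obtains b where "b \<in> PF" "b p \<noteq> 0" "\<And>q. q \<in> S \<Longrightarrow> b q \<noteq> 0 \<Longrightarrow> q \<in> V"
  using assms unfolding zopen_def by blast

lemma zopenD: "zopen S V \<Longrightarrow> V \<subseteq> S"
  by (auto simp: zopen_def)

lemma zopen_basic: "b \<in> PF \<Longrightarrow> zopen S {x \<in> S. b x \<noteq> 0}"
  unfolding zopen_def by blast

lemma zopen_self: "zopen S S"
  using zopen_basic[OF PF_1, of S] by simp

lemma zopen_Int:
  assumes "zopen S U" "zopen S V" shows "zopen S (U \<inter> V)"
proof (rule zopenI)
  fix p assume "p \<in> U \<inter> V"
  then have p: "p \<in> U" "p \<in> V" by auto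
  obtain b where b: "b \<in> PF" "b p \<noteq> 0" "\<And>q. q \<in> S \<Longrightarrow> b q \<noteq> 0 \<Longrightarrow> q \<in> U"
    by (rule zopenE[OF assms(1) p(1)]) (rule that)
  obtain c where c: "c \<in> PF" "c p \<noteq> 0" "\<And>q. q \<in> S \<Longrightarrow> c q \<noteq> 0 \<Longrightarrow> q \<in> V"
    by (rule zopenE[OF assms(2) p(2)]) (rule that)
  show "\<exists>b\<in>PF. b p \<noteq> 0 \<and> (\<forall>q\<in>S. b q \<noteq> 0 \<longrightarrow> q \<in> U \<inter> V)"
    using b c by (intro bexI[of _ "\<lambda>x. b x * c x"]) (auto intro: PF_mult)
qed (use zopenD[OF assms(1)] in auto)

lemma zopen_Union:
  assumes "\<And>U. U \<in> \<U> \<Longrightarrow> zopen S U" shows "zopen S (\<Union>\<U>)"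
proof (rule zopenI)
  fix p assume "p \<in> \<Union>\<U>"
  then obtain U where U: "U \<in> \<U>" "p \<in> U" by blast
  then obtain b where "b \<in> PF" "b p \<noteq> 0" "\<forall>q\<in>S. b q \<noteq> 0 \<longrightarrow> q \<in> U"
    using assms unfolding zopen_def by blast
  then show "\<exists>b\<in>PF. b p \<noteq> 0 \<and> (\<forall>q\<in>S. b q \<noteq> 0 \<longrightarrow> q \<in> \<Union>\<U>)"
    using U by (intro bexI[of _ b]) auto
qed (use assms in \<open>auto simp: zopen_def\<close>)

lemma zopen_trans:
  assumes "zopen S U" "zopen U V" shows "zopen S V"
proof (rule zopenI)
  fix p assume p: "p \<in> V"
  then have pU: "p \<in> U" using zopenD[OF assms(2)] by blast
  obtain b where b: "b \<in> PF" "b p \<noteq> 0" "\<And>q. q \<in> S \<Longrightarrow> b q \<noteq> 0 \<Longrightarrow> q \<in> U"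
    by (rule zopenE[OF assms(1) pU]) (rule that)
  obtain c where c: "c \<in> PF" "c p \<noteq> 0" "\<And>q. q \<in> U \<Longrightarrow> c q \<noteq> 0 \<Longrightarrow> q \<in> V"
    by (rule zopenE[OF assms(2) p]) (rule that)
  show "\<exists>b\<in>PF. b p \<noteq> 0 \<and> (\<forall>q\<in>S. b q \<noteq> 0 \<longrightarrow> q \<in> V)"
    using b c by (intro bexI[of _ "\<lambda>x. b x * c x"]) (auto intro: PF_mult)
qed (use zopenD[OF assms(1)] zopenD[OF assms(2)] in auto)

lemma zopen_restrict:
  assumes "zopen S V" "T \<subseteq> S" shows "zopen T (V \<inter> T)"
proof (rule zopenI)
  fix p assume "p \<in> V \<inter> T"
  then have "p \<in> V" by blast
  then obtain b where "b \<in> PF" "b p \<noteq> 0" "\<And>q. q \<in> S \<Longrightarrow> b q \<noteq> 0 \<Longrightarrow> q \<in> V"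
    by (rule zopenE[OF assms(1)]) (rule that)
  then show "\<exists>b\<in>PF. b p \<noteq> 0 \<and> (\<forall>q\<in>T. b q \<noteq> 0 \<longrightarrow> q \<in> V \<inter> T)"
    using assms(2) by (intro bexI[of _ b]) auto
qed auto

text \<open>Collects all non-vanishing loci whose trace on T lies in V. Their union in S extends V
  to an open set of S; for S = T it exhibits the loci as a basis.\<close>

lemma zopen_eq_Union:
  assumes "zopen T V" "T \<subseteq> S"
  shows "V = \<Union>{{x \<in> S. b x \<noteq> 0} | b. b \<in> PF \<and> {x \<in> T. b x \<noteq> 0} \<subseteq> V} \<inter> T" (is "V = ?R")
proof (intro equalityI subsetI)
  fix p assume p: "p \<in> V"
  then obtain b where "b \<in> PF" "b p \<noteq> 0" "\<And>q. q \<in> T \<Longrightarrow> b q \<noteq> 0 \<Longrightarrow> q \<in> V"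
    by (rule zopenE[OF assms(1)]) (rule that)
  moreover have "p \<in> T" using zopenD[OF assms(1)] p by blast
  ultimately show "p \<in> ?R"
    using assms(2) by (intro IntI UnionI[of "{x \<in> S. b x \<noteq> 0}"]) auto
qed blast

lemma openin_zariski:
  fixes V :: "('a \<Rightarrow> 'b::field_char_0 alg_closure) set"
  shows "openin (zariski I) V \<longleftrightarrow> zopen (aff_points I) V"
proof
  assume "openin (zariski I) V"
  then have "generate_topology_on (range (\<lambda>b. {x \<in> aff_points I. mp_eval to_ac b x \<noteq> 0})) V"
    by (simp add: zariski_def openin_topology_generated_by_iff)
  then show "zopen (aff_points I) V"
  proof (induction rule: generate_topology_on.induct)
    case (Basis s)
    then show ?case using zopen_basic PF_mp_eval by blast
  next
    case Empty
    show ?case by (simp add: zopen_def)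
  qed (simp_all add: zopen_Int zopen_Union)
next
  assume V: "zopen (aff_points I) V"
  have *: "openin (zariski I) {x \<in> aff_points I. b x \<noteq> 0}"
    if b: "b \<in> PF" for b :: "('a \<Rightarrow> 'b alg_closure) \<Rightarrow> 'b alg_closure"
    unfolding zariski_def using b by (intro topology_generated_by_Basis) (auto elim: PF_E)
  let ?U = "\<Union>{{x \<in> aff_points I. b x \<noteq> 0} | b. b \<in> PF \<and> {x \<in> aff_points I. b x \<noteq> 0} \<subseteq> V}"
  have "V = ?U \<inter> aff_points I" by (rule zopen_eq_Union[OF V order_refl])
  also have "\<dots> = ?U" by auto
  also have "openin (zariski I) ?U"
  proof (rule openin_Union)
    fix W assume "W \<in> {{x \<in> aff_points I. b x \<noteq> 0} | b. b \<in> PF \<and> {x \<in> aff_points I. b x \<noteq> 0} \<subseteq> V}"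
    then obtain b where "b \<in> PF" "W = {x \<in> aff_points I. b x \<noteq> 0}" by blast
    then show "openin (zariski I) W" using * by simp
  qed
  finally show "openin (zariski I) V" .
qed

lemma topspace_zariski [simp]: "topspace (zariski I) = aff_points I"
proof (rule subset_antisym)
  show "topspace (zariski I) \<subseteq> aff_points I"
    using openin_topspace[of "zariski I"] unfolding openin_zariski by (rule zopenD)
  show "aff_points I \<subseteq> topspace (zariski I)"
    using zopen_self[of "aff_points I"] unfolding openin_zariski[symmetric] by (rule openin_subset)
qed

section \<open>Functions that are locally quotients of polynomials\<close>

definition locrat ::
    "('i \<Rightarrow> 'k::field_char_0 alg_closure) set \<Rightarrow> (('i \<Rightarrow> 'k alg_closure) \<Rightarrow> 'k alg_closure) set" where
  "locrat V = {f. \<forall>p\<in>V. \<exists>a\<in>PF. \<exists>b\<in>PF. b p \<noteq> 0 \<and> (\<forall>q\<in>V. b q \<noteq> 0 \<longrightarrow> f q = a q / b q)}"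

lemma locratD:
  assumes "f \<in> locrat V" "p \<in> V"
  obtains a b where "a \<in> PF" "b \<in> PF" "b p \<noteq> 0" "\<And>q. q \<in> V \<Longrightarrow> b q \<noteq> 0 \<Longrightarrow> f q = a q / b q"
  using assms unfolding locrat_def by blast

lemma locratI:
  assumes "\<And>p. p \<in> V \<Longrightarrow> \<exists>a\<in>PF. \<exists>b\<in>PF. b p \<noteq> 0 \<and> (\<forall>q\<in>V. b q \<noteq> 0 \<longrightarrow> f q = a q / b q)"
  shows "f \<in> locrat V"
  using assms unfolding locrat_def by blast

lemma locrat_PF: "f \<in> PF \<Longrightarrow> f \<in> locrat V"
  by (rule locratI, rule bexI[of _ f], rule bexI[of _ "\<lambda>_. 1"]) (auto intro: PF_1)

lemma locrat_cong: "f \<in> locrat V \<Longrightarrow> (\<And>x. x \<in> V \<Longrightarrow> f x = g x) \<Longrightarrow> g \<in> locrat V"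
  unfolding locrat_def by simp

lemma locrat_mono:
  assumes "f \<in> locrat V" "W \<subseteq> V" shows "f \<in> locrat W"
proof (rule locratI)
  fix p assume "p \<in> W"
  then have "p \<in> V" using assms(2) by blast
  then obtain a b where "a \<in> PF" "b \<in> PF" "b p \<noteq> 0" "\<And>q. q \<in> V \<Longrightarrow> b q \<noteq> 0 \<Longrightarrow> f q = a q / b q"
    by (rule locratD[OF assms(1)]) (rule that)
  then show "\<exists>a\<in>PF. \<exists>b\<in>PF. b p \<noteq> 0 \<and> (\<forall>q\<in>W. b q \<noteq> 0 \<longrightarrow> f q = a q / b q)"
    using assms(2) by (intro bexI[of _ a] bexI[of _ b]) auto
qed

lemma locrat_add:
  assumes "f \<in> locrat V" "g \<in> locrat V" shows "(\<lambda>x. f x + g x) \<in> locrat V"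
proof (rule locratI)
  fix p assume p: "p \<in> V"
  obtain a b where 1: "a \<in> PF" "b \<in> PF" "b p \<noteq> 0" "\<And>q. q \<in> V \<Longrightarrow> b q \<noteq> 0 \<Longrightarrow> f q = a q / b q"
    by (rule locratD[OF assms(1) p]) (rule that)
  obtain c d where 2: "c \<in> PF" "d \<in> PF" "d p \<noteq> 0" "\<And>q. q \<in> V \<Longrightarrow> d q \<noteq> 0 \<Longrightarrow> g q = c q / d q"
    by (rule locratD[OF assms(2) p]) (rule that)
  show "\<exists>a\<in>PF. \<exists>b\<in>PF. b p \<noteq> 0 \<and> (\<forall>q\<in>V. b q \<noteq> 0 \<longrightarrow> f q + g q = a q / b q)"
    using 1 2 by (intro bexI[of _ "\<lambda>x. a x * d x + c x * b x"] bexI[of _ "\<lambda>x. b x * d x"])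
      (auto intro!: PF_intros simp: add_frac_eq)
qed

lemma locrat_mult:
  assumes "f \<in> locrat V" "g \<in> locrat V" shows "(\<lambda>x. f x * g x) \<in> locrat V"
proof (rule locratI)
  fix p assume p: "p \<in> V"
  obtain a b where 1: "a \<in> PF" "b \<in> PF" "b p \<noteq> 0" "\<And>q. q \<in> V \<Longrightarrow> b q \<noteq> 0 \<Longrightarrow> f q = a q / b q"
    by (rule locratD[OF assms(1) p]) (rule that)
  obtain c d where 2: "c \<in> PF" "d \<in> PF" "d p \<noteq> 0" "\<And>q. q \<in> V \<Longrightarrow> d q \<noteq> 0 \<Longrightarrow> g q = c q / d q"
    by (rule locratD[OF assms(2) p]) (rule that)
  show "\<exists>a\<in>PF. \<exists>b\<in>PF. b p \<noteq> 0 \<and> (\<forall>q\<in>V. b q \<noteq> 0 \<longrightarrow> f q * g q = a q / b q)"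
    using 1 2 by (intro bexI[of _ "\<lambda>x. a x * c x"] bexI[of _ "\<lambda>x. b x * d x"])
      (auto intro!: PF_intros)
qed

lemma locrat_inverse:
  assumes "f \<in> locrat V" "\<And>x. x \<in> V \<Longrightarrow> f x \<noteq> 0" shows "(\<lambda>x. inverse (f x)) \<in> locrat V"
proof (rule locratI)
  fix p assume p: "p \<in> V"
  obtain a b where 1: "a \<in> PF" "b \<in> PF" "b p \<noteq> 0" "\<And>q. q \<in> V \<Longrightarrow> b q \<noteq> 0 \<Longrightarrow> f q = a q / b q"
    by (rule locratD[OF assms(1) p]) (rule that)
  \<comment> \<open>Extending b/a by b makes the new denominator vanish wherever b does, since f =
    a/b is known only where b is non-zero.\<close>
  have "inverse (f q) = b q * b q / (b q * a q)" if "q \<in> V" "b q * a q \<noteq> 0" for q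
    using 1(4)[OF that(1)] that(2) by simp
  moreover have "b p * a p \<noteq> 0" using 1(3) 1(4)[OF p] assms(2)[OF p] by auto
  ultimately show "\<exists>a\<in>PF. \<exists>b\<in>PF. b p \<noteq> 0 \<and> (\<forall>q\<in>V. b q \<noteq> 0 \<longrightarrow> inverse (f q) = a q / b q)"
    using 1(1,2) by (intro bexI[of _ "\<lambda>x. b x * b x"] bexI[of _ "\<lambda>x. b x * a x"])
      (auto intro!: PF_intros)
qed

lemma locrat_divide:
  "f \<in> locrat V \<Longrightarrow> g \<in> locrat V \<Longrightarrow> (\<And>x. x \<in> V \<Longrightarrow> g x \<noteq> 0) \<Longrightarrow> (\<lambda>x. f x / g x) \<in> locrat V"
  using locrat_mult[OF _ locrat_inverse, of f V g] by (simp add: divide_inverse)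

lemma locrat_sum: "(\<And>i. i \<in> A \<Longrightarrow> f i \<in> locrat V) \<Longrightarrow> (\<lambda>x. \<Sum>i\<in>A. f i x) \<in> locrat V"
  by (induction A rule: infinite_finite_induct) (auto intro: locrat_PF PF_0 locrat_add)

lemma locrat_PF_compose:
  assumes "g \<in> PF" "\<And>i. (\<lambda>x. u x i) \<in> locrat V" shows "(\<lambda>x. g (u x)) \<in> locrat V"
  using assms(1)
proof (rule PF_compose_in)
  show "(\<lambda>_. to_ac c) \<in> locrat V" for c by (rule locrat_PF[OF PF_const])
qed (rule locrat_add locrat_mult assms(2); assumption?)+

lemma locrat_compose:
  assumes f: "f \<in> locrat W" and u: "\<And>i. (\<lambda>x. u x i) \<in> locrat V" and VW: "\<And>x. x \<in> V \<Longrightarrow> u x \<in> W"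
  shows "(\<lambda>x. f (u x)) \<in> locrat V"
proof (rule locratI)
  fix p assume p: "p \<in> V"
  obtain a b where 1: "a \<in> PF" "b \<in> PF" "b (u p) \<noteq> 0" "\<And>q. q \<in> W \<Longrightarrow> b q \<noteq> 0 \<Longrightarrow> f q = a q / b q"
    by (rule locratD[OF f VW[OF p]]) (rule that)
  obtain a1 a2 where A: "a1 \<in> PF" "a2 \<in> PF" "a2 p \<noteq> 0" "\<And>q. q \<in> V \<Longrightarrow> a2 q \<noteq> 0 \<Longrightarrow> a (u q) = a1 q / a2 q"
    by (rule locratD[OF locrat_PF_compose[OF 1(1) u] p]) (rule that)
  obtain b1 b2 where B: "b1 \<in> PF" "b2 \<in> PF" "b2 p \<noteq> 0" "\<And>q. q \<in> V \<Longrightarrow> b2 q \<noteq> 0 \<Longrightarrow> b (u q) = b1 q / b2 q"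
    by (rule locratD[OF locrat_PF_compose[OF 1(2) u] p]) (rule that)
  have "b1 p \<noteq> 0" using 1(3) B(3,4) p by auto
  \<comment> \<open>The composite is (a1/a2)/(b1/b2) = a1 b2 / (a2 b1). Extending it by b2 lets the
    new denominator vanish with b2, because the formula for \<open>b (u q)\<close> holds only where
    b2 is non-zero.\<close>
  moreover have "f (u q) = a1 q * b2 q * b2 q / (a2 q * b1 q * b2 q)"
    if "q \<in> V" "a2 q * b1 q * b2 q \<noteq> 0" for q
  proof -
    have "b (u q) \<noteq> 0" using B(4)[OF that(1)] that(2) by auto
    then show ?thesis using 1(4)[OF VW[OF that(1)]] A(4)[OF that(1)] B(4)[OF that(1)] that(2) by simp
  qed
  ultimately show "\<exists>a\<in>PF. \<exists>b\<in>PF. b p \<noteq> 0 \<and> (\<forall>q\<in>V. b q \<noteq> 0 \<longrightarrow> f (u q) = a q / b q)"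
    using A(1-3) B(1-3)
    by (intro bexI[of _ "\<lambda>q. a1 q * b2 q * b2 q"] bexI[of _ "\<lambda>q. a2 q * b1 q * b2 q"])
      (auto intro!: PF_intros)
qed

lemma zopen_locrat:
  assumes "f \<in> locrat V" shows "zopen V {x \<in> V. f x \<noteq> 0}"
proof (rule zopenI)
  fix p assume p: "p \<in> {x \<in> V. f x \<noteq> 0}"
  obtain a b where 1: "a \<in> PF" "b \<in> PF" "b p \<noteq> 0" "\<And>q. q \<in> V \<Longrightarrow> b q \<noteq> 0 \<Longrightarrow> f q = a q / b q"
    using locratD[OF assms] p by blast
  show "\<exists>b\<in>PF. b p \<noteq> 0 \<and> (\<forall>q\<in>V. b q \<noteq> 0 \<longrightarrow> q \<in> {x \<in> V. f x \<noteq> 0})"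
    using 1 p by (intro bexI[of _ "\<lambda>x. a x * b x"]) (auto intro: PF_mult)
qed auto

text \<open>Numerator and denominator of the quotient for g are multiplied by a function c whose
  non-vanishing locus lies in W; this turns a quotient valid on W into one usable on V.\<close>

lemma locrat_local:
  assumes "\<And>p. p \<in> V \<Longrightarrow> \<exists>W g. zopen V W \<and> p \<in> W \<and> g \<in> locrat W \<and> (\<forall>q\<in>W. f q = g q)"
  shows "f \<in> locrat V"
proof (rule locratI)
  fix p assume p: "p \<in> V"
  obtain W g where W: "zopen V W" "p \<in> W" "g \<in> locrat W" "\<forall>q\<in>W. f q = g q"
    using assms[OF p] by blast
  obtain a b where 1: "a \<in> PF" "b \<in> PF" "b p \<noteq> 0" "\<And>q. q \<in> W \<Longrightarrow> b q \<noteq> 0 \<Longrightarrow> g q = a q / b q"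
    by (rule locratD[OF W(3,2)]) (rule that)
  obtain c where c: "c \<in> PF" "c p \<noteq> 0" "\<And>q. q \<in> V \<Longrightarrow> c q \<noteq> 0 \<Longrightarrow> q \<in> W"
    by (rule zopenE[OF W(1,2)]) (rule that)
  show "\<exists>a\<in>PF. \<exists>b\<in>PF. b p \<noteq> 0 \<and> (\<forall>q\<in>V. b q \<noteq> 0 \<longrightarrow> f q = a q / b q)"
    using 1 c W(4) by (intro bexI[of _ "\<lambda>x. a x * c x"] bexI[of _ "\<lambda>x. b x * c x"])
      (auto intro: PF_mult)
qed

text \<open>The normal form of all spaces below. \<open>aff_space_eq_qspace\<close> and
  \<open>fsub_qspace\<close> reduce affine spaces and their subspaces to it, so that a stratum of a
  stratum does not remember how it was obtained.\<close>

definition qspace ::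
    "('i \<Rightarrow> 'k::field_char_0 alg_closure) set \<Rightarrow> ('i \<Rightarrow> 'k alg_closure, 'k alg_closure) fspace" where
  "qspace S = \<lparr> ztop = topology (zopen S), reg = (\<lambda>V. {f \<in> extensional V. zopen S V \<and> f \<in> locrat V}) \<rparr>"

lemma istopology_zopen: "istopology (zopen S)"
  unfolding istopology_def by (auto intro: zopen_Int zopen_Union)

lemma openin_qspace [simp]: "openin (ztop (qspace S)) V \<longleftrightarrow> zopen S V"
  by (simp add: qspace_def istopology_zopen topology_inverse')

lemma topspace_qspace [simp]: "topspace (ztop (qspace S)) = S"
proof (rule subset_antisym)
  show "topspace (ztop (qspace S)) \<subseteq> S"
    using openin_topspace[of "ztop (qspace S)"] unfolding openin_qspace by (rule zopenD)
  show "S \<subseteq> topspace (ztop (qspace S))"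
    using zopen_self[of S] unfolding openin_qspace[symmetric] by (rule openin_subset)
qed

lemma reg_qspace [simp]: "f \<in> reg (qspace S) V \<longleftrightarrow> f \<in> extensional V \<and> zopen S V \<and> f \<in> locrat V"
  by (simp add: qspace_def)

lemma fspace_eqI:
  fixes X Y :: "('p, 'v) fspace"
  assumes "\<And>V. openin (ztop X) V \<longleftrightarrow> openin (ztop Y) V" "\<And>V f. f \<in> reg X V \<longleftrightarrow> f \<in> reg Y V"
  shows "X = Y"
proof -
  have "ztop X = ztop Y" using assms(1) by (simp add: topology_eq)
  moreover have "reg X = reg Y" using assms(2) by (intro ext) blast
  ultimately show ?thesis by simp
qed

text \<open>The neighbourhoods in the definition of \<open>aff_space\<close> are arbitrary open
  sets; the non-vanishing locus of the denominator is one of them.\<close>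

lemma aff_space_eq_qspace: "aff_space I = qspace (aff_points I)"
proof (rule fspace_eqI)
  show "openin (ztop (aff_space I)) V \<longleftrightarrow> openin (ztop (qspace (aff_points I))) V" for V
    by (simp add: aff_space_def openin_zariski)
next
  fix V :: "('a \<Rightarrow> 'b alg_closure) set" and f
  have 1: "f \<in> locrat V"
    if f: "\<forall>p\<in>V. \<exists>W (a :: ('a, 'b) mpoly) b. zopen (aff_points I) W \<and> p \<in> W \<and> W \<subseteq> V \<and>
                    (\<forall>q\<in>W. mp_eval to_ac b q \<noteq> 0 \<and> f q = mp_eval to_ac a q / mp_eval to_ac b q)"
      and V: "zopen (aff_points I) V"
  proof (rule locrat_local)
    fix p assume p: "p \<in> V"
    obtain W a b where W: "zopen (aff_points I) W" "p \<in> W" "W \<subseteq> V"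
      "\<forall>q\<in>W. mp_eval to_ac b q \<noteq> 0 \<and> f q = mp_eval to_ac (a :: ('a, 'b) mpoly) q / mp_eval to_ac b q"
      using f[rule_format, OF p] by (elim exE conjE) (rule that, assumption+)
    have "zopen V W" using zopen_restrict[OF W(1) zopenD[OF V]] W(3) by (simp add: inf.absorb1)
    moreover have "(\<lambda>q. mp_eval to_ac a q / mp_eval to_ac b q) \<in> locrat W"
      using W(4) by (intro locrat_divide locrat_PF PF_mp_eval) auto
    ultimately show "\<exists>W g. zopen V W \<and> p \<in> W \<and> g \<in> locrat W \<and> (\<forall>q\<in>W. f q = g q)"
      using W by blast
  qed
  have 2: "\<exists>W (a :: ('a, 'b) mpoly) b. zopen (aff_points I) W \<and> p \<in> W \<and> W \<subseteq> V \<and>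
                    (\<forall>q\<in>W. mp_eval to_ac b q \<noteq> 0 \<and> f q = mp_eval to_ac a q / mp_eval to_ac b q)"
    if V: "zopen (aff_points I) V" and f: "f \<in> locrat V" and p: "p \<in> V" for p
  proof -
    obtain a b where ab: "a \<in> PF" "b \<in> PF" "b p \<noteq> 0" "\<And>q. q \<in> V \<Longrightarrow> b q \<noteq> 0 \<Longrightarrow> f q = a q / b q"
      by (rule locratD[OF f p]) (rule that)
    obtain a' b' where [simp]: "a = mp_eval to_ac a'" "b = mp_eval to_ac b'"
      using ab(1,2) by (auto simp: PF_def)
    have "zopen (aff_points I) {x \<in> V. b x \<noteq> 0}"
      using zopen_trans[OF V zopen_basic[OF ab(2)]] .
    then show ?thesis using ab p
      by (intro exI[of _ "{x \<in> V. b x \<noteq> 0}"] exI[of _ a'] exI[of _ b']) auto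
  qed
  have "f \<in> reg (aff_space I) V \<longleftrightarrow> f \<in> extensional V \<and> zopen (aff_points I) V \<and>
      (\<forall>p\<in>V. \<exists>W (a :: ('a, 'b) mpoly) b. zopen (aff_points I) W \<and> p \<in> W \<and> W \<subseteq> V \<and>
                    (\<forall>q\<in>W. mp_eval to_ac b q \<noteq> 0 \<and> f q = mp_eval to_ac a q / mp_eval to_ac b q))"
    by (simp add: aff_space_def openin_zariski)
  then show "f \<in> reg (aff_space I) V \<longleftrightarrow> f \<in> reg (qspace (aff_points I)) V"
    unfolding reg_qspace using 1 2 by blast
qed

text \<open>A local quotient on T is regular on the whole locus in S where its denominator is
  non-zero, so it is locally the restriction of a regular function of S.\<close>

lemma fsub_qspace:
  assumes "T \<subseteq> S" shows "fsub (qspace S) T = qspace T"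
proof (rule fspace_eqI)
  have *: "openin (subtopology (ztop (qspace S)) T) V \<longleftrightarrow> zopen T V" for V
  proof
    assume "openin (subtopology (ztop (qspace S)) T) V"
    then show "zopen T V" using zopen_restrict[OF _ assms] by (auto simp: openin_subtopology)
  next
    assume V: "zopen T V"
    let ?U = "\<Union>{{x \<in> S. b x \<noteq> 0} | b. b \<in> PF \<and> {x \<in> T. b x \<noteq> 0} \<subseteq> V}"
    have "zopen S ?U"
    proof (rule zopen_Union)
      fix W assume "W \<in> {{x \<in> S. b x \<noteq> 0} | b. b \<in> PF \<and> {x \<in> T. b x \<noteq> 0} \<subseteq> V}"
      then obtain b where "b \<in> PF" "W = {x \<in> S. b x \<noteq> 0}" by blast
      then show "zopen S W" by (simp add: zopen_basic)
    qed
    moreover have "V = ?U \<inter> T" by (rule zopen_eq_Union[OF V assms])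
    ultimately show "openin (subtopology (ztop (qspace S)) T) V"
      by (auto simp: openin_subtopology)
  qed
  show "openin (ztop (fsub (qspace S) T)) V \<longleftrightarrow> openin (ztop (qspace T)) V" for V
    by (simp add: fsub_def *)
  fix V f
  have "f \<in> locrat V"
    if V: "zopen T V" and f: "\<forall>p\<in>V. \<exists>W g. zopen S W \<and> p \<in> W \<and> (g \<in> extensional W \<and> zopen S W \<and> g \<in> locrat W) \<and>
         (\<forall>q\<in>W \<inter> V. f q = g q)"
  proof (rule locrat_local)
    fix p assume p: "p \<in> V"
    obtain W g where W: "zopen S W" "p \<in> W" "g \<in> locrat W" "\<forall>q\<in>W \<inter> V. f q = g q"
      using f[rule_format, OF p] by (elim exE conjE) (rule that, assumption+)
    have "V \<subseteq> S" using zopenD[OF V] assms by blast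
    then show "\<exists>W g. zopen V W \<and> p \<in> W \<and> g \<in> locrat W \<and> (\<forall>q\<in>W. f q = g q)"
      using W p zopen_restrict[OF W(1)] locrat_mono[OF W(3)]
      by (intro exI[of _ "W \<inter> V"] exI[of _ g]) auto
  qed
  moreover have "\<exists>W g. zopen S W \<and> p \<in> W \<and> (g \<in> extensional W \<and> zopen S W \<and> g \<in> locrat W) \<and>
         (\<forall>q\<in>W \<inter> V. f q = g q)"
    if V: "zopen T V" and f: "f \<in> locrat V" and p: "p \<in> V" for p
  proof -
    obtain a b where ab: "a \<in> PF" "b \<in> PF" "b p \<noteq> 0" "\<And>q. q \<in> V \<Longrightarrow> b q \<noteq> 0 \<Longrightarrow> f q = a q / b q"
      by (rule locratD[OF f p]) (rule that)
    let ?W = "{x \<in> S. b x \<noteq> 0}"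
    have "(\<lambda>x. a x / b x) \<in> locrat ?W"
      using ab by (intro locrat_divide locrat_PF) auto
    then have "restrict (\<lambda>x. a x / b x) ?W \<in> locrat ?W"
      by (rule locrat_cong) auto
    moreover have "zopen S ?W" using zopen_basic ab(2) by blast
    moreover have "p \<in> S" using p zopenD[OF V] assms by blast
    ultimately show ?thesis using ab
      by (intro exI[of _ ?W] exI[of _ "restrict (\<lambda>x. a x / b x) ?W"]) auto
  qed
  moreover have "f \<in> reg (fsub (qspace S) T) V \<longleftrightarrow> f \<in> extensional V \<and> zopen T V \<and>
      (\<forall>p\<in>V. \<exists>W g. zopen S W \<and> p \<in> W \<and> (g \<in> extensional W \<and> zopen S W \<and> g \<in> locrat W) \<and>
         (\<forall>q\<in>W \<inter> V. f q = g q))"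
    by (simp add: fsub_def *)
  ultimately show "f \<in> reg (fsub (qspace S) T) V \<longleftrightarrow> f \<in> reg (qspace T) V"
    unfolding reg_qspace by blast
qed

lemma fsub_aff_space: "S \<subseteq> aff_points I \<Longrightarrow> fsub (aff_space I) S = qspace S"
  by (simp add: aff_space_eq_qspace fsub_qspace)


section \<open>Morphisms\<close>

text \<open>Substituting regular coordinate functions turns non-vanishing loci into open sets and
  local quotients into local quotients.\<close>

lemma qspace_morphism:
  assumes u: "\<And>i. (\<lambda>x. u x i) \<in> locrat S" and ST: "\<And>x. x \<in> S \<Longrightarrow> u x \<in> T"
  shows "fspace_morphism (qspace S) (qspace T) u"
proof -
  have op: "zopen S (u -` V \<inter> S)" if V: "zopen T V" for V
  proof (rule zopenI)
    fix p assume p: "p \<in> u -` V \<inter> S"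
    then have "u p \<in> V" by simp
    then obtain b where b: "b \<in> PF" "b (u p) \<noteq> 0" "\<And>q. q \<in> T \<Longrightarrow> b q \<noteq> 0 \<Longrightarrow> q \<in> V"
      by (rule zopenE[OF V]) (rule that)
    have "zopen S {x \<in> S. b (u x) \<noteq> 0}" using zopen_locrat[OF locrat_PF_compose[OF b(1) u]] .
    moreover have "p \<in> {x \<in> S. b (u x) \<noteq> 0}" using p b(2) by simp
    ultimately obtain c where "c \<in> PF" "c p \<noteq> 0" "\<And>q. q \<in> S \<Longrightarrow> c q \<noteq> 0 \<Longrightarrow> q \<in> {x \<in> S. b (u x) \<noteq> 0}"
      using zopenE by blast
    then show "\<exists>b\<in>PF. b p \<noteq> 0 \<and> (\<forall>q\<in>S. b q \<noteq> 0 \<longrightarrow> q \<in> u -` V \<inter> S)"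
      using b(3) ST by (intro bexI[of _ c]) auto
  qed auto
  have "restrict (g \<circ> u) (u -` V \<inter> S) \<in> locrat (u -` V \<inter> S)" if "zopen T V" "g \<in> locrat V" for V g
  proof -
    have "(\<lambda>x. g (u x)) \<in> locrat (u -` V \<inter> S)"
      by (rule locrat_compose[OF that(2)]) (use locrat_mono[OF u, of "u -` V \<inter> S"] in auto)
    then show ?thesis by (rule locrat_cong) auto
  qed
  moreover have "{x \<in> S. u x \<in> V} = u -` V \<inter> S" for V by auto
  ultimately show ?thesis unfolding fspace_morphism_def continuous_map_def
    using op ST by auto
qed

lemma qspace_iso:
  assumes "\<And>i. (\<lambda>x. u x i) \<in> locrat S" "\<And>x. x \<in> S \<Longrightarrow> u x \<in> T"
    and "\<And>i. (\<lambda>x. v x i) \<in> locrat T" "\<And>x. x \<in> T \<Longrightarrow> v x \<in> S"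
    and "\<And>x. x \<in> S \<Longrightarrow> v (u x) = x" "\<And>x. x \<in> T \<Longrightarrow> u (v x) = x"
  shows "fspace_iso (qspace S) (qspace T)"
  unfolding fspace_iso_def using assms qspace_morphism[of u S T] qspace_morphism[of v T S]
  by (intro exI[of _ u] exI[of _ v]) auto

lemma fspace_iso_sym: "fspace_iso X Y \<Longrightarrow> fspace_iso Y X"
  unfolding fspace_iso_def by blast

lemma fspace_morphism_comp:
  assumes u: "fspace_morphism X Y u" and v: "fspace_morphism Y Z v"
  shows "fspace_morphism X Z (v \<circ> u)"
  unfolding fspace_morphism_def
proof (intro conjI allI impI)
  show "continuous_map (ztop X) (ztop Z) (v \<circ> u)"
    using assms unfolding fspace_morphism_def by (blast intro: continuous_map_compose)
  fix V g assume V: "openin (ztop Z) V \<and> g \<in> reg Z V"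
  let ?V = "v -` V \<inter> topspace (ztop Y)"
  have cu: "continuous_map (ztop X) (ztop Y) u" and cv: "continuous_map (ztop Y) (ztop Z) v"
    using assms unfolding fspace_morphism_def by auto
  have "openin (ztop Y) ?V"
    using openin_continuous_map_preimage[OF cv, of V] V by (simp add: vimage_def Int_def conj_commute)
  moreover have "restrict (g \<circ> v) ?V \<in> reg Y ?V" using v V unfolding fspace_morphism_def by blast
  ultimately have "restrict (restrict (g \<circ> v) ?V \<circ> u) (u -` ?V \<inter> topspace (ztop X))
      \<in> reg X (u -` ?V \<inter> topspace (ztop X))"
    using u unfolding fspace_morphism_def by blast
  moreover have *: "u x \<in> topspace (ztop Y)" if "x \<in> topspace (ztop X)" for x
    using cu that by (auto simp: continuous_map_def Pi_iff)
  have "u -` ?V \<inter> topspace (ztop X) = (v \<circ> u) -` V \<inter> topspace (ztop X)" using * by auto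
  moreover have "restrict (restrict (g \<circ> v) ?V \<circ> u) (u -` ?V \<inter> topspace (ztop X))
      = restrict (g \<circ> (v \<circ> u)) ((v \<circ> u) -` V \<inter> topspace (ztop X))"
    using * by (auto simp: restrict_def fun_eq_iff)
  ultimately show "restrict (g \<circ> (v \<circ> u)) ((v \<circ> u) -` V \<inter> topspace (ztop X))
      \<in> reg X ((v \<circ> u) -` V \<inter> topspace (ztop X))" by simp
qed

lemma fspace_iso_trans:
  assumes "fspace_iso X Y" "fspace_iso Y Z" shows "fspace_iso X Z"
proof -
  obtain u v where uv: "fspace_morphism X Y u" "fspace_morphism Y X v"
    "\<forall>p\<in>topspace (ztop X). v (u p) = p" "\<forall>q\<in>topspace (ztop Y). u (v q) = q"
    using assms(1) unfolding fspace_iso_def by blast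
  obtain u' v' where uv': "fspace_morphism Y Z u'" "fspace_morphism Z Y v'"
    "\<forall>p\<in>topspace (ztop Y). v' (u' p) = p" "\<forall>q\<in>topspace (ztop Z). u' (v' q) = q"
    using assms(2) unfolding fspace_iso_def by blast
  have "u p \<in> topspace (ztop Y)" if "p \<in> topspace (ztop X)" for p
    using uv(1) that unfolding fspace_morphism_def continuous_map_def by blast
  moreover have "v' p \<in> topspace (ztop Y)" if "p \<in> topspace (ztop Z)" for p
    using uv'(2) that unfolding fspace_morphism_def continuous_map_def by blast
  ultimately show ?thesis unfolding fspace_iso_def
    using fspace_morphism_comp[OF uv(1) uv'(1)] fspace_morphism_comp[OF uv'(2) uv(2)] uv(3,4) uv'(3,4)
    by (intro exI[of _ "u' \<circ> u"] exI[of _ "v \<circ> v'"]) auto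
qed

lemma qspace_iso_refl: "fspace_iso (qspace S) (qspace S)"
  by (rule qspace_iso[of id _ _ id]) (auto intro: locrat_PF PF_var)

section \<open>Noetherianity\<close>

text \<open>Rings are subsets of one ambient type, so that Hilbert's theorem can be iterated over
  the variables without a change of type.\<close>

definition subring_set :: "'a::comm_ring_1 set \<Rightarrow> bool" where
  "subring_set R \<longleftrightarrow> 0 \<in> R \<and> 1 \<in> R \<and> (\<forall>a\<in>R. \<forall>b\<in>R. a + b \<in> R \<and> a * b \<in> R) \<and> (\<forall>a\<in>R. - a \<in> R)"

lemma subring_setD:
  assumes "subring_set R"
  shows "0 \<in> R" "1 \<in> R" "a \<in> R \<Longrightarrow> b \<in> R \<Longrightarrow> a + b \<in> R" "a \<in> R \<Longrightarrow> b \<in> R \<Longrightarrow> a * b \<in> R"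
    "a \<in> R \<Longrightarrow> - a \<in> R"
  using assms unfolding subring_set_def by auto

inductive_set ideal_in :: "'a::comm_ring_1 set \<Rightarrow> 'a set \<Rightarrow> 'a set" for R B where
  zero: "0 \<in> ideal_in R B"
| step: "r \<in> R \<Longrightarrow> b \<in> B \<Longrightarrow> y \<in> ideal_in R B \<Longrightarrow> r * b + y \<in> ideal_in R B"

lemma ideal_in_add: "y \<in> ideal_in R B \<Longrightarrow> z \<in> ideal_in R B \<Longrightarrow> y + z \<in> ideal_in R B"
  by (induction rule: ideal_in.induct) (auto simp: add.assoc intro: ideal_in.intros)

lemma ideal_in_scale:
  assumes "subring_set R" "r \<in> R" "y \<in> ideal_in R B" shows "r * y \<in> ideal_in R B"
  using assms(3)
proof (induction rule: ideal_in.induct)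
  case (step s b y)
  have "(r * s) * b + r * y \<in> ideal_in R B"
    by (rule ideal_in.step[OF subring_setD(4)[OF assms(1,2) step(1)] step(2) step(4)])
  then show ?case by (simp only: distrib_left mult.assoc)
qed (simp add: ideal_in.zero)

lemma ideal_in_base: "subring_set R \<Longrightarrow> b \<in> B \<Longrightarrow> b \<in> ideal_in R B"
  using ideal_in.step[OF subring_setD(2) _ ideal_in.zero, of R b B] by simp

lemma ideal_in_uminus: "subring_set R \<Longrightarrow> y \<in> ideal_in R B \<Longrightarrow> - y \<in> ideal_in R B"
  using ideal_in_scale[OF _ subring_setD(5)[OF _ subring_setD(2)], of R y B] by simp

lemma ideal_in_subset:
  assumes "subring_set R" "B \<subseteq> ideal_in R C" shows "ideal_in R B \<subseteq> ideal_in R C"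
proof
  fix y assume "y \<in> ideal_in R B"
  then show "y \<in> ideal_in R C"
  proof (induction rule: ideal_in.induct)
    case (step r b y)
    have "b \<in> ideal_in R C" using step(2) assms(2) by blast
    then show ?case by (rule ideal_in_add[OF ideal_in_scale[OF assms(1) step(1)] step(4)])
  qed (rule ideal_in.zero)
qed

lemma ideal_in_mono: "B \<subseteq> C \<Longrightarrow> ideal_in R B \<subseteq> ideal_in R C"
proof
  fix y assume "y \<in> ideal_in R B" "B \<subseteq> C"
  then show "y \<in> ideal_in R C"
    by (induction rule: ideal_in.induct) (auto intro: ideal_in.intros)
qed

lemma ideal_in_finite: "y \<in> ideal_in R B \<Longrightarrow> \<exists>F. finite F \<and> F \<subseteq> B \<and> y \<in> ideal_in R F"
proof (induction rule: ideal_in.induct)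
  case zero
  then show ?case by (intro exI[of _ "{}"]) (auto intro: ideal_in.zero)
next
  case (step r b y)
  then obtain F where "finite F" "F \<subseteq> B" "y \<in> ideal_in R F" by blast
  then show ?case using step ideal_in_mono[of F "insert b F" R]
    by (intro exI[of _ "insert b F"]) (auto intro: ideal_in.step)
qed

lemma ideal_in_finite_set:
  assumes "finite P" "P \<subseteq> ideal_in R B"
  shows "\<exists>F. finite F \<and> F \<subseteq> B \<and> P \<subseteq> ideal_in R F"
  using assms
proof (induction P)
  case (insert p P)
  then obtain F where F: "finite F" "F \<subseteq> B" "P \<subseteq> ideal_in R F" by blast
  have "p \<in> ideal_in R B" using insert.prems by blast
  then obtain G where G: "finite G" "G \<subseteq> B" "p \<in> ideal_in R G" using ideal_in_finite[of p R B] by blast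
  have "ideal_in R F \<subseteq> ideal_in R (F \<union> G)" by (rule ideal_in_mono) simp
  moreover have "ideal_in R G \<subseteq> ideal_in R (F \<union> G)" by (rule ideal_in_mono) simp
  ultimately have "finite (F \<union> G) \<and> F \<union> G \<subseteq> B \<and> insert p P \<subseteq> ideal_in R (F \<union> G)"
    using F G by blast
  then show ?case ..
qed (rule exI[of _ "{}"], simp)

text \<open>F is chosen inside B: finitely many of the given generators suffice. In this form
  Noetherianity becomes compactness in \<open>zopen_finite_cover\<close>.\<close>

definition noetherian_set :: "'a::comm_ring_1 set \<Rightarrow> bool" where
  "noetherian_set R \<longleftrightarrow> subring_set R \<and> (\<forall>B\<subseteq>R. \<exists>F. finite F \<and> F \<subseteq> B \<and> B \<subseteq> ideal_in R F)"

text \<open>Finitely many elements of the union of the chain generate all of it, and they already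
  lie in a single member.\<close>

lemma noetherian_chain:
  assumes R: "noetherian_set R" and J: "\<And>d. J d \<subseteq> R" "\<And>d. J d \<subseteq> J (Suc d)"
    "\<And>d. ideal_in R (J d) \<subseteq> J d"
  shows "\<exists>D. \<forall>d\<ge>D. J d = J D"
proof -
  have mono: "J d \<subseteq> J e" if "d \<le> e" for d e using lift_Suc_mono_le[of J, OF J(2) that] .
  have "(\<Union>d. J d) \<subseteq> R" using J(1) by (rule UN_least)
  then obtain F where F: "finite F" "F \<subseteq> (\<Union>d. J d)" "(\<Union>d. J d) \<subseteq> ideal_in R F"
    using R[unfolded noetherian_set_def, THEN conjunct2, rule_format, of "\<Union>d. J d"] by blast
  have "\<exists>D. F \<subseteq> J D"
    using F(1,2)
  proof (induction F)
    case (insert a F)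
    then obtain D e where "F \<subseteq> J D" "a \<in> J e" by auto
    then have "insert a F \<subseteq> J (max D e)"
      using mono[of D "max D e"] mono[of e "max D e"] by auto
    then show ?case ..
  qed simp
  then obtain D where D: "F \<subseteq> J D" ..
  have "J d \<subseteq> J D" for d using F(3) ideal_in_mono[OF D, of R] J(3)[of D] by blast
  then show ?thesis using mono by blast
qed

section \<open>Adjoining one element to a subring\<close>

primrec polys_below :: "'a::comm_ring_1 set \<Rightarrow> 'a \<Rightarrow> nat \<Rightarrow> 'a set" where
  "polys_below R x 0 = {0}"
| "polys_below R x (Suc n) = {r * x ^ n + q | r q. r \<in> R \<and> q \<in> polys_below R x n}"

declare polys_below.simps(2) [simp del]

lemma polys_below_SucI: "r \<in> R \<Longrightarrow> q \<in> polys_below R x n \<Longrightarrow> r * x ^ n + q \<in> polys_below R x (Suc n)"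
  unfolding polys_below.simps by blast

lemma polys_below_SucE:
  assumes "p \<in> polys_below R x (Suc n)"
  obtains r q where "p = r * x ^ n + q" "r \<in> R" "q \<in> polys_below R x n"
  using assms unfolding polys_below.simps by blast

text \<open>\<open>x\<close> is any element of the ambient ring, possibly algebraic over R.
  Hilbert's argument works with some representation of each element as a polynomial in
  \<open>x\<close>, not with a unique one.\<close>

definition adjoin :: "'a::comm_ring_1 set \<Rightarrow> 'a \<Rightarrow> 'a set" where
  "adjoin R x = (\<Union>n. polys_below R x n)"

context
  fixes R :: "'a::comm_ring_1 set" and x :: 'a
  assumes R: "subring_set R"
begin

lemma polys_below_Suc: "polys_below R x n \<subseteq> polys_below R x (Suc n)"
proof
  fix q assume "q \<in> polys_below R x n"
  then have "0 * x ^ n + q \<in> polys_below R x (Suc n)" by (rule polys_below_SucI[OF subring_setD(1)[OF R]])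
  then show "q \<in> polys_below R x (Suc n)" by simp
qed

lemma polys_below_mono: "m \<le> n \<Longrightarrow> polys_below R x m \<subseteq> polys_below R x n"
  by (rule lift_Suc_mono_le[of "polys_below R x", OF polys_below_Suc])

lemma polys_below_0: "0 \<in> polys_below R x n"
  using polys_below_mono[of 0 n] by simp

lemma polys_below_add: "p \<in> polys_below R x n \<Longrightarrow> q \<in> polys_below R x n \<Longrightarrow> p + q \<in> polys_below R x n"
proof (induction n arbitrary: p q)
  case (Suc n)
  obtain r p' where p: "p = r * x ^ n + p'" "r \<in> R" "p' \<in> polys_below R x n"
    using Suc.prems(1) by (rule polys_below_SucE)
  obtain s q' where q: "q = s * x ^ n + q'" "s \<in> R" "q' \<in> polys_below R x n"
    using Suc.prems(2) by (rule polys_below_SucE)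
  have "p + q = (r + s) * x ^ n + (p' + q')" by (simp add: p q algebra_simps)
  then show ?case using polys_below_SucI[OF subring_setD(3)[OF R p(2) q(2)] Suc.IH[OF p(3) q(3)]] by simp
qed simp

lemma polys_below_scale: "c \<in> R \<Longrightarrow> p \<in> polys_below R x n \<Longrightarrow> c * p \<in> polys_below R x n"
proof (induction n arbitrary: p)
  case (Suc n)
  obtain r p' where *: "p = r * x ^ n + p'" "r \<in> R" "p' \<in> polys_below R x n"
    using Suc.prems(2) by (rule polys_below_SucE)
  have "c * p = (c * r) * x ^ n + c * p'" by (simp add: * algebra_simps)
  then show ?case
    using polys_below_SucI[OF subring_setD(4)[OF R Suc.prems(1) *(2)] Suc.IH[OF Suc.prems(1) *(3)]] by simp
qed simp

lemma polys_below_shift: "p \<in> polys_below R x n \<Longrightarrow> x * p \<in> polys_below R x (Suc n)"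
proof (induction n arbitrary: p)
  case 0
  then show ?case using polys_below_0[of "Suc 0"] by simp
next
  case (Suc n)
  obtain r p' where *: "p = r * x ^ n + p'" "r \<in> R" "p' \<in> polys_below R x n"
    using Suc.prems by (rule polys_below_SucE)
  have "x * p = r * x ^ Suc n + x * p'" by (simp add: * algebra_simps)
  then show ?case using polys_below_SucI[OF *(2) Suc.IH[OF *(3)]] by simp
qed

lemma polys_below_power: "p \<in> polys_below R x n \<Longrightarrow> x ^ k * p \<in> polys_below R x (k + n)"
  by (induction k) (auto simp: mult.assoc intro: polys_below_shift)

lemma adjoin_mono: "polys_below R x n \<subseteq> adjoin R x"
  by (auto simp: adjoin_def)

lemma adjoin_add: assumes "p \<in> adjoin R x" "q \<in> adjoin R x" shows "p + q \<in> adjoin R x"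
proof -
  obtain m n where "p \<in> polys_below R x m" "q \<in> polys_below R x n" using assms by (auto simp: adjoin_def)
  then have "p \<in> polys_below R x (max m n)" "q \<in> polys_below R x (max m n)"
    using polys_below_mono[of m "max m n"] polys_below_mono[of n "max m n"] by auto
  then show ?thesis using polys_below_add adjoin_mono by blast
qed

lemma adjoin_base: "R \<subseteq> adjoin R x"
proof
  fix r assume "r \<in> R"
  then have "r * x ^ 0 + 0 \<in> polys_below R x (Suc 0)" by (rule polys_below_SucI) simp
  then show "r \<in> adjoin R x" using adjoin_mono[of "Suc 0"] by auto
qed

lemma adjoin_shift: "p \<in> adjoin R x \<Longrightarrow> x * p \<in> adjoin R x"
  unfolding adjoin_def using polys_below_shift by blast

lemma adjoin_self: "x \<in> adjoin R x"
  using adjoin_shift[of 1] adjoin_base subring_setD(2)[OF R] by auto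

lemma adjoin_scale: "r \<in> R \<Longrightarrow> p \<in> adjoin R x \<Longrightarrow> r * p \<in> adjoin R x"
  unfolding adjoin_def using polys_below_scale by blast

lemma adjoin_power: "p \<in> adjoin R x \<Longrightarrow> x ^ n * p \<in> adjoin R x"
  by (induction n) (auto simp: mult.assoc intro: adjoin_shift)

lemma adjoin_mult: assumes "p \<in> adjoin R x" "q \<in> adjoin R x" shows "p * q \<in> adjoin R x"
proof -
  obtain n where "p \<in> polys_below R x n" using assms by (auto simp: adjoin_def)
  then show ?thesis
  proof (induction n arbitrary: p)
    case 0
    then show ?case using adjoin_base subring_setD(1)[OF R] by auto
  next
    case (Suc n)
    obtain r p' where *: "p = r * x ^ n + p'" "r \<in> R" "p' \<in> polys_below R x n"
      using Suc.prems by (rule polys_below_SucE)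
    have "p * q = r * (x ^ n * q) + p' * q" by (simp add: * algebra_simps)
    then show ?case
      using adjoin_add[OF adjoin_scale[OF *(2) adjoin_power[OF assms(2)]] Suc.IH[OF *(3)]] by simp
  qed
qed

lemma subring_adjoin: "subring_set (adjoin R x)"
  unfolding subring_set_def
proof (intro conjI ballI)
  show "0 \<in> adjoin R x" "1 \<in> adjoin R x" using adjoin_base subring_setD(1,2)[OF R] by auto
  fix a assume a: "a \<in> adjoin R x"
  show "- a \<in> adjoin R x"
    using adjoin_scale[OF _ a, of "- 1"] subring_setD(2,5)[OF R] by simp
  fix b assume "b \<in> adjoin R x"
  then show "a + b \<in> adjoin R x" "a * b \<in> adjoin R x" using a adjoin_add adjoin_mult by auto
qed

end

text \<open>Hilbert's argument: a generating set of an ideal is assembled from finitely many generators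
  of the ideals of leading coefficients in each degree, which are stationary.\<close>

theorem noetherian_adjoin:
  assumes N: "noetherian_set R" shows "noetherian_set (adjoin R x)"
proof -
  have R: "subring_set R" using N by (simp add: noetherian_set_def)
  let ?A = "adjoin R x"
  note A = subring_adjoin[OF R, of x]
  have "\<exists>F. finite F \<and> F \<subseteq> B \<and> B \<subseteq> ideal_in ?A F" if B: "B \<subseteq> ?A" for B
  proof -
    let ?I = "ideal_in ?A B"
    define J where "J d = {r \<in> R. \<exists>q\<in>polys_below R x d. r * x ^ d + q \<in> ?I}" for d
    have shift: "x ^ k * y \<in> ideal_in ?A C" if "y \<in> ideal_in ?A C" for k y C
      using that adjoin_power[OF R, of 1 x k] subring_setD(2)[OF A] by (intro ideal_in_scale[OF A]) auto
    have J1: "J d \<subseteq> R" for d by (auto simp: J_def)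
    have J2: "J d \<subseteq> J (Suc d)" for d
    proof
      fix r assume "r \<in> J d"
      then obtain q where q: "r \<in> R" "q \<in> polys_below R x d" "r * x ^ d + q \<in> ?I" by (auto simp: J_def)
      have "x ^ 1 * (r * x ^ d + q) \<in> ?I" using shift q(3) by blast
      then have "r * x ^ Suc d + x * q \<in> ?I" by (simp add: algebra_simps)
      then show "r \<in> J (Suc d)" using q polys_below_shift[OF R q(2)] unfolding J_def by blast
    qed
    have J3: "ideal_in R (J d) \<subseteq> J d" for d
    proof
      fix r assume "r \<in> ideal_in R (J d)"
      then show "r \<in> J d"
      proof (induction rule: ideal_in.induct)
        case zero
        have "0 * x ^ d + 0 \<in> ?I" by (simp add: ideal_in.zero)
        then show ?case using polys_below_0[OF R] subring_setD(1)[OF R] unfolding J_def by blast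
      next
        case (step c b y)
        obtain q where q: "b \<in> R" "q \<in> polys_below R x d" "b * x ^ d + q \<in> ?I" using step by (auto simp: J_def)
        obtain p where p: "y \<in> R" "p \<in> polys_below R x d" "y * x ^ d + p \<in> ?I" using step by (auto simp: J_def)
        have "c * (b * x ^ d + q) + (y * x ^ d + p) \<in> ?I"
          using ideal_in_add[OF ideal_in_scale[OF A _ q(3)] p(3)] step(1) adjoin_base[OF R, of x] by blast
        then have "(c * b + y) * x ^ d + (c * q + p) \<in> ?I" by (simp add: algebra_simps)
        moreover have "c * q + p \<in> polys_below R x d"
          using polys_below_add[OF R polys_below_scale[OF R step(1) q(2)] p(2)] .
        moreover have "c * b + y \<in> R" using step(1) q(1) p(1) subring_setD(3,4)[OF R] by blast
        ultimately show ?case unfolding J_def by blast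
      qed
    qed
    obtain D where D: "\<And>d. d \<ge> D \<Longrightarrow> J d = J D" using noetherian_chain[of R J, OF N J1 J2 J3] by (elim exE) (rule that, blast)
    have "\<forall>d. \<exists>F. finite F \<and> F \<subseteq> J d \<and> J d \<subseteq> ideal_in R F"
      using N[unfolded noetherian_set_def, THEN conjunct2, rule_format, OF J1] by (rule allI)
    then obtain G where G: "\<And>d. finite (G d)" "\<And>d. G d \<subseteq> J d" "\<And>d. J d \<subseteq> ideal_in R (G d)" by metis
    have "\<forall>d. \<forall>g\<in>J d. \<exists>q\<in>polys_below R x d. g * x ^ d + q \<in> ?I" by (auto simp: J_def)
    then obtain t where t: "\<And>d g. g \<in> J d \<Longrightarrow> t d g \<in> polys_below R x d"
      "\<And>d g. g \<in> J d \<Longrightarrow> g * x ^ d + t d g \<in> ?I" by metis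
    define P where "P = (\<Union>d\<in>{..D}. (\<lambda>g. g * x ^ d + t d g) ` G d)"
    have "g * x ^ d + t d g \<in> ?I" if "g \<in> G d" for d g using t(2)[of g d] G(2)[of d] that by blast
    then have P: "finite P" "P \<subseteq> ?I" using G(1) by (auto simp: P_def)
    have lead: "\<exists>z\<in>ideal_in ?A P. \<exists>q\<in>polys_below R x d. z = r * x ^ d + q"
      if "d \<le> D" "r \<in> ideal_in R (G d)" for d r
      using that(2)
    proof (induction rule: ideal_in.induct)
      case zero
      show ?case by (intro bexI[of _ 0]) (auto simp: polys_below_0[OF R] ideal_in.zero)
    next
      case (step c b y)
      then obtain z q where z: "z \<in> ideal_in ?A P" "q \<in> polys_below R x d" "z = y * x ^ d + q" by blast
      have "b * x ^ d + t d b \<in> P" using step(2) that(1) by (auto simp: P_def)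
      moreover have "c \<in> ?A" using step(1) adjoin_base[OF R] by blast
      ultimately have "c * (b * x ^ d + t d b) + z \<in> ideal_in ?A P"
        using z(1) by (intro ideal_in.step)
      moreover have "c * (b * x ^ d + t d b) + z = (c * b + y) * x ^ d + (c * t d b + q)"
        by (simp add: z algebra_simps)
      moreover have "c * t d b + q \<in> polys_below R x d"
        using polys_below_add[OF R polys_below_scale[OF R step(1) t(1)] z(2)] step(2) G(2) by blast
      ultimately show ?case by metis
    qed
    have main: "y \<in> ideal_in ?A P" if "y \<in> ?I" "y \<in> polys_below R x n" for n y
      using that
    proof (induction n arbitrary: y)
      case 0
      then show ?case by (simp add: ideal_in.zero)
    next
      case (Suc n)
      obtain r q where y: "y = r * x ^ n + q" "r \<in> R" "q \<in> polys_below R x n"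
        using Suc.prems(2) by (rule polys_below_SucE)
      \<comment> \<open>From degree D on no new leading coefficients occur; a generator of degree D
        is then shifted up by a power of x.\<close>
      define d where "d = min n D"
      have "r \<in> J n" using y Suc.prems(1) by (auto simp: J_def)
      then have "r \<in> J d" using D[of n] by (auto simp: d_def min_def)
      then obtain z p where z: "z \<in> ideal_in ?A P" "p \<in> polys_below R x d" "z = r * x ^ d + p"
        using lead[of d r] G(3) by (auto simp: d_def)
      let ?w = "x ^ (n - d) * z"
      have w: "?w \<in> ideal_in ?A P" using shift z(1) by blast
      have "n - d + d = n" by (simp add: d_def)
      then have p: "x ^ (n - d) * p \<in> polys_below R x n"
        using polys_below_power[OF R z(2), of "n - d"] by simp
      have "?w = r * (x ^ (n - d) * x ^ d) + x ^ (n - d) * p" by (simp add: z algebra_simps)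
      also have "x ^ (n - d) * x ^ d = x ^ n"
        using \<open>n - d + d = n\<close> by (simp flip: power_add)
      finally have yw: "y + - ?w = q + (- 1) * (x ^ (n - d) * p)" by (simp add: y)
      have "q + (- 1) * (x ^ (n - d) * p) \<in> polys_below R x n"
        using polys_below_add[OF R y(3) polys_below_scale[OF R _ p]] subring_setD(2,5)[OF R] by blast
      moreover have "?w \<in> ?I" using w ideal_in_subset[OF A P(2)] by blast
      then have "y + - ?w \<in> ?I" using Suc.prems(1) by (intro ideal_in_add ideal_in_uminus[OF A])
      ultimately have "y + - ?w \<in> ideal_in ?A P" using Suc.IH yw by simp
      then have "y + - ?w + ?w \<in> ideal_in ?A P" using w by (rule ideal_in_add)
      then show ?case by simp
    qed
    \<comment> \<open>P lies in the ideal and not necessarily in B; each of its finitely many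
      elements is a combination of finitely many elements of B.\<close>
    obtain F where F: "finite F" "F \<subseteq> B" "P \<subseteq> ideal_in ?A F" using ideal_in_finite_set[OF P] by blast
    have "B \<subseteq> ideal_in ?A F"
    proof
      fix b assume b: "b \<in> B"
      then obtain n where "b \<in> polys_below R x n" using B by (auto simp: adjoin_def)
      then have "b \<in> ideal_in ?A P" using main ideal_in_base[OF A b] by blast
      then show "b \<in> ideal_in ?A F" using ideal_in_subset[OF A F(3)] by blast
    qed
    then show ?thesis using F by blast
  qed
  then show ?thesis using A by (simp add: noetherian_set_def)
qed

section \<open>Polynomial rings are Noetherian and open sets quasi-compact\<close>

lemma noetherian_constants:
  "noetherian_set (range (Poly_Mapping.single 0) :: ('i, 'k::field_char_0) mpoly set)"
proof -
  let ?R = "range (Poly_Mapping.single 0) :: ('i, 'k) mpoly set"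
  have "subring_set ?R"
    unfolding subring_set_def
  proof (intro conjI ballI)
    show "0 \<in> ?R" by (rule range_eqI[of _ _ 0]) simp
    show "1 \<in> ?R" by (rule range_eqI[of _ _ 1]) simp
  next
    fix a b assume "a \<in> ?R" "b \<in> ?R"
    then show "a + b \<in> ?R" "a * b \<in> ?R"
      by (auto simp: mult_single simp flip: single_add)
  next
    fix a assume "a \<in> ?R"
    then show "- a \<in> ?R" by (auto simp flip: single_uminus)
  qed
  moreover have "\<exists>F. finite F \<and> F \<subseteq> B \<and> B \<subseteq> ideal_in ?R F" if B: "B \<subseteq> ?R" for B
  proof (cases "B \<subseteq> {0}")
    case True
    then have "B \<subseteq> ideal_in ?R {}" by (auto intro: ideal_in.zero)
    then show ?thesis by blast
  next
    case False
    then obtain b c where b: "b \<in> B" "b = Poly_Mapping.single 0 c" "c \<noteq> 0" using B by fastforce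
    have "y \<in> ideal_in ?R {b}" if "y \<in> B" for y
    proof -
      obtain e where e: "y = Poly_Mapping.single 0 e" using \<open>y \<in> B\<close> B by blast
      have "Poly_Mapping.single 0 (e / c) * b + 0 \<in> ideal_in ?R {b}"
        by (intro ideal_in.intros) auto
      then show ?thesis using b by (simp add: mult_single e)
    qed
    then show ?thesis using b by (intro exI[of _ "{b}"]) auto
  qed
  ultimately show ?thesis by (simp add: noetherian_set_def)
qed

text \<open>R is only claimed to contain the constants and the variables; being a ring, it then
  represents every polynomial function on \<open>aff_points I\<close>.\<close>

lemma noetherian_polynomials:
  assumes "finite I"
  shows "\<exists>R :: ('i, 'k::field_char_0) mpoly set. noetherian_set R \<and> range (Poly_Mapping.single 0) \<subseteq> R \<and>
    mvar ` I \<subseteq> R"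
  using assms
proof (induction I)
  case empty
  then show ?case using noetherian_constants by (intro exI[of _ "range (Poly_Mapping.single 0)"]) simp
next
  case (insert i I)
  then obtain R :: "('i, 'k) mpoly set" where R: "noetherian_set R" "range (Poly_Mapping.single 0) \<subseteq> R"
    "mvar ` I \<subseteq> R" by blast
  then have sub: "subring_set R" by (simp add: noetherian_set_def)
  show ?case
    using noetherian_adjoin[OF R(1), of "mvar i"] adjoin_base[OF sub, of "mvar i"] R(2,3)
      adjoin_self[OF sub, of "mvar i"]
    by (intro exI[of _ "adjoin R (mvar i)"]) blast
qed

text \<open>U is the union of the non-vanishing loci contained in it. Finitely many of their
  equations generate all of them as an ideal, and a point where these generators vanish is a zero of
  the whole ideal.\<close>

theorem zopen_finite_cover:
  fixes U :: "('i \<Rightarrow> 'k::field_char_0 alg_closure) set"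
  assumes I: "finite I" and U: "zopen (aff_points I) U"
  shows "\<exists>F\<subseteq>PF. finite F \<and> U = (\<Union>b\<in>F. {x \<in> aff_points I. b x \<noteq> 0})"
proof -
  obtain R :: "('i, 'k) mpoly set" where R: "noetherian_set R" "range (Poly_Mapping.single 0) \<subseteq> R"
    "mvar ` I \<subseteq> R" using noetherian_polynomials[OF I] by blast
  then have sub: "subring_set R" by (simp add: noetherian_set_def)
  \<comment> \<open>Variables outside I vanish on \<open>aff_points I\<close>, so they are
    represented by 0 in R.\<close>
  define Q where "Q = {g. \<exists>p\<in>R. \<forall>x\<in>aff_points I. g x = mp_eval to_ac p x}"
  have Q: "g \<in> Q" if "g \<in> PF" for g
  proof -
    have "(\<lambda>x. g (id x)) \<in> Q"
      using that
    proof (rule PF_compose_in)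
      show "(\<lambda>_. to_ac c) \<in> Q" for c
        using R(2) unfolding Q_def
        by (intro CollectI bexI[of _ "Poly_Mapping.single 0 c"]) (auto simp: to_ac.eval_single)
      show "(\<lambda>x. id x i) \<in> Q" for i
      proof (cases "i \<in> I")
        case True
        then show ?thesis using R(3) unfolding Q_def by (intro CollectI bexI[of _ "mvar i"]) auto
      next
        case False
        then show ?thesis using subring_setD(1)[OF sub] unfolding Q_def
          by (intro CollectI bexI[of _ 0]) (auto simp: aff_points_def)
      qed
    next
      fix f g assume "f \<in> Q" "g \<in> Q"
      then have "\<exists>p\<in>R. \<forall>x\<in>aff_points I. f x = mp_eval to_ac p x"
        "\<exists>q\<in>R. \<forall>x\<in>aff_points I. g x = mp_eval to_ac q x" unfolding Q_def by simp_all
      then obtain p q where p: "p \<in> R" "\<forall>x\<in>aff_points I. f x = mp_eval to_ac p x"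
        and q: "q \<in> R" "\<forall>x\<in>aff_points I. g x = mp_eval to_ac q x" by (elim bexE) (rule that)
      show "(\<lambda>x. f x + g x) \<in> Q"
        unfolding Q_def using p q subring_setD(3)[OF sub]
        by (intro CollectI bexI[of _ "p + q"]) (auto simp: to_ac.eval_add)
      show "(\<lambda>x. f x * g x) \<in> Q"
        unfolding Q_def using p q subring_setD(4)[OF sub]
        by (intro CollectI bexI[of _ "p * q"]) (auto simp: to_ac.eval_mult)
    qed
    then show ?thesis by simp
  qed
  define D where "D p = {x \<in> aff_points I. mp_eval to_ac p x \<noteq> 0}" for p :: "('i, 'k) mpoly"
  define B where "B = {p \<in> R. D p \<subseteq> U}"
  obtain F where F: "finite F" "F \<subseteq> B" "B \<subseteq> ideal_in R F"
    using R(1)[unfolded noetherian_set_def, THEN conjunct2, rule_format, of B] by (auto simp: B_def)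
  have "U \<subseteq> (\<Union>p\<in>F. D p)"
  proof
    fix y assume y: "y \<in> U"
    then obtain b where b: "b \<in> PF" "b y \<noteq> 0" "\<And>q. q \<in> aff_points I \<Longrightarrow> b q \<noteq> 0 \<Longrightarrow> q \<in> U"
      by (rule zopenE[OF U]) (rule that)
    have "\<exists>p\<in>R. \<forall>x\<in>aff_points I. b x = mp_eval to_ac p x" using Q[OF b(1)] unfolding Q_def by simp
    then obtain p where p: "p \<in> R" "\<forall>x\<in>aff_points I. b x = mp_eval to_ac p x" ..
    have "p \<in> B" using p b(3) by (auto simp: B_def D_def)
    then have "p \<in> ideal_in R F" using F(3) by blast
    moreover have "mp_eval to_ac q y = 0" if "q \<in> ideal_in R F" "\<And>p. p \<in> F \<Longrightarrow> mp_eval to_ac p y = 0" for q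
      using that(1) by (induction rule: ideal_in.induct) (auto simp: to_ac.eval_add to_ac.eval_mult that(2))
    ultimately have "\<exists>p\<in>F. mp_eval to_ac p y \<noteq> 0" using p(2) b(2) zopenD[OF U] y by fastforce
    then show "y \<in> (\<Union>p\<in>F. D p)" using zopenD[OF U] y by (auto simp: D_def)
  qed
  then have "U = (\<Union>p\<in>F. D p)" using F(2) by (auto simp: B_def)
  then show ?thesis using F(1) PF_mp_eval unfolding D_def
    by (intro exI[of _ "mp_eval to_ac ` F"]) auto
qed


section \<open>Locally closed sets are varieties\<close>

text \<open>Locally closed in the space of all families, whatever the index set. Free of I, the
  notion is stable under preimages along polynomial maps between different index types.\<close>

definition loc_closed :: "('i \<Rightarrow> 'k::field_char_0 alg_closure) set \<Rightarrow> bool" where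
  "loc_closed S \<longleftrightarrow> (\<exists>U V. zopen UNIV U \<and> zopen UNIV V \<and> S = U - V)"

lemma loc_closedI: "zopen UNIV U \<Longrightarrow> zopen UNIV V \<Longrightarrow> S = U - V \<Longrightarrow> loc_closed S"
  unfolding loc_closed_def by blast

lemma zopen_empty: "zopen S {}"
  by (simp add: zopen_def)

lemma zopen_Un: "zopen S U \<Longrightarrow> zopen S V \<Longrightarrow> zopen S (U \<union> V)"
  using zopen_Union[of "{U, V}" S] by auto

lemma zopen_UNIV_basic: "b \<in> PF \<Longrightarrow> zopen UNIV {x. b x \<noteq> 0}"
  using zopen_basic[of b UNIV] by simp

lemma zopen_vimage:
  assumes V: "zopen UNIV V" and u: "\<And>i. (\<lambda>x. u x i) \<in> PF" shows "zopen UNIV (u -` V)"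
proof (rule zopenI)
  fix p assume "p \<in> u -` V"
  then have "u p \<in> V" by simp
  then obtain b where b: "b \<in> PF" "b (u p) \<noteq> 0" "\<And>q. q \<in> UNIV \<Longrightarrow> b q \<noteq> 0 \<Longrightarrow> q \<in> V"
    by (rule zopenE[OF V]) (rule that)
  show "\<exists>b\<in>PF. b p \<noteq> 0 \<and> (\<forall>q\<in>UNIV. b q \<noteq> 0 \<longrightarrow> q \<in> u -` V)"
    using b PF_compose[OF b(1) u] by (intro bexI[of _ "\<lambda>x. b (u x)"]) auto
qed simp

lemma loc_closed_Int: "loc_closed S \<Longrightarrow> loc_closed T \<Longrightarrow> loc_closed (S \<inter> T)"
  unfolding loc_closed_def
proof (elim exE conjE)
  fix U V U' V'
  assume "zopen UNIV U" "zopen UNIV V" "S = U - V" "zopen UNIV U'" "zopen UNIV V'" "T = U' - V'"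
  then show "\<exists>U V. zopen UNIV U \<and> zopen UNIV V \<and> S \<inter> T = U - V"
    by (intro exI[of _ "U \<inter> U'"] exI[of _ "V \<union> V'"]) (auto intro: zopen_Int zopen_Un)
qed

lemma loc_closed_zopen: "zopen UNIV U \<Longrightarrow> loc_closed U"
  by (rule loc_closedI[of U "{}"]) (auto intro: zopen_empty)

lemma loc_closed_Diff: "loc_closed S \<Longrightarrow> zopen UNIV V \<Longrightarrow> loc_closed (S - V)"
  using loc_closed_Int[OF _ loc_closedI[OF zopen_self _ refl], of S V] by (simp flip: Int_Diff)

lemma loc_closed_empty: "loc_closed {}" and loc_closed_UNIV: "loc_closed UNIV"
  by (rule loc_closed_zopen[OF zopen_empty], rule loc_closed_zopen[OF zopen_self])

lemma loc_closed_neq0: "b \<in> PF \<Longrightarrow> loc_closed {x. b x \<noteq> 0}"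
  by (rule loc_closed_zopen[OF zopen_UNIV_basic])

lemma loc_closed_eq0: "b \<in> PF \<Longrightarrow> loc_closed {x. b x = 0}"
  by (rule loc_closedI[OF zopen_self zopen_UNIV_basic]) auto

lemma loc_closed_INT: "finite A \<Longrightarrow> (\<And>a. a \<in> A \<Longrightarrow> loc_closed (S a)) \<Longrightarrow> loc_closed (\<Inter>a\<in>A. S a)"
  by (induction A rule: finite_induct) (auto intro: loc_closed_UNIV loc_closed_Int)

lemma loc_closed_vimage:
  assumes "loc_closed S" "\<And>i. (\<lambda>x. u x i) \<in> PF" shows "loc_closed (u -` S)"
proof -
  obtain U V where UV: "zopen UNIV U" "zopen UNIV V" "S = U - V" using assms(1) unfolding loc_closed_def by blast
  show ?thesis
    by (rule loc_closedI[OF zopen_vimage[OF UV(1) assms(2)] zopen_vimage[OF UV(2) assms(2)]]) (auto simp: UV(3))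
qed

lemma zopen_aff_points_Compl: "zopen UNIV (- aff_points I)"
proof -
  have "- aff_points I = \<Union>((\<lambda>i. {x. x i \<noteq> 0}) ` (- I))" by (auto simp: aff_points_def)
  also have "zopen UNIV \<dots>" by (rule zopen_Union) (auto intro: zopen_UNIV_basic PF_var)
  finally show ?thesis .
qed

lemma loc_closed_aff_points: "loc_closed (aff_points I)"
  by (rule loc_closedI[OF zopen_self zopen_aff_points_Compl]) auto

lemma zopen_extend:
  assumes "zopen S V" shows "\<exists>W. zopen UNIV W \<and> V = W \<inter> S"
proof -
  let ?W = "\<Union>{{x \<in> UNIV. b x \<noteq> 0} | b. b \<in> PF \<and> {x \<in> S. b x \<noteq> 0} \<subseteq> V}"
  have "V = ?W \<inter> S" by (rule zopen_eq_Union[OF assms subset_UNIV])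
  moreover have "zopen UNIV ?W"
  proof (rule zopen_Union)
    fix W assume "W \<in> {{x \<in> UNIV. b x \<noteq> 0} | b. b \<in> PF \<and> {x \<in> S. b x \<noteq> 0} \<subseteq> V}"
    then obtain b where "b \<in> PF" "W = {x \<in> UNIV. b x \<noteq> 0}" by blast
    then show "zopen UNIV W" by (simp add: zopen_UNIV_basic)
  qed
  ultimately show ?thesis by blast
qed

text \<open>The two notions agree because \<open>aff_points I\<close> is itself closed in the space
  of all families.\<close>

lemma locally_closedin_zariski:
  "locally_closedin (zariski I) S \<longleftrightarrow> loc_closed S \<and> S \<subseteq> aff_points I"
proof
  assume "locally_closedin (zariski I) S"
  then obtain U C where S: "zopen (aff_points I) U" "C \<subseteq> aff_points I" "zopen (aff_points I) (aff_points I - C)" "S = U \<inter> C"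
    unfolding locally_closedin_def closedin_def openin_zariski topspace_zariski by blast
  obtain U' where U': "zopen UNIV U'" "U = U' \<inter> aff_points I" using zopen_extend[OF S(1)] by blast
  obtain V where V: "zopen UNIV V" "aff_points I - C = V \<inter> aff_points I" using zopen_extend[OF S(3)] by blast
  have "S = U' \<inter> aff_points I - V" using S U' V by blast
  then show "loc_closed S \<and> S \<subseteq> aff_points I"
    using loc_closed_Diff[OF loc_closed_Int[OF loc_closed_zopen[OF U'(1)] loc_closed_aff_points] V(1)] by auto
next
  assume "loc_closed S \<and> S \<subseteq> aff_points I"
  then obtain U V where S: "zopen UNIV U" "zopen UNIV V" "S = U - V" "S \<subseteq> aff_points I"
    unfolding loc_closed_def by blast
  have 1: "zopen (aff_points I) (U \<inter> aff_points I)" "zopen (aff_points I) (V \<inter> aff_points I)"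
    using zopen_restrict S by blast+
  have 2: "aff_points I - (aff_points I - V) = V \<inter> aff_points I" by blast
  show "locally_closedin (zariski I) S"
    unfolding locally_closedin_def closedin_def openin_zariski topspace_zariski
    using 1 S by (intro exI[of _ "U \<inter> aff_points I"] exI[of _ "aff_points I - V"]) (auto simp: 2)
qed

section \<open>Separatedness and affine charts\<close>

lemma restrict_reg_qspace: "f \<in> locrat S \<Longrightarrow> restrict f S \<in> reg (qspace S) S"
  by (auto simp: zopen_self intro: locrat_cong)

lemma openin_prod_Z_basic:
  assumes "openin (ztop X) U" "openin (ztop Y) V" "F \<in> biregular X Y U V"
  shows "openin (prod_topology_Z X Y) {z \<in> U \<times> V. F z \<noteq> 0}"
  unfolding prod_topology_Z_def by (rule topology_generated_by_Basis) (use assms in blast)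

lemma topspace_prod_Z:
  assumes X: "X = qspace S" and Y: "Y = qspace T"
  shows "topspace (prod_topology_Z X Y) = S \<times> T"
proof
  show "topspace (prod_topology_Z X Y) \<subseteq> S \<times> T"
    unfolding prod_topology_Z_def topology_generated_by_topspace X Y openin_qspace
  proof (rule Union_least)
    fix W assume "W \<in> {{z \<in> U \<times> V. F z \<noteq> 0} |U V F. zopen S U \<and> zopen T V \<and> F \<in> biregular (qspace S) (qspace T) U V}"
    then show "W \<subseteq> S \<times> T"
      unfolding mem_Collect_eq
    proof (elim exE conjE)
      fix U V F assume *: "W = {z \<in> U \<times> V. F z \<noteq> 0}" "zopen S U" "zopen T V"
      show ?thesis unfolding *(1) using zopenD[OF *(2)] zopenD[OF *(3)] by auto
    qed
  qed
  let ?F = "\<lambda>(x, y). \<Sum>i<(1::nat). restrict (\<lambda>_. 1) S x * restrict (\<lambda>_. 1) T y :: 'b alg_closure"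
  have "?F \<in> biregular X Y S T"
    unfolding biregular_def X Y
    by (intro CollectI exI[of _ "1 :: nat"] exI[of _ "\<lambda>_. restrict (\<lambda>_. 1) S"] exI[of _ "\<lambda>_. restrict (\<lambda>_. 1) T"] conjI refl)
       (auto intro!: restrict_reg_qspace locrat_PF PF_1 simp del: reg_qspace)
  then have "openin (prod_topology_Z X Y) {z \<in> S \<times> T. ?F z \<noteq> 0}"
    by (intro openin_prod_Z_basic) (simp_all add: X Y zopen_self)
  also have "{z \<in> S \<times> T. ?F z \<noteq> 0} = S \<times> T" by auto
  finally show "S \<times> T \<subseteq> topspace (prod_topology_Z X Y)" by (rule openin_subset)
qed

text \<open>The complement of the diagonal is the union of the loci where x_i - y_i is non-zero, and
  this difference is the sum of two products x_i * 1 + (-1) * y_i.\<close>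

lemma qspace_separated:
  fixes S :: "('i \<Rightarrow> 'k::field_char_0 alg_closure) set"
  shows "closedin (ztop (fprod (qspace S) (qspace S))) {(p, p) | p. p \<in> topspace (ztop (qspace S))}"
proof -
  let ?X = "qspace S"
  let ?f = "\<lambda>i (n::nat). if n = 0 then restrict (\<lambda>x. x i) S else restrict (\<lambda>_. - 1) S"
  let ?g = "\<lambda>i (n::nat). if n = 0 then restrict (\<lambda>_. 1) S else restrict (\<lambda>x. x i) S"
  let ?F = "\<lambda>i. \<lambda>(x, y). \<Sum>n<2. ?f i n x * ?g i n y"
  have m1: "(\<lambda>_. - 1) \<in> PF" using PF_uminus[OF PF_1] .
  have "?F i \<in> biregular ?X ?X S S" for i
    unfolding biregular_def
    by (intro CollectI exI[of _ "2 :: nat"] exI[of _ "?f i"] exI[of _ "?g i"] conjI refl)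
       (auto intro!: restrict_reg_qspace locrat_PF PF_1 PF_var m1 simp del: reg_qspace)
  then have "openin (prod_topology_Z ?X ?X) {z \<in> S \<times> S. ?F i z \<noteq> 0}" for i
    by (intro openin_prod_Z_basic) (simp_all add: zopen_self)
  then have "openin (prod_topology_Z ?X ?X) (\<Union>i. {z \<in> S \<times> S. ?F i z \<noteq> 0})"
    by (intro openin_Union) auto
  also have "(\<Union>i. {z \<in> S \<times> S. ?F i z \<noteq> 0}) = S \<times> S - {(p, p) | p. p \<in> S}"
    by (auto simp: numeral_2_eq_2 fun_eq_iff)
  finally show ?thesis
    unfolding closedin_def topspace_qspace fprod_def fspace.simps topspace_prod_Z[OF refl refl] by auto
qed

text \<open>Rabinowitsch's trick: an extra coordinate, of index n, carries 1/b, and the basic open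
  set becomes the closed set given by y_n b = 1 over C.\<close>

lemma qspace_basic_iso:
  fixes C :: "(nat \<Rightarrow> 'k::field_char_0 alg_closure) set"
  assumes C: "C \<subseteq> aff_points {..<n}" "zopen (aff_points {..<n}) (aff_points {..<n} - C)" and b: "b \<in> PF"
  shows "\<exists>(m::nat) Z. closedin (zariski {..<m}) Z \<and>
    fspace_iso (qspace {x \<in> C. b x \<noteq> 0}) (fsub (aff_space {..<m}) Z)"
proof -
  let ?n0 = "\<lambda>y :: nat \<Rightarrow> 'k alg_closure. y(n := 0)"
  define Z where "Z = {y \<in> aff_points {..<Suc n}. ?n0 y \<in> C \<and> y n * b (?n0 y) - 1 = 0}"
  have n0: "(\<lambda>y. ?n0 y i) \<in> PF" for i by (cases "i = n") (auto intro: PF_0 PF_var)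
  have n0_aff: "?n0 y \<in> aff_points {..<n}" if "y \<in> aff_points {..<Suc n}" for y
    using that by (auto simp: aff_points_def)
  have bn0: "(\<lambda>y. b (?n0 y)) \<in> PF" by (rule PF_compose[OF b n0])
  obtain V where V: "zopen UNIV V" "aff_points {..<n} - C = V \<inter> aff_points {..<n}" using zopen_extend[OF C(2)] by blast
  have "zopen UNIV (?n0 -` V \<union> {y. y n * b (?n0 y) - 1 \<noteq> 0})"
    by (intro zopen_Un zopen_vimage[OF V(1) n0] zopen_UNIV_basic PF_intros bn0)
  from zopen_restrict[OF this subset_UNIV, of "aff_points {..<Suc n}"]
  have "zopen (aff_points {..<Suc n}) ((?n0 -` V \<union> {y. y n * b (?n0 y) - 1 \<noteq> 0}) \<inter> aff_points {..<Suc n})" .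
  also have "(?n0 -` V \<union> {y. y n * b (?n0 y) - 1 \<noteq> 0}) \<inter> aff_points {..<Suc n} = aff_points {..<Suc n} - Z"
    using V(2) n0_aff unfolding Z_def by blast
  finally have "closedin (zariski {..<Suc n}) Z"
    by (auto simp: closedin_def openin_zariski Z_def)
  moreover have "fspace_iso (qspace {x \<in> C. b x \<noteq> 0}) (qspace Z)"
  proof (rule qspace_iso[of "\<lambda>x. x(n := 1 / b x)" _ _ "?n0"])
    show "(\<lambda>x. (x(n := 1 / b x)) i) \<in> locrat {x \<in> C. b x \<noteq> 0}" for i
    proof (cases "i = n")
      case True
      have "(\<lambda>x. 1 / b x) \<in> locrat {x \<in> C. b x \<noteq> 0}"
        by (rule locrat_divide[OF locrat_PF[OF PF_1] locrat_PF[OF b]]) simp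
      then show ?thesis using True by simp
    qed (simp add: locrat_PF[OF PF_var])
    show "(\<lambda>x. ?n0 x i) \<in> locrat Z" for i by (intro locrat_PF n0)
    show "x(n := 1 / b x) \<in> Z" if "x \<in> {x \<in> C. b x \<noteq> 0}" for x
    proof -
      have "x \<in> aff_points {..<n}" using that C(1) by blast
      then have "x(n := 0) = x" "x(n := 1 / b x) \<in> aff_points {..<Suc n}"
        by (auto simp: aff_points_def fun_eq_iff)
      then show ?thesis using that by (simp add: Z_def)
    qed
    show "?n0 x \<in> {x \<in> C. b x \<noteq> 0}" if "x \<in> Z" for x using that by (auto simp: Z_def)
    show "?n0 (x(n := 1 / b x)) = x" if "x \<in> {x \<in> C. b x \<noteq> 0}" for x
      using that C(1) by (auto simp: aff_points_def fun_eq_iff)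
    show "(?n0 x)(n := 1 / b (?n0 x)) = x" if "x \<in> Z" for x
    proof -
      have "x n * b (?n0 x) = 1" using that by (simp add: Z_def)
      then have "1 / b (?n0 x) = x n" by (metis divide_eq_eq mult_zero_right zero_neq_one)
      then show ?thesis by (auto simp: fun_eq_iff)
    qed
  qed
  moreover have "Z \<subseteq> aff_points {..<Suc n}" by (auto simp: Z_def)
  ultimately show ?thesis by (intro exI[of _ "Suc n"] exI[of _ Z]) (simp add: fsub_aff_space)
qed

theorem is_variety_qspace:
  fixes S :: "(nat \<Rightarrow> 'k::field_char_0 alg_closure) set"
  assumes S: "loc_closed S" "S \<subseteq> aff_points {..<n}"
  shows "is_variety (qspace S)"
  unfolding is_variety_def
proof (intro conjI)
  show "reg (qspace S) = reg (fsub (qspace S) (topspace (ztop (qspace S))))"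
    by (simp add: fsub_qspace)
  show "closedin (ztop (fprod (qspace S) (qspace S))) {(p, p) |p. p \<in> topspace (ztop (qspace S))}"
    by (rule qspace_separated)
  let ?A = "aff_points {..<n} :: (nat \<Rightarrow> 'k alg_closure) set"
  have "locally_closedin (zariski {..<n}) S" using S by (simp add: locally_closedin_zariski)
  then obtain U C where UC: "zopen ?A U" "C \<subseteq> ?A" "zopen ?A (?A - C)" "S = U \<inter> C"
    unfolding locally_closedin_def closedin_def openin_zariski topspace_zariski by blast
  obtain F where F: "F \<subseteq> PF" "finite F" "U = (\<Union>b\<in>F. {x \<in> ?A. b x \<noteq> 0})"
    using zopen_finite_cover[OF _ UC(1)] by blast
  \<comment> \<open>The locus of b lies in U, so on it S coincides with the closed set C.\<close>
  have eq: "{x \<in> S. b x \<noteq> 0} = {x \<in> C. b x \<noteq> 0}" if "b \<in> F" for b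
    using that UC(2,4) F(3) by blast
  let ?U = "(\<lambda>b. {x \<in> S. b x \<noteq> 0}) ` F"
  have "finite ?U" using F(2) by simp
  moreover have "\<Union>?U = topspace (ztop (qspace S))"
    using UC(4) F(3) by (simp, blast)
  moreover have "\<forall>W\<in>?U. openin (ztop (qspace S)) W \<and>
      (\<exists>(m::nat) Z. closedin (zariski {..<m}) Z \<and> fspace_iso (fsub (qspace S) W) (fsub (aff_space {..<m}) Z))"
  proof
    fix W assume "W \<in> ?U"
    then obtain b where b: "b \<in> F" "W = {x \<in> S. b x \<noteq> 0}" by blast
    have "b \<in> PF" using b F by blast
    moreover have "fsub (qspace S) W = qspace W" by (rule fsub_qspace) (auto simp: b(2))
    then have "fsub (qspace S) W = qspace {x \<in> C. b x \<noteq> 0}"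
      using eq[OF b(1)] b(2) by simp
    ultimately show "openin (ztop (qspace S)) W \<and>
      (\<exists>(m::nat) Z. closedin (zariski {..<m}) Z \<and> fspace_iso (fsub (qspace S) W) (fsub (aff_space {..<m}) Z))"
      using qspace_basic_iso[OF UC(2,3), of b] b(2) by (simp add: zopen_basic)
  qed
  ultimately show "\<exists>\<U>. finite \<U> \<and> \<Union>\<U> = topspace (ztop (qspace S)) \<and>
        (\<forall>U\<in>\<U>. openin (ztop (qspace S)) U \<and>
           (\<exists>(n::nat) Z. closedin (zariski {..<n}) Z \<and>
              fspace_iso (fsub (qspace S) U) (fsub (aff_space {..<n}) Z)))"
    by (intro exI[of _ ?U] conjI)
qed

section \<open>Products with the affine line\<close>

lemma biregular_sum:
  assumes A: "finite A" and f: "\<And>a. a \<in> A \<Longrightarrow> f a \<in> reg X U" and g: "\<And>a. a \<in> A \<Longrightarrow> g a \<in> reg Y V"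
  shows "(\<lambda>(x, y). \<Sum>a\<in>A. f a x * g a y) \<in> biregular X Y U V"
proof -
  obtain h where h: "bij_betw h {0..<card A} A" using ex_bij_betw_nat_finite[OF A] by blast
  have "(\<Sum>a\<in>A. f a x * g a y) = (\<Sum>i<card A. f (h i) x * g (h i) y)" for x y
    using sum.reindex_bij_betw[OF h, of "\<lambda>a. f a x * g a y"] by (simp add: atLeast0LessThan)
  moreover have "h i \<in> A" if "i < card A" for i
    using h that by (auto simp: bij_betw_def)
  ultimately show ?thesis unfolding biregular_def
    using f g by (intro CollectI exI[of _ "card A"] exI[of _ "f \<circ> h"] exI[of _ "g \<circ> h"]) auto
qed

lemma biregularE:
  assumes "F \<in> biregular X Y U V"
  obtains n :: nat and f g where "\<And>i. i < n \<Longrightarrow> f i \<in> reg X U" "\<And>i. i < n \<Longrightarrow> g i \<in> reg Y V"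
    "F = (\<lambda>(x, y). \<Sum>i<n. f i x * g i y)"
  using assms unfolding biregular_def mem_Collect_eq
proof (elim exE conjE)
  fix n :: nat and f g
  assume *: "\<forall>i<n. f i \<in> reg X U \<and> g i \<in> reg Y V" and F: "F = (\<lambda>(x, y). \<Sum>i<n. f i x * g i y)"
  show ?thesis by (rule that[OF _ _ F]) (simp_all add: *)
qed

lemma biregular_add:
  assumes "F \<in> biregular X Y U V" "G \<in> biregular X Y U V"
  shows "(\<lambda>z. F z + G z) \<in> biregular X Y U V"
proof -
  obtain n :: nat and f g where F: "\<And>i. i < n \<Longrightarrow> f i \<in> reg X U" "\<And>i. i < n \<Longrightarrow> g i \<in> reg Y V"
    "F = (\<lambda>(x, y). \<Sum>i<n. f i x * g i y)" using assms(1) by (rule biregularE) (rule that)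
  obtain m :: nat and f' g' where G: "\<And>i. i < m \<Longrightarrow> f' i \<in> reg X U" "\<And>i. i < m \<Longrightarrow> g' i \<in> reg Y V"
    "G = (\<lambda>(x, y). \<Sum>i<m. f' i x * g' i y)" using assms(2) by (rule biregularE) (rule that)
  have "(\<lambda>(x, y). \<Sum>a\<in>{..<n} <+> {..<m}. case_sum f f' a x * case_sum g g' a y) \<in> biregular X Y U V"
    by (rule biregular_sum) (auto simp: F(1,2) G(1,2))
  then show ?thesis by (simp add: F(3) G(3) sum.Plus case_prod_unfold)
qed

text \<open>Equality is claimed on U x V only: regular functions are \<open>undefined\<close>
  outside their domain, and a product of two such functions has to be restricted again.\<close>

lemma biregular_mult:
  assumes F: "F \<in> biregular X Y U V" and G: "G \<in> biregular X Y U V"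
    and X: "\<And>f f'. f \<in> reg X U \<Longrightarrow> f' \<in> reg X U \<Longrightarrow> \<exists>f''\<in>reg X U. \<forall>x\<in>U. f'' x = f x * f' x"
    and Y: "\<And>f f'. f \<in> reg Y V \<Longrightarrow> f' \<in> reg Y V \<Longrightarrow> \<exists>f''\<in>reg Y V. \<forall>x\<in>V. f'' x = f x * f' x"
  shows "\<exists>H\<in>biregular X Y U V. \<forall>z\<in>U \<times> V. H z = F z * G z"
proof -
  obtain n :: nat and f g where F: "\<And>i. i < n \<Longrightarrow> f i \<in> reg X U" "\<And>i. i < n \<Longrightarrow> g i \<in> reg Y V"
    "F = (\<lambda>(x, y). \<Sum>i<n. f i x * g i y)" using F by (rule biregularE) (rule that)
  obtain m :: nat and f' g' where G: "\<And>i. i < m \<Longrightarrow> f' i \<in> reg X U" "\<And>i. i < m \<Longrightarrow> g' i \<in> reg Y V"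
    "G = (\<lambda>(x, y). \<Sum>i<m. f' i x * g' i y)" using G by (rule biregularE) (rule that)
  let ?A = "{..<n} \<times> {..<m}"
  have "\<forall>a\<in>?A. \<exists>f''\<in>reg X U. \<forall>x\<in>U. f'' x = f (fst a) x * f' (snd a) x"
    using X F(1) G(1) by auto
  then have "\<exists>h. \<forall>a\<in>?A. h a \<in> reg X U \<and> (\<forall>x\<in>U. h a x = f (fst a) x * f' (snd a) x)"
    unfolding Bex_def by (rule bchoice)
  then obtain h where h: "\<forall>a\<in>?A. h a \<in> reg X U \<and> (\<forall>x\<in>U. h a x = f (fst a) x * f' (snd a) x)" ..
  have "\<forall>a\<in>?A. \<exists>f''\<in>reg Y V. \<forall>x\<in>V. f'' x = g (fst a) x * g' (snd a) x"
    using Y F(2) G(2) by auto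
  then have "\<exists>h. \<forall>a\<in>?A. h a \<in> reg Y V \<and> (\<forall>x\<in>V. h a x = g (fst a) x * g' (snd a) x)"
    unfolding Bex_def by (rule bchoice)
  then obtain k where k: "\<forall>a\<in>?A. k a \<in> reg Y V \<and> (\<forall>x\<in>V. k a x = g (fst a) x * g' (snd a) x)" ..
  have "(\<lambda>(x, y). \<Sum>a\<in>?A. h a x * k a y) \<in> biregular X Y U V"
    by (rule biregular_sum) (use h k in auto)
  moreover have "(\<Sum>a\<in>?A. h a x * k a y) = F (x, y) * G (x, y)" if "x \<in> U" "y \<in> V" for x y
  proof -
    have "(\<Sum>a\<in>?A. h a x * k a y) = (\<Sum>a\<in>?A. (f (fst a) x * g (fst a) y) * (f' (snd a) x * g' (snd a) y))"
    proof (rule sum.cong[OF refl])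
      fix a assume a: "a \<in> ?A"
      show "h a x * k a y = (f (fst a) x * g (fst a) y) * (f' (snd a) x * g' (snd a) y)"
        using bspec[OF h a] bspec[OF k a] that by simp
    qed
    also have "\<dots> = F (x, y) * G (x, y)"
      by (simp add: F(3) G(3) sum_product sum.cartesian_product case_prod_unfold)
    finally show ?thesis .
  qed
  ultimately show ?thesis by (intro bexI[of _ "\<lambda>(x, y). \<Sum>a\<in>?A. h a x * k a y"]) auto
qed

lemma reg_qspace_mult:
  "f \<in> reg (qspace S) U \<Longrightarrow> f' \<in> reg (qspace S) U \<Longrightarrow> \<exists>f''\<in>reg (qspace S) U. \<forall>x\<in>U. f'' x = f x * f' x"
  by (rule bexI[of _ "restrict (\<lambda>x. f x * f' x) U"]) (auto intro: locrat_cong[OF locrat_mult])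

lemma biregular_cmult:
  assumes "f \<in> locrat S" "g \<in> locrat T"
  shows "\<exists>H\<in>biregular (qspace S) (qspace T) S T. \<forall>z\<in>S \<times> T. H z = f (fst z) * g (snd z)"
proof -
  have "(\<lambda>(x, y). \<Sum>a\<in>{()}. restrict f S x * restrict g T y) \<in> biregular (qspace S) (qspace T) S T"
    by (rule biregular_sum[where f = "\<lambda>_. restrict f S" and g = "\<lambda>_. restrict g T"])
       (use assms[THEN restrict_reg_qspace] in simp_all)
  then show ?thesis by (rule bexI[rotated]) auto
qed

text \<open>A copy of the affine line with coordinates indexed by \<open>nat\<close>, as the type
  \<open>variety\<close> demands.\<close>

definition line :: "(nat \<Rightarrow> 'k::field_char_0 alg_closure) set" where
  "line = aff_points {0}"

definition to_line :: "'k::field_char_0 alg_closure \<Rightarrow> nat \<Rightarrow> 'k alg_closure" where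
  "to_line c = (\<lambda>m. if m = 0 then c else 0)"

lemma to_line [simp]: "to_line c \<in> line" "to_line c 0 = c" "y \<in> line \<Longrightarrow> to_line (y 0) = y"
  by (auto simp: to_line_def line_def aff_points_def fun_eq_iff)

lemma zopen_preimage:
  assumes u: "\<And>i. (\<lambda>x. u x i) \<in> PF" and V: "zopen B V" and AB: "\<And>x. x \<in> A \<Longrightarrow> u x \<in> B"
  shows "zopen A {x \<in> A. u x \<in> V}"
proof -
  obtain W where W: "zopen UNIV W" "V = W \<inter> B" using zopen_extend[OF V] by blast
  have "zopen A (u -` W \<inter> A)" by (rule zopen_restrict[OF zopen_vimage[OF W(1) u] subset_UNIV])
  also have "u -` W \<inter> A = {x \<in> A. u x \<in> V}" using W(2) AB by auto
  finally show ?thesis .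
qed

lemma fspace_morphismI:
  assumes "continuous_map (ztop X) (ztop Y) u"
    and "\<And>V g. openin (ztop Y) V \<Longrightarrow> g \<in> reg Y V \<Longrightarrow>
      restrict (g \<circ> u) (u -` V \<inter> topspace (ztop X)) \<in> reg X (u -` V \<inter> topspace (ztop X))"
  shows "fspace_morphism X Y u"
  using assms unfolding fspace_morphism_def by blast

lemma ztop_fprod: "ztop (fprod X Y) = prod_topology_Z X Y"
  by (simp add: fprod_def)

section \<open>A free coordinate as a product with the line\<close>

context
  fixes S T :: "('i \<Rightarrow> 'k::field_char_0 alg_closure) set" and p :: 'i
  assumes S0: "\<And>x. x \<in> S \<Longrightarrow> x p = 0" and T: "T = {x. x(p := 0) \<in> S}"
begin

private abbreviation "\<phi> \<equiv> \<lambda>x :: 'i \<Rightarrow> 'k alg_closure. (x(p := 0), to_line (x p))"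
private abbreviation "\<psi> \<equiv> \<lambda>z :: ('i \<Rightarrow> 'k alg_closure) \<times> (nat \<Rightarrow> 'k alg_closure). (fst z)(p := snd z 0)"

lemma line_PF1: "(\<lambda>x. (x(p := 0)) i) \<in> PF" by (cases "i = p") (auto intro: PF_0 PF_var)

lemma line_PF2: "(\<lambda>x. to_line (x p) i) \<in> PF" by (cases "i = 0") (auto simp: to_line_def intro: PF_0 PF_var)

lemma line_basic_zopen:
  assumes "zopen S U" "zopen line V" shows "zopen T {x \<in> T. x(p := 0) \<in> U \<and> to_line (x p) \<in> V}"
proof -
  have "zopen T ({x \<in> T. x(p := 0) \<in> U} \<inter> {x \<in> T. to_line (x p) \<in> V})"
    using zopen_preimage[where u = "\<lambda>x. x(p := 0)", OF line_PF1 assms(1), of T]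
      zopen_preimage[where u = "\<lambda>x. to_line (x p)", OF line_PF2 assms(2), of T]
    by (intro zopen_Int) (simp_all add: T)
  also have "{x \<in> T. x(p := 0) \<in> U} \<inter> {x \<in> T. to_line (x p) \<in> V} = {x \<in> T. x(p := 0) \<in> U \<and> to_line (x p) \<in> V}" by auto
  finally show ?thesis .
qed

lemma biregular_locrat:
  assumes "F \<in> biregular (qspace S) (qspace line) U V"
    and A: "\<And>x. x \<in> A \<Longrightarrow> x(p := 0) \<in> U" "\<And>x. x \<in> A \<Longrightarrow> to_line (x p) \<in> V"
  shows "(\<lambda>x. F (\<phi> x)) \<in> locrat A"
proof -
  obtain n :: nat and f g where F: "\<And>i. i < n \<Longrightarrow> f i \<in> reg (qspace S) U" "\<And>i. i < n \<Longrightarrow> g i \<in> reg (qspace line) V"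
    "F = (\<lambda>(x, y). \<Sum>i<n. f i x * g i y)" using assms(1) by (rule biregularE) (rule that)
  have "(\<lambda>x. \<Sum>i<n. f i (x(p := 0)) * g i (to_line (x p))) \<in> locrat A"
  proof (intro locrat_sum locrat_mult)
    fix i assume "i \<in> {..<n}"
    then have fg: "f i \<in> locrat U" "g i \<in> locrat V" using F(1,2) by auto
    show "(\<lambda>x. f i (x(p := 0))) \<in> locrat A"
      by (rule locrat_compose[where u = "\<lambda>x. x(p := 0)", OF fg(1) locrat_PF[OF line_PF1] A(1)])
    show "(\<lambda>x. g i (to_line (x p))) \<in> locrat A"
    proof (rule locrat_compose[where u = "\<lambda>x. to_line (x p)", OF fg(2)])
      show "(\<lambda>x. to_line (x p) i) \<in> locrat A" for i by (rule locrat_PF[OF line_PF2])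
    qed (rule A(2))
  qed
  then show ?thesis by (simp add: F(3))
qed

text \<open>Along phi a sum of products of regular functions becomes locally rational
  (\<open>biregular_locrat\<close>); this settles the generating open sets and the regular functions
  alike.\<close>

lemma to_prod_morphism: "fspace_morphism (qspace T) (fprod (qspace S) (qspace line)) \<phi>"
proof -
  let ?X = "qspace S" and ?Y = "qspace line :: (nat \<Rightarrow> 'k alg_closure, 'k alg_closure) fspace"
  have cont: "continuous_map (ztop (qspace T)) (prod_topology_Z ?X ?Y) \<phi>"
    unfolding prod_topology_Z_def
  proof (rule continuous_on_generated_topo)
    fix W assume "W \<in> {{z \<in> U \<times> V. F z \<noteq> 0} | U V F. openin (ztop ?X) U \<and> openin (ztop ?Y) V \<and> F \<in> biregular ?X ?Y U V}"
    then show "openin (ztop (qspace T)) (\<phi> -` W \<inter> topspace (ztop (qspace T)))"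
      unfolding mem_Collect_eq
    proof (elim exE conjE)
      fix U V F assume W: "W = {z \<in> U \<times> V. F z \<noteq> 0}" and U: "openin (ztop ?X) U" and V: "openin (ztop ?Y) V"
        and F: "F \<in> biregular ?X ?Y U V"
      let ?A = "{x \<in> T. x(p := 0) \<in> U \<and> to_line (x p) \<in> V}"
      have "zopen T ?A" using U V by (intro line_basic_zopen) auto
      moreover have "zopen ?A {x \<in> ?A. F (\<phi> x) \<noteq> 0}" by (rule zopen_locrat, rule biregular_locrat[OF F]) auto
      ultimately have "zopen T {x \<in> ?A. F (\<phi> x) \<noteq> 0}" by (rule zopen_trans)
      also have "{x \<in> ?A. F (\<phi> x) \<noteq> 0} = \<phi> -` W \<inter> topspace (ztop (qspace T))" by (auto simp: W)
      finally show ?thesis by simp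
    qed
  next
    have "\<Union>{{z \<in> U \<times> V. F z \<noteq> 0} | U V F. openin (ztop ?X) U \<and> openin (ztop ?Y) V \<and> F \<in> biregular ?X ?Y U V}
      = topspace (prod_topology_Z ?X ?Y)"
      by (simp add: prod_topology_Z_def)
    also have "\<dots> = S \<times> line" by (rule topspace_prod_Z[OF refl refl])
    finally show "\<phi> ` topspace (ztop (qspace T)) \<subseteq> \<Union>{{z \<in> U \<times> V. F z \<noteq> 0} | U V F. openin (ztop ?X) U \<and> openin (ztop ?Y) V \<and> F \<in> biregular ?X ?Y U V}"
      by (auto simp: T)
  qed
  have "restrict (g \<circ> \<phi>) (\<phi> -` W \<inter> T) \<in> reg (qspace T) (\<phi> -` W \<inter> T)"
    if W: "openin (prod_topology_Z ?X ?Y) W" and g: "g \<in> reg (fprod ?X ?Y) W" for W g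
  proof -
    let ?W = "\<phi> -` W \<inter> T"
    have oW: "zopen T ?W"
      using openin_continuous_map_preimage[OF cont W] by (simp add: vimage_def Int_def conj_commute)
    have "(\<lambda>x. g (\<phi> x)) \<in> locrat ?W"
    proof (rule locrat_local)
      fix x assume x: "x \<in> ?W"
      have "\<forall>z\<in>W. \<exists>U V a b. openin (ztop ?X) U \<and> openin (ztop ?Y) V \<and> z \<in> U \<times> V \<and>
                    a \<in> biregular ?X ?Y U V \<and> b \<in> biregular ?X ?Y U V \<and> b z \<noteq> 0 \<and>
                    (\<forall>q\<in>W \<inter> U \<times> V. b q \<noteq> 0 \<longrightarrow> g q = a q / b q)"
        using g by (simp add: fprod_def)
      moreover have "\<phi> x \<in> W" using x by simp
      ultimately have "\<exists>U V a b. openin (ztop ?X) U \<and> openin (ztop ?Y) V \<and> \<phi> x \<in> U \<times> V \<and>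
                    a \<in> biregular ?X ?Y U V \<and> b \<in> biregular ?X ?Y U V \<and> b (\<phi> x) \<noteq> 0 \<and>
                    (\<forall>q\<in>W \<inter> U \<times> V. b q \<noteq> 0 \<longrightarrow> g q = a q / b q)" by (rule bspec)
      then show "\<exists>A f. zopen ?W A \<and> x \<in> A \<and> f \<in> locrat A \<and> (\<forall>q\<in>A. g (\<phi> q) = f q)"
      proof (elim exE conjE)
        fix U V a b
        assume U: "openin (ztop ?X) U" and V: "openin (ztop ?Y) V" and z: "\<phi> x \<in> U \<times> V"
          and a: "a \<in> biregular ?X ?Y U V" and b: "b \<in> biregular ?X ?Y U V" and bz: "b (\<phi> x) \<noteq> 0"
          and eq: "\<forall>q\<in>W \<inter> U \<times> V. b q \<noteq> 0 \<longrightarrow> g q = a q / b q"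
        let ?A = "{x \<in> T. x(p := 0) \<in> U \<and> to_line (x p) \<in> V} \<inter> ?W"
        let ?B = "{x \<in> ?A. b (\<phi> x) \<noteq> 0}"
        have "zopen T {x \<in> T. x(p := 0) \<in> U \<and> to_line (x p) \<in> V}" using U V by (intro line_basic_zopen) auto
        then have "zopen ?W ?A" by (rule zopen_restrict) auto
        moreover have "zopen ?A ?B" by (rule zopen_locrat, rule biregular_locrat[OF b]) auto
        ultimately have "zopen ?W ?B" by (rule zopen_trans)
        moreover have "x \<in> ?B" using x z bz by auto
        moreover have "(\<lambda>x. a (\<phi> x) / b (\<phi> x)) \<in> locrat ?B"
          by (intro locrat_divide biregular_locrat[OF a] biregular_locrat[OF b]) auto
        moreover have "\<forall>q\<in>?B. g (\<phi> q) = a (\<phi> q) / b (\<phi> q)" using eq by auto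
        ultimately show ?thesis by (intro exI conjI)
      qed
    qed
    then have "restrict (g \<circ> \<phi>) ?W \<in> locrat ?W" by (rule locrat_cong) auto
    then show ?thesis using oW by simp
  qed
  with cont show ?thesis
    by (intro fspace_morphismI) (simp_all only: ztop_fprod topspace_qspace)
qed

text \<open>The coordinates of psi depend on one factor only, and sums of products of regular
  functions are closed under addition and multiplication, so \<open>PF_compose_in\<close>
  applies.\<close>

lemma polynomial_biregular:
  assumes "b \<in> PF"
  shows "\<exists>B\<in>biregular (qspace S) (qspace line) S line. \<forall>z\<in>S \<times> line. B z = b (\<psi> z)"
proof -
  let ?X = "qspace S" and ?Y = "qspace line :: (nat \<Rightarrow> 'k alg_closure, 'k alg_closure) fspace"
  let ?R = "{F. \<exists>B\<in>biregular ?X ?Y S line. \<forall>z\<in>S \<times> line. B z = F z}"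
  have "(\<lambda>z. b (\<psi> z)) \<in> ?R"
    using assms
  proof (rule PF_compose_in)
    show "(\<lambda>_. to_ac c) \<in> ?R" for c
      using biregular_cmult[OF locrat_PF[OF PF_const[of c]] locrat_PF[OF PF_1], of S line] by simp
    show "(\<lambda>z. \<psi> z i) \<in> ?R" for i
    proof (cases "i = p")
      case True
      then show ?thesis
        using biregular_cmult[OF locrat_PF[OF PF_1] locrat_PF[OF PF_var[of 0]], of S line] by simp
    next
      case False
      then show ?thesis
        using biregular_cmult[OF locrat_PF[OF PF_var[of i]] locrat_PF[OF PF_1], of S line] by simp
    qed
  next
    fix F G assume "F \<in> ?R" "G \<in> ?R"
    then obtain B C where B: "B \<in> biregular ?X ?Y S line" "\<forall>z\<in>S \<times> line. B z = F z"
      and C: "C \<in> biregular ?X ?Y S line" "\<forall>z\<in>S \<times> line. C z = G z"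
      unfolding mem_Collect_eq by (elim bexE) (rule that)
    show "(\<lambda>z. F z + G z) \<in> ?R"
      using biregular_add[OF B(1) C(1)] B(2) C(2) by (intro CollectI bexI[of _ "\<lambda>z. B z + C z"]) auto
    have "\<exists>D\<in>biregular ?X ?Y S line. \<forall>z\<in>S \<times> line. D z = B z * C z"
      by (rule biregular_mult[OF B(1) C(1)]) (rule reg_qspace_mult; assumption)+
    then obtain D where D: "D \<in> biregular ?X ?Y S line" "\<forall>z\<in>S \<times> line. D z = B z * C z"
      by (elim bexE) (rule that)
    show "(\<lambda>z. F z * G z) \<in> ?R"
      using D B(2) C(2) by (intro CollectI bexI[of _ D]) auto
  qed
  then show ?thesis by simp
qed

lemma from_prod_morphism: "fspace_morphism (fprod (qspace S) (qspace line)) (qspace T) \<psi>"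
proof -
  let ?X = "qspace S" and ?Y = "qspace line :: (nat \<Rightarrow> 'k alg_closure, 'k alg_closure) fspace"
  have ts: "topspace (prod_topology_Z ?X ?Y) = S \<times> line" by (rule topspace_prod_Z[OF refl refl])
  have \<psi>T: "\<psi> z \<in> T" if "z \<in> S \<times> line" for z
  proof -
    have "(fst z)(p := 0) = fst z" using that S0[of "fst z"] by auto
    then show ?thesis using that by (auto simp: T)
  qed
  have op: "openin (prod_topology_Z ?X ?Y) (\<psi> -` V \<inter> S \<times> line)" if V: "zopen T V" for V
  proof (subst openin_subopen, intro ballI)
    fix z assume z: "z \<in> \<psi> -` V \<inter> S \<times> line"
    then have "\<psi> z \<in> V" by simp
    then obtain b where b: "b \<in> PF" "b (\<psi> z) \<noteq> 0" "\<And>q. q \<in> T \<Longrightarrow> b q \<noteq> 0 \<Longrightarrow> q \<in> V"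
      by (rule zopenE[OF V]) (rule that)
    obtain B where B: "B \<in> biregular ?X ?Y S line" "\<forall>z\<in>S \<times> line. B z = b (\<psi> z)"
      using polynomial_biregular[OF b(1)] by (elim bexE) (rule that)
    have "openin (prod_topology_Z ?X ?Y) {z \<in> S \<times> line. B z \<noteq> 0}"
      using B(1) by (intro openin_prod_Z_basic) (simp_all add: zopen_self)
    moreover have "z \<in> {z \<in> S \<times> line. B z \<noteq> 0}" using z b(2) B(2) by auto
    moreover have "{z \<in> S \<times> line. B z \<noteq> 0} \<subseteq> \<psi> -` V \<inter> S \<times> line"
      using B(2) b(3)[OF \<psi>T] by auto
    ultimately show "\<exists>W. openin (prod_topology_Z ?X ?Y) W \<and> z \<in> W \<and> W \<subseteq> \<psi> -` V \<inter> S \<times> line" by blast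
  qed
  have "continuous_map (prod_topology_Z ?X ?Y) (ztop (qspace T)) \<psi>"
    unfolding continuous_map_def
  proof (intro conjI allI impI)
    show "\<psi> \<in> topspace (prod_topology_Z ?X ?Y) \<rightarrow> topspace (ztop (qspace T))" using \<psi>T by (auto simp: ts)
    fix V assume "openin (ztop (qspace T)) V"
    then have "openin (prod_topology_Z ?X ?Y) (\<psi> -` V \<inter> S \<times> line)" using op by simp
    also have "\<psi> -` V \<inter> S \<times> line = {z \<in> topspace (prod_topology_Z ?X ?Y). \<psi> z \<in> V}" by (auto simp: ts)
    finally show "openin (prod_topology_Z ?X ?Y) {z \<in> topspace (prod_topology_Z ?X ?Y). \<psi> z \<in> V}" .
  qed
  moreover have "restrict (g \<circ> \<psi>) (\<psi> -` V \<inter> S \<times> line) \<in> reg (fprod ?X ?Y) (\<psi> -` V \<inter> S \<times> line)"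
    if V: "zopen T V" and g: "g \<in> locrat V" for V g
  proof -
    let ?W = "\<psi> -` V \<inter> S \<times> line"
    have "\<exists>U V' a b. openin (ztop ?X) U \<and> openin (ztop ?Y) V' \<and> z \<in> U \<times> V' \<and>
                    a \<in> biregular ?X ?Y U V' \<and> b \<in> biregular ?X ?Y U V' \<and> b z \<noteq> 0 \<and>
                    (\<forall>q\<in>?W \<inter> U \<times> V'. b q \<noteq> 0 \<longrightarrow> restrict (g \<circ> \<psi>) ?W q = a q / b q)" if z: "z \<in> ?W" for z
    proof -
      have "\<psi> z \<in> V" using z by simp
      then obtain a b where ab: "a \<in> PF" "b \<in> PF" "b (\<psi> z) \<noteq> 0" "\<And>q. q \<in> V \<Longrightarrow> b q \<noteq> 0 \<Longrightarrow> g q = a q / b q"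
        by (rule locratD[OF g]) (rule that)
      obtain A where A: "A \<in> biregular ?X ?Y S line" "\<forall>z\<in>S \<times> line. A z = a (\<psi> z)"
        using polynomial_biregular[OF ab(1)] by (elim bexE) (rule that)
      obtain B where B: "B \<in> biregular ?X ?Y S line" "\<forall>z\<in>S \<times> line. B z = b (\<psi> z)"
        using polynomial_biregular[OF ab(2)] by (elim bexE) (rule that)
      have "z \<in> S \<times> line" using z by blast
      then have "B z \<noteq> 0" using bspec[OF B(2)] ab(3) by simp
      moreover have "restrict (g \<circ> \<psi>) ?W q = A q / B q" if q: "q \<in> ?W \<inter> S \<times> line" "B q \<noteq> 0" for q
      proof -
        have "q \<in> S \<times> line" "\<psi> q \<in> V" "q \<in> ?W" using q(1) by auto
        then show ?thesis using bspec[OF A(2), of q] bspec[OF B(2), of q] ab(4)[of "\<psi> q"] q(2) by simp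
      qed
      then have "\<forall>q\<in>?W \<inter> S \<times> line. B q \<noteq> 0 \<longrightarrow> restrict (g \<circ> \<psi>) ?W q = A q / B q" by blast
      moreover have "openin (ztop ?X) S" "openin (ztop ?Y) line" by (simp_all add: zopen_self)
      moreover have "z \<in> S \<times> line" using z by simp
      ultimately show ?thesis using A(1) B(1) by (intro exI conjI)
    qed
    then show ?thesis using op[OF V] by (simp add: fprod_def)
  qed
  ultimately show ?thesis
    by (intro fspace_morphismI) (simp_all only: ztop_fprod ts reg_qspace openin_qspace)
qed

text \<open>Freeing a coordinate on a set where it vanishes amounts to a product with the line. The
  product relation of the Grothendieck ring enters through this isomorphism alone.\<close>

lemma prod_line_iso: "fspace_iso (qspace T) (fprod (qspace S) (qspace line))"
  unfolding fspace_iso_def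
proof (intro exI[of _ \<phi>] exI[of _ \<psi>] conjI ballI)
  show "fspace_morphism (qspace T) (fprod (qspace S) (qspace line)) \<phi>" by (rule to_prod_morphism)
  show "fspace_morphism (fprod (qspace S) (qspace line)) (qspace T) \<psi>" by (rule from_prod_morphism)
  show "\<psi> (\<phi> x) = x" for x by simp
  fix z assume "z \<in> topspace (ztop (fprod (qspace S) (qspace line :: (nat \<Rightarrow> 'k alg_closure, 'k alg_closure) fspace)))"
  then have "fst z \<in> S" "snd z \<in> line" by (auto simp: fprod_def topspace_prod_Z[OF refl refl])
  then show "\<phi> (\<psi> z) = z" using S0[of "fst z"] by (auto simp: prod_eq_iff fun_eq_iff)
qed

end

section \<open>Classes of locally closed sets in the Grothendieck ring\<close>

lemma abs_K0_hom:
  "abs_K0 0 = 0" "abs_K0 1 = 1" "abs_K0 (a + b) = abs_K0 a + abs_K0 b"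
  "abs_K0 (a - b) = abs_K0 a - abs_K0 b" "abs_K0 (a * b) = abs_K0 a * abs_K0 b"
  by (simp_all add: zero_K0_def one_K0_def plus_K0.abs_eq minus_K0.abs_eq times_K0.abs_eq)

lemma abs_K0_relator: "r \<in> K0_relators \<Longrightarrow> abs_K0 r = 0"
  unfolding zero_K0_def K0.abs_eq_iff by (simp add: self_module.span_base)

lemma K0_relator_scissor:
  "closedin (ztop (Rep_variety X)) Z \<Longrightarrow> fspace_iso (Rep_variety Y) (fsub (Rep_variety X) Z) \<Longrightarrow>
   fspace_iso (Rep_variety W) (fsub (Rep_variety X) (topspace (ztop (Rep_variety X)) - Z)) \<Longrightarrow>
   mvar X - mvar Y - mvar W \<in> K0_relators"
  unfolding K0_relators_def by blast

lemma K0_relator_prod: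
  "fspace_iso (Rep_variety W) (fprod (Rep_variety X) (Rep_variety Y)) \<Longrightarrow> mvar X * mvar Y - mvar W \<in> K0_relators"
  unfolding K0_relators_def by blast

lemma K0_class_iso:
  assumes "fspace_iso X Y" shows "K0_class X = K0_class Y"
proof -
  have "fspace_iso (Rep_variety V) X \<longleftrightarrow> fspace_iso (Rep_variety V) Y" for V
    using fspace_iso_trans[OF _ assms, of "Rep_variety V"]
      fspace_iso_trans[OF _ fspace_iso_sym[OF assms], of "Rep_variety V"] by (rule iffI)
  then show ?thesis by (simp add: K0_class_def)
qed

text \<open>The isomorphism relation makes the class independent of the variety that
  \<open>SOME\<close> picks.\<close>

lemma K0_class_Rep:
  assumes "fspace_iso (Rep_variety V) X" shows "K0_class X = abs_K0 (mvar V)"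
proof -
  let ?Y = "SOME Y. fspace_iso (Rep_variety Y) X"
  have "fspace_iso (Rep_variety ?Y) X" using assms by (rule someI)
  then have "fspace_iso (Rep_variety ?Y) (Rep_variety V)"
    by (rule fspace_iso_trans[OF _ fspace_iso_sym[OF assms]])
  then have "mvar ?Y - mvar V \<in> K0_relators" unfolding K0_relators_def by blast
  then have "abs_K0 (mvar ?Y) - abs_K0 (mvar V) = 0"
    using abs_K0_relator[of "mvar ?Y - mvar V"] by (simp only: abs_K0_hom)
  then show ?thesis by (simp add: K0_class_def)
qed

abbreviation cls :: "('i \<Rightarrow> 'k::field_char_0 alg_closure) set \<Rightarrow> 'k K0" where
  "cls S \<equiv> K0_class (qspace S)"

text \<open>Meaningful for a locally closed subset of some \<open>aff_points {..<n}\<close>, where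
  \<open>is_variety_qspace\<close> applies.\<close>

definition nat_model :: "(nat \<Rightarrow> 'k::field_char_0 alg_closure) set \<Rightarrow> 'k variety" where
  "nat_model S = Abs_variety (qspace S)"

lemma Rep_nat_model: "loc_closed S \<Longrightarrow> S \<subseteq> aff_points {..<n} \<Longrightarrow> Rep_variety (nat_model S) = qspace S"
  unfolding nat_model_def by (intro Abs_variety_inverse CollectI is_variety_qspace)

lemma cls_nat_model: "loc_closed S \<Longrightarrow> S \<subseteq> aff_points {..<n} \<Longrightarrow> cls S = abs_K0 (mvar (nat_model S))"
  by (intro K0_class_Rep) (simp add: Rep_nat_model qspace_iso_refl)

lemma cls_scissor_nat:
  fixes S :: "(nat \<Rightarrow> 'k::field_char_0 alg_closure) set"
  assumes S: "loc_closed S" "S \<subseteq> aff_points {..<n}" and V: "zopen UNIV V"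
  shows "cls S = cls (S \<inter> V) + cls (S - V)"
proof -
  have 1: "loc_closed (S \<inter> V)" "S \<inter> V \<subseteq> aff_points {..<n}" "loc_closed (S - V)" "S - V \<subseteq> aff_points {..<n}"
    using S loc_closed_Int[OF S(1) loc_closed_zopen[OF V]] loc_closed_Diff[OF S(1) V] by auto
  have "S - (S - V) = V \<inter> S" by blast
  then have "closedin (ztop (qspace S)) (S - V)"
    using zopen_restrict[OF V subset_UNIV, of S] by (simp add: closedin_def)
  moreover have "S - (S - V) = S \<inter> V" by blast
  ultimately have "mvar (nat_model S) - mvar (nat_model (S - V)) - mvar (nat_model (S \<inter> V)) \<in> K0_relators"
    by (intro K0_relator_scissor[of _ "S - V"])
       (simp_all add: Rep_nat_model[OF S] Rep_nat_model[OF 1(1,2)] Rep_nat_model[OF 1(3,4)] fsub_qspace qspace_iso_refl)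
  then have "abs_K0 (mvar (nat_model S)) - abs_K0 (mvar (nat_model (S - V))) - abs_K0 (mvar (nat_model (S \<inter> V))) = 0"
    using abs_K0_relator[of "mvar (nat_model S) - mvar (nat_model (S - V)) - mvar (nat_model (S \<inter> V))"] by (simp only: abs_K0_hom)
  then show ?thesis using cls_nat_model[OF S] cls_nat_model[OF 1(1,2)] cls_nat_model[OF 1(3,4)]
    by (simp add: algebra_simps)
qed

text \<open>For a bijection \<open>e\<close> this renames coordinates. For \<open>e = id\<close> it
  is the projection to the coordinates in I, the form in which jets are truncated.\<close>

definition reindex :: "('i \<Rightarrow> 'j) \<Rightarrow> 'i set \<Rightarrow> ('j \<Rightarrow> 'k::field_char_0 alg_closure) \<Rightarrow> 'i \<Rightarrow> 'k alg_closure" where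
  "reindex e I y = (\<lambda>i. if i \<in> I then y (e i) else 0)"

lemma reindex_PF: "(\<lambda>y. reindex e I y i) \<in> PF"
  by (cases "i \<in> I") (auto simp: reindex_def intro: PF_0 PF_var)

lemma reindex_aff: "reindex e I y \<in> aff_points I"
  by (auto simp: reindex_def aff_points_def)

lemma reindex_iso:
  assumes e: "bij_betw e I J" and S: "S \<subseteq> aff_points I"
  shows "fspace_iso (qspace S) (qspace {y \<in> aff_points J. reindex e I y \<in> S})"
proof (rule qspace_iso[of "reindex (inv_into I e) J" _ _ "reindex e I"])
  have inv: "reindex e I (reindex (inv_into I e) J x) = x" if "x \<in> S" for x
  proof
    fix i
    show "reindex e I (reindex (inv_into I e) J x) i = x i"
      using e that S by (auto simp: reindex_def aff_points_def bij_betw_def)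
  qed
  show "reindex (inv_into I e) J x \<in> {y \<in> aff_points J. reindex e I y \<in> S}" if "x \<in> S" for x
    using inv[OF that] that by (simp add: reindex_aff)
  show "reindex e I (reindex (inv_into I e) J x) = x" if "x \<in> S" for x using inv[OF that] .
  show "reindex (inv_into I e) J (reindex e I y) = y" if "y \<in> {y \<in> aff_points J. reindex e I y \<in> S}" for y
  proof
    fix j
    have "inv_into I e j \<in> I" "e (inv_into I e j) = j" if "j \<in> J"
      using e that by (auto simp: bij_betw_def f_inv_into_f inv_into_into)
    then show "reindex (inv_into I e) J (reindex e I y) j = y j"
      using that by (auto simp: reindex_def aff_points_def)
  qed
qed (auto intro: locrat_PF reindex_PF)

lemma cls_reindex:
  "bij_betw e I J \<Longrightarrow> S \<subseteq> aff_points I \<Longrightarrow> cls S = cls {y \<in> aff_points J. reindex e I y \<in> S}"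
  by (intro K0_class_iso reindex_iso)

lemma loc_closed_reindex: "loc_closed S \<Longrightarrow> loc_closed {y \<in> aff_points J. reindex e I y \<in> S}"
  using loc_closed_Int[OF loc_closed_aff_points[of J] loc_closed_vimage[where u = "reindex e I", OF _ reindex_PF], of S]
  by (simp add: vimage_def Int_def)

definition quasi_affine :: "('i \<Rightarrow> 'k::field_char_0 alg_closure) set \<Rightarrow> bool" where
  "quasi_affine S \<longleftrightarrow> loc_closed S \<and> (\<exists>I. finite I \<and> S \<subseteq> aff_points I)"

lemma quasi_affineI: "loc_closed S \<Longrightarrow> finite I \<Longrightarrow> S \<subseteq> aff_points I \<Longrightarrow> quasi_affine S"
  by (auto simp: quasi_affine_def)

lemma quasi_affine_finite: "loc_closed S \<Longrightarrow> quasi_affine (S :: ('i::finite \<Rightarrow> 'k::field_char_0 alg_closure) set)"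
  by (rule quasi_affineI[of S UNIV]) (auto simp: aff_points_def)

lemma quasi_affine_Int: "quasi_affine S \<Longrightarrow> loc_closed T \<Longrightarrow> quasi_affine (S \<inter> T)"
  unfolding quasi_affine_def using loc_closed_Int by blast

lemma quasi_affine_Diff: "quasi_affine S \<Longrightarrow> zopen UNIV V \<Longrightarrow> quasi_affine (S - V)"
  unfolding quasi_affine_def using loc_closed_Diff by blast

text \<open>The relations of the Grothendieck ring concern points indexed by \<open>nat\<close>; a
  numbering of the finitely many coordinates transports them.\<close>

lemma cls_scissor:
  assumes S: "quasi_affine S" and V: "zopen UNIV V"
  shows "cls S = cls (S \<inter> V) + cls (S - V)"
proof -
  obtain I where I: "finite I" "S \<subseteq> aff_points I" "loc_closed S" using S by (auto simp: quasi_affine_def)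
  obtain e where e: "bij_betw e I {..<card I}"
    using ex_bij_betw_finite_nat[OF I(1)] by (auto simp: atLeast0LessThan)
  let ?R = "\<lambda>T. {y \<in> aff_points {..<card I}. reindex e I y \<in> T}"
  have "cls S = cls (?R S)" by (rule cls_reindex[OF e I(2)])
  also have "\<dots> = cls (?R S \<inter> reindex e I -` V) + cls (?R S - reindex e I -` V)"
    by (rule cls_scissor_nat[OF loc_closed_reindex[OF I(3)] _ zopen_vimage[OF V reindex_PF]]) auto
  also have "?R S \<inter> reindex e I -` V = ?R (S \<inter> V)" by auto
  also have "?R S - reindex e I -` V = ?R (S - V)" by auto
  also have "cls (?R (S \<inter> V)) = cls (S \<inter> V)" by (rule cls_reindex[OF e, symmetric]) (use I in auto)
  also have "cls (?R (S - V)) = cls (S - V)" by (rule cls_reindex[OF e, symmetric]) (use I in auto)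
  finally show ?thesis .
qed

text \<open>The scissor relation for the empty set reads c = c + c.\<close>

lemma cls_empty: "cls ({} :: ('i \<Rightarrow> 'k::field_char_0 alg_closure) set) = 0"
proof -
  have "quasi_affine ({} :: ('i \<Rightarrow> 'k alg_closure) set)" by (rule quasi_affineI[OF loc_closed_empty, of "{}"]) auto
  from cls_scissor[OF this zopen_empty] show ?thesis by simp
qed

lemma cls_line: "cls line = (K0_L :: 'k::field_char_0 K0)"
proof -
  have "cls line = cls {y \<in> aff_points (UNIV :: unit set). reindex (\<lambda>_. ()) {0} y \<in> (line :: (nat \<Rightarrow> 'k alg_closure) set)}"
    by (rule cls_reindex) (auto simp: bij_betw_def line_def)
  also have "{y \<in> aff_points (UNIV :: unit set). reindex (\<lambda>_. ()) {0} y \<in> (line :: (nat \<Rightarrow> 'k alg_closure) set)} = aff_points UNIV"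
    by (auto simp: reindex_aff line_def)
  finally show ?thesis by (simp add: K0_L_def aff_space_eq_qspace)
qed

lemma cls_point: "cls {\<lambda>_. 0} = (1 :: 'k::field_char_0 K0)"
proof -
  let ?P = "aff_points {} :: (nat \<Rightarrow> 'k alg_closure) set"
  have P: "loc_closed ?P" "?P \<subseteq> aff_points {..<0}" by (simp_all add: loc_closed_aff_points)
  have "cls {\<lambda>_ :: 'a. 0 :: 'k alg_closure} = cls {y \<in> aff_points {}. reindex (\<lambda>_. 0::nat) {} y \<in> {\<lambda>_ :: 'a. 0 :: 'k alg_closure}}"
    by (rule cls_reindex) (auto simp: aff_points_def bij_betw_def)
  also have "{y \<in> aff_points {}. reindex (\<lambda>_. 0::nat) {} y \<in> {\<lambda>_ :: 'a. 0 :: 'k alg_closure}} = ?P"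
    by (auto simp: reindex_def)
  also have "cls ?P = abs_K0 (mvar (nat_model ?P))" by (rule cls_nat_model[OF P])
  also have "mvar (nat_model ?P) - 1 \<in> K0_relators"
    unfolding K0_relators_def
    by (rule UnI2) (auto simp: Rep_nat_model[OF P] aff_space_eq_qspace qspace_iso_refl)
  then have "abs_K0 (mvar (nat_model ?P)) = 1"
    using abs_K0_relator[of "mvar (nat_model ?P) - 1"] by (simp add: abs_K0_hom)
  finally show ?thesis .
qed

lemma cls_prod_line_nat:
  fixes S T :: "(nat \<Rightarrow> 'k::field_char_0 alg_closure) set"
  assumes S: "loc_closed S" "S \<subseteq> aff_points {..<n}" and T: "loc_closed T" "T \<subseteq> aff_points {..<n}"
    and S0: "\<And>x. x \<in> S \<Longrightarrow> x p = 0" and TS: "T = {x. x(p := 0) \<in> S}"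
  shows "cls T = cls S * K0_L"
proof -
  have L: "loc_closed (line :: (nat \<Rightarrow> 'k alg_closure) set)" "(line :: (nat \<Rightarrow> 'k alg_closure) set) \<subseteq> aff_points {..<1}"
    unfolding line_def by (rule loc_closed_aff_points) (auto simp: aff_points_def)
  have "fspace_iso (qspace T) (fprod (qspace S) (qspace line))" by (rule prod_line_iso[of S p T]) (use S0 TS in auto)
  then have "mvar (nat_model S) * mvar (nat_model line) - mvar (nat_model T) \<in> K0_relators"
    by (intro K0_relator_prod) (simp_all add: Rep_nat_model[OF S] Rep_nat_model[OF T] Rep_nat_model[OF L])
  then have "abs_K0 (mvar (nat_model S)) * abs_K0 (mvar (nat_model line)) - abs_K0 (mvar (nat_model T)) = 0"
    using abs_K0_relator[of "mvar (nat_model S) * mvar (nat_model line) - mvar (nat_model T)"] by (simp only: abs_K0_hom)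
  then show ?thesis using cls_nat_model[OF S] cls_nat_model[OF T] cls_nat_model[OF L]
    by (simp add: cls_line)
qed

lemma cls_prod_line:
  assumes S: "loc_closed S" "S \<subseteq> aff_points I" "finite I" "p \<in> I"
    and S0: "\<And>x. x \<in> S \<Longrightarrow> x p = 0" and TS: "T = {x. x(p := 0) \<in> S}"
  shows "cls T = cls S * K0_L"
proof -
  obtain e where e: "bij_betw e I {..<card I}"
    using ex_bij_betw_finite_nat[OF S(3)] by (auto simp: atLeast0LessThan)
  let ?J = "{..<card I}"
  let ?R = "\<lambda>T. {y \<in> aff_points ?J. reindex e I y \<in> T}"
  have upd: "(\<lambda>x. (x(p := 0)) i) \<in> PF" for i by (cases "i = p") (auto intro: PF_0 PF_var)
  have T: "loc_closed T" using loc_closed_vimage[where u = "\<lambda>x. x(p := 0)", OF S(1) upd] by (simp add: TS vimage_def)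
  have TI: "T \<subseteq> aff_points I"
  proof
    fix x assume "x \<in> T"
    then have "x(p := 0) \<in> aff_points I" using S(2) TS by blast
    then show "x \<in> aff_points I" using S(4) by (auto simp: aff_points_def split: if_splits)
  qed
  have eJ: "e p \<in> ?J" using e S(4) by (auto simp: bij_betw_def)
  have re: "reindex e I (y(e p := c)) = (reindex e I y)(p := c)" for y c
    using e S(4) by (auto simp: reindex_def fun_eq_iff bij_betw_def inj_on_def)
  have "cls (?R T) = cls (?R S) * K0_L"
  proof (rule cls_prod_line_nat)
    show "y (e p) = 0" if "y \<in> ?R S" for y
      using that S0[of "reindex e I y"] S(4) by (simp add: reindex_def)
    have "y \<in> aff_points ?J" if "y(e p := 0) \<in> aff_points ?J" for y :: "nat \<Rightarrow> 'b alg_closure"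
      using that eJ by (auto simp: aff_points_def split: if_splits)
    moreover have "y(e p := 0) \<in> aff_points ?J" if "y \<in> aff_points ?J" for y :: "nat \<Rightarrow> 'b alg_closure"
      using that by (auto simp: aff_points_def)
    ultimately show "?R T = {y. y(e p := 0) \<in> ?R S}" unfolding TS re mem_Collect_eq by blast
  qed (auto intro!: loc_closed_reindex S(1) T)
  then show ?thesis using cls_reindex[OF e TI] cls_reindex[OF e S(2)] by simp
qed

text \<open>Invariance under changes of \<open>x p\<close> makes S the product of its slice
  \<open>x p = 0\<close> with the line.\<close>

lemma cls_cylinder:
  assumes S: "loc_closed S" "S \<subseteq> aff_points I" "finite I" "p \<in> I"
    and inv: "\<And>x s. x \<in> S \<Longrightarrow> x(p := s) \<in> S"
  shows "cls S = cls {x \<in> S. x p = 0} * K0_L"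
proof (rule cls_prod_line[OF _ _ S(3,4)])
  show "loc_closed {x \<in> S. x p = 0}"
    using loc_closed_Int[OF S(1) loc_closed_eq0[OF PF_var[of p]]] by (simp add: Int_def)
  show "S = {x. x(p := 0) \<in> {x \<in> S. x p = 0}}"
  proof (intro equalityI subsetI)
    fix x assume "x \<in> {x. x(p := 0) \<in> {x \<in> S. x p = 0}}"
    then have "(x(p := 0))(p := x p) \<in> S" using inv[of "x(p := 0)" "x p"] by simp
    then show "x \<in> S" by simp
  next
    fix x assume "x \<in> S"
    from inv[OF this, of 0] show "x \<in> {x. x(p := 0) \<in> {x \<in> S. x p = 0}}" by simp
  qed
qed (use S(2) in auto)

text \<open>Over each point of the slice \<open>x p = 0\<close> the equation c = 0 has exactly one
  solution in the coordinate p, namely -c/g. So its zero set is a graph over the slice, while S is a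
  cylinder over it.\<close>

lemma cls_eliminate:
  assumes S: "loc_closed S" "S \<subseteq> aff_points I" "finite I" "p \<in> I"
    and inv: "\<And>x s. x \<in> S \<Longrightarrow> x(p := s) \<in> S"
    and g: "g \<in> PF" "\<And>x. x \<in> S \<Longrightarrow> g x \<noteq> 0" and c: "c \<in> PF"
    and lin: "\<And>x s. x \<in> S \<Longrightarrow> c (x(p := s)) = c (x(p := 0)) + s * g (x(p := 0))"
  shows "cls S = cls {x \<in> S. c x = 0} * K0_L"
proof -
  have upd: "(\<lambda>x. (x(p := 0)) i) \<in> PF" for i by (cases "i = p") (auto intro: PF_0 PF_var)
  have "fspace_iso (qspace {x \<in> S. c x = 0}) (qspace {x \<in> S. x p = 0})"
  proof (rule qspace_iso[of "\<lambda>x. x(p := 0)" _ _ "\<lambda>y. y(p := - c y / g y)"])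
    show "(\<lambda>x. (x(p := 0)) i) \<in> locrat {x \<in> S. c x = 0}" for i by (rule locrat_PF[OF upd])
    show "(\<lambda>y. (y(p := - c y / g y)) i) \<in> locrat {x \<in> S. x p = 0}" for i
    proof (cases "i = p")
      case True
      have "(\<lambda>y. - c y / g y) \<in> locrat {x \<in> S. x p = 0}"
        by (rule locrat_divide[OF locrat_PF[OF PF_uminus[OF c]] locrat_PF[OF g(1)]]) (use g(2) in auto)
      then show ?thesis using True by simp
    qed (simp add: locrat_PF[OF PF_var])
    show "x(p := 0) \<in> {x \<in> S. x p = 0}" if "x \<in> {x \<in> S. c x = 0}" for x
      using inv[of x 0] that by simp
    show "y(p := - c y / g y) \<in> {x \<in> S. c x = 0}" if y: "y \<in> {x \<in> S. x p = 0}" for y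
    proof -
      have "y(p := 0) = y" using y by auto
      then show ?thesis using lin[of y "- c y / g y"] y inv[of y "- c y / g y"] g(2)[of y] by simp
    qed
    show "(x(p := 0))(p := - c (x(p := 0)) / g (x(p := 0))) = x" if x: "x \<in> {x \<in> S. c x = 0}" for x
    proof -
      have "c x = c (x(p := 0)) + x p * g (x(p := 0))" using lin[of x "x p"] x by simp
      moreover have "g (x(p := 0)) \<noteq> 0" using g(2)[OF inv[of x 0]] x by simp
      moreover have "c x = 0" using x by simp
      ultimately have "- c (x(p := 0)) / g (x(p := 0)) = x p"
        by (metis add.commute add_eq_0_iff nonzero_mult_div_cancel_right)
      then show ?thesis by simp
    qed
    show "(y(p := - c y / g y))(p := 0) = y" if "y \<in> {x \<in> S. x p = 0}" for y using that by auto
  qed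
  then have "cls {x \<in> S. c x = 0} = cls {x \<in> S. x p = 0}" by (rule K0_class_iso)
  then show ?thesis using cls_cylinder[OF S inv] by simp
qed


section \<open>Finite additivity\<close>

text \<open>The pieces are unions of the atoms of the Boolean algebra generated by the finitely many
  open sets \<open>\<V>\<close>; these atoms are cut out of \<open>S\<close> one open set at a time.\<close>

lemma cls_additive_saturated:
  assumes "finite \<V>" "finite A" "\<And>V. V \<in> \<V> \<Longrightarrow> zopen UNIV V" "quasi_affine S"
    and "disjoint_family_on P A" "(\<Union>a\<in>A. P a) = S"
    and "\<And>x y a. x \<in> S \<Longrightarrow> y \<in> S \<Longrightarrow> (\<And>V. V \<in> \<V> \<Longrightarrow> x \<in> V \<longleftrightarrow> y \<in> V) \<Longrightarrow> a \<in> A \<Longrightarrow> x \<in> P a \<Longrightarrow> y \<in> P a"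
    and "\<And>a. a \<in> A \<Longrightarrow> quasi_affine (P a)"
  shows "cls S = (\<Sum>a\<in>A. cls (P a))"
  using assms(1,3-)
proof (induction \<V> arbitrary: S P rule: finite_induct)
  case empty
  show ?case
  proof (cases "S = {}")
    case True
    then have "P a = {}" if "a \<in> A" for a using empty that by auto
    then show ?thesis using True by (simp add: cls_empty)
  next
    case False
    then obtain x where "x \<in> S" by blast
    then obtain a where a: "a \<in> A" "x \<in> P a" using empty by blast
    \<comment> \<open>With no open set left to separate points, a piece that contains one point of S
      contains all of them.\<close>
    have "P a = S" using empty(5)[OF \<open>x \<in> S\<close> _ _ a] empty(4) a(1) by auto
    moreover have "P b = {}" if "b \<in> A - {a}" for b
    proof -
      have "P b \<inter> P a = {}" using empty(3) a(1) that by (auto simp: disjoint_family_on_def)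
      moreover have "P b \<subseteq> S" using empty(4) that by auto
      ultimately show ?thesis using \<open>P a = S\<close> by auto
    qed
    moreover have "(\<Sum>b\<in>A. cls (P b)) = cls (P a) + (\<Sum>b\<in>A - {a}. cls (P b))"
      by (rule sum.remove[OF assms(2) a(1)])
    ultimately show ?thesis by (simp add: cls_empty)
  qed
next
  case (insert V \<V>)
  have V: "zopen UNIV V" using insert.prems(1) by simp
  note alg = insert.prems(6)
  have "cls (S \<inter> V) = (\<Sum>a\<in>A. cls (P a \<inter> V))"
  proof (rule insert.IH)
    show "quasi_affine (S \<inter> V)" using insert.prems(2) loc_closed_zopen[OF V] by (rule quasi_affine_Int)
    show "disjoint_family_on (\<lambda>a. P a \<inter> V) A" using insert.prems(3) by (auto simp: disjoint_family_on_def)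
    show "(\<Union>a\<in>A. P a \<inter> V) = S \<inter> V" using insert.prems(4) by auto
    show "y \<in> P a \<inter> V" if "x \<in> S \<inter> V" "y \<in> S \<inter> V" "\<And>W. W \<in> \<V> \<Longrightarrow> (x \<in> W) = (y \<in> W)" "a \<in> A" "x \<in> P a \<inter> V" for x y a
      using insert.prems(5)[of x y a] that by auto
  qed (use insert.prems(1) quasi_affine_Int[OF alg loc_closed_zopen[OF V]] in auto)
  moreover have "cls (S - V) = (\<Sum>a\<in>A. cls (P a - V))"
  proof (rule insert.IH)
    show "quasi_affine (S - V)" by (rule quasi_affine_Diff[OF insert.prems(2) V])
    show "disjoint_family_on (\<lambda>a. P a - V) A" using insert.prems(3) by (auto simp: disjoint_family_on_def)
    show "(\<Union>a\<in>A. P a - V) = S - V" using insert.prems(4) by auto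
    show "y \<in> P a - V" if "x \<in> S - V" "y \<in> S - V" "\<And>W. W \<in> \<V> \<Longrightarrow> (x \<in> W) = (y \<in> W)" "a \<in> A" "x \<in> P a - V" for x y a
      using insert.prems(5)[of x y a] that by auto
  qed (use insert.prems(1) quasi_affine_Diff[OF alg V] in auto)
  ultimately have "cls S = (\<Sum>a\<in>A. cls (P a \<inter> V) + cls (P a - V))"
    using cls_scissor[OF insert.prems(2) V] by (simp add: sum.distrib)
  also have "\<dots> = (\<Sum>a\<in>A. cls (P a))"
    by (rule sum.cong) (use cls_scissor[OF alg V] in auto)
  finally show ?case .
qed

text \<open>Each piece is a difference of two open sets, and membership in these finitely many open
  sets decides membership in the pieces.\<close>

lemma cls_additive:
  assumes A: "finite A" "disjoint_family_on P A" "\<And>a. a \<in> A \<Longrightarrow> quasi_affine (P a)" and S: "quasi_affine (\<Union>a\<in>A. P a)"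
  shows "cls (\<Union>a\<in>A. P a) = (\<Sum>a\<in>A. cls (P a))"
proof -
  have "\<forall>a\<in>A. \<exists>W. zopen UNIV (fst W) \<and> zopen UNIV (snd W) \<and> P a = fst W - snd W"
    using A(3) unfolding quasi_affine_def loc_closed_def by (metis fst_conv snd_conv)
  from bchoice[OF this] obtain W where
    W: "\<And>a. a \<in> A \<Longrightarrow> zopen UNIV (fst (W a)) \<and> zopen UNIV (snd (W a)) \<and> P a = fst (W a) - snd (W a)" by auto
  let ?\<V> = "(\<lambda>a. fst (W a)) ` A \<union> (\<lambda>a. snd (W a)) ` A"
  show ?thesis
  proof (rule cls_additive_saturated[of ?\<V>])
    show "y \<in> P a" if "\<And>V. V \<in> ?\<V> \<Longrightarrow> x \<in> V \<longleftrightarrow> y \<in> V" "a \<in> A" "x \<in> P a" for x y a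
      using that(1)[of "fst (W a)"] that(1)[of "snd (W a)"] that(2,3) W[OF that(2)] by auto
  qed (use assms W in auto)
qed

text \<open>Common refinement by the sets P a \<inter> Q b. The union may be merely constructible
  and then has no class of its own; additivity is therefore applied to the single pieces.\<close>

lemma sum_cls_unique:
  assumes A: "finite A" "disjoint_family_on P A" "\<And>a. a \<in> A \<Longrightarrow> quasi_affine (P a)"
    and B: "finite B" "disjoint_family_on Q B" "\<And>b. b \<in> B \<Longrightarrow> quasi_affine (Q b)"
    and eq: "(\<Union>a\<in>A. P a) = (\<Union>b\<in>B. Q b)"
  shows "(\<Sum>a\<in>A. cls (P a)) = (\<Sum>b\<in>B. cls (Q b))"
proof -
  have PQ: "quasi_affine (P a \<inter> Q b)" if "a \<in> A" "b \<in> B" for a b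
    using quasi_affine_Int[OF A(3)[OF that(1)]] B(3)[OF that(2)] by (auto simp: quasi_affine_def)
  have 1: "cls (P a) = (\<Sum>b\<in>B. cls (P a \<inter> Q b))" if "a \<in> A" for a
  proof -
    have "(\<Union>b\<in>B. P a \<inter> Q b) = P a" using eq that by blast
    then show ?thesis
      using cls_additive[of B "\<lambda>b. P a \<inter> Q b"] B(1,2) PQ[OF that] A(3)[OF that]
      by (auto simp: disjoint_family_on_def)
  qed
  have 2: "cls (Q b) = (\<Sum>a\<in>A. cls (P a \<inter> Q b))" if "b \<in> B" for b
  proof -
    have "(\<Union>a\<in>A. P a \<inter> Q b) = Q b" using eq that by blast
    then show ?thesis
      using cls_additive[of A "\<lambda>a. P a \<inter> Q b"] A(1,2) PQ[OF _ that] B(3)[OF that]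
      by (auto simp: disjoint_family_on_def)
  qed
  have "(\<Sum>a\<in>A. cls (P a)) = (\<Sum>a\<in>A. \<Sum>b\<in>B. cls (P a \<inter> Q b))" using 1 by (rule sum.cong[OF refl])
  also have "\<dots> = (\<Sum>b\<in>B. \<Sum>a\<in>A. cls (P a \<inter> Q b))" by (rule sum.swap)
  also have "\<dots> = (\<Sum>b\<in>B. cls (Q b))" using 2 by (intro sum.cong[OF refl]) simp
  finally show ?thesis .
qed

lemma constructible_class_eq:
  fixes P :: "'a \<Rightarrow> ('i \<Rightarrow> 'k::field_char_0 alg_closure) set"
  assumes I: "finite I" and A: "finite A" "disjoint_family_on P A"
    and P: "\<And>a. a \<in> A \<Longrightarrow> loc_closed (P a)" "\<And>a. a \<in> A \<Longrightarrow> P a \<subseteq> aff_points I"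
    and C: "C = (\<Union>a\<in>A. P a)"
  shows "constructible_class I C = (\<Sum>a\<in>A. cls (P a))"
  unfolding constructible_class_def
proof (rule the_equality)
  have fs: "K0_class (fsub (aff_space I) S) = cls S" if "locally_closedin (zariski I) S"
    for S :: "('i \<Rightarrow> 'k alg_closure) set"
    using that by (simp add: locally_closedin_zariski fsub_aff_space)
  have uniq: "(\<Sum>a\<in>A. cls (P a)) = (\<Sum>S\<in>\<P>. K0_class (fsub (aff_space I) S))"
    if "finite \<P>" "disjoint \<P>" "\<Union>\<P> = C" "\<forall>S\<in>\<P>. locally_closedin (zariski I) S" for \<P>
  proof -
    have "(\<Sum>a\<in>A. cls (P a)) = (\<Sum>S\<in>\<P>. cls S)"
    proof (rule sum_cls_unique[OF A])
      show "quasi_affine (P a)" if "a \<in> A" for a by (rule quasi_affineI[OF P(1)[OF that] I P(2)[OF that]])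
      show "quasi_affine S" if "S \<in> \<P>" for S
        using \<open>\<forall>S\<in>\<P>. locally_closedin (zariski I) S\<close> that quasi_affineI[OF _ I, of S]
        by (simp add: locally_closedin_zariski)
      show "disjoint_family_on (\<lambda>S. S) \<P>" using \<open>disjoint \<P>\<close> by (auto simp: disjoint_family_on_def disjoint_def)
      show "\<Union> (P ` A) = (\<Union>S\<in>\<P>. S)" using \<open>\<Union>\<P> = C\<close> C by simp
    qed (rule \<open>finite \<P>\<close>)
    also have "\<dots> = (\<Sum>S\<in>\<P>. K0_class (fsub (aff_space I) S))"
      by (rule sum.cong) (use that(4) fs in auto)
    finally show ?thesis .
  qed
  let ?\<P> = "P ` A"
  have "disjoint ?\<P>" using A(2) by (rule disjoint_family_on_disjoint_image)
  moreover have "\<forall>S\<in>?\<P>. locally_closedin (zariski I) S" using P by (auto simp: locally_closedin_zariski)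
  ultimately show "\<exists>\<P>. finite \<P> \<and> disjoint \<P> \<and> \<Union>\<P> = C \<and>
               (\<forall>S\<in>\<P>. locally_closedin (zariski I) S) \<and>
               (\<Sum>a\<in>A. cls (P a)) = (\<Sum>S\<in>\<P>. K0_class (fsub (aff_space I) S))"
    using A(1) C by (intro exI[of _ ?\<P>] conjI uniq) auto
  fix c assume "\<exists>\<P>. finite \<P> \<and> disjoint \<P> \<and> \<Union>\<P> = C \<and>
               (\<forall>S\<in>\<P>. locally_closedin (zariski I) S) \<and>
               c = (\<Sum>S\<in>\<P>. K0_class (fsub (aff_space I) S))"
  then show "c = (\<Sum>a\<in>A. cls (P a))" using uniq by (elim exE conjE) simp
qed


section \<open>The motivic measure of a cylinder\<close>

definition cyl :: "'i set \<Rightarrow> 'i set \<Rightarrow> ('i \<Rightarrow> 'k::field_char_0 alg_closure) set \<Rightarrow> ('i \<Rightarrow> 'k alg_closure) set" where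
  "cyl I J T = {x \<in> aff_points J. reindex id I x \<in> T}"

lemma loc_closed_cyl: "loc_closed T \<Longrightarrow> loc_closed (cyl I J T)"
  unfolding cyl_def by (rule loc_closed_reindex)

lemma cls_cyl:
  assumes T: "loc_closed T" "T \<subseteq> aff_points I" and I: "finite I" and K: "finite K" "I \<inter> K = {}"
  shows "cls (cyl I (I \<union> K) T) = cls T * K0_L ^ card K"
  using K
proof (induction K)
  case empty
  have "reindex id I x = x" if "x \<in> aff_points I" for x :: "'a \<Rightarrow> 'b alg_closure"
    using that by (auto simp: reindex_def aff_points_def)
  then have "cyl I (I \<union> {}) T = T" using T(2) by (auto simp: cyl_def)
  then show ?case by simp
next
  case (insert p K)
  have re: "reindex id I (x(p := s)) = reindex id I x" for x :: "'a \<Rightarrow> 'b alg_closure" and s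
    using insert.prems by (auto simp: reindex_def)
  have "cls (cyl I (I \<union> insert p K) T) = cls {x \<in> cyl I (I \<union> insert p K) T. x p = 0} * K0_L"
  proof (rule cls_cylinder[where I = "I \<union> insert p K"])
    show "loc_closed (cyl I (I \<union> insert p K) T)" by (rule loc_closed_cyl[OF T(1)])
    show "cyl I (I \<union> insert p K) T \<subseteq> aff_points (I \<union> insert p K)" by (auto simp: cyl_def)
    show "x(p := s) \<in> cyl I (I \<union> insert p K) T" if "x \<in> cyl I (I \<union> insert p K) T" for x s
      using that by (simp add: cyl_def re) (simp add: aff_points_def)
  qed (use I insert.hyps in auto)
  also have "{x \<in> cyl I (I \<union> insert p K) T. x p = 0} = cyl I (I \<union> K) T"
    using insert by (auto simp: cyl_def aff_points_def)
  finally show ?case using insert by (simp add: mult_ac)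
qed

text \<open>Raising the level of a cylinder multiplies its class by a power of L that the
  normalisation takes away again.\<close>

lemma Mk_Linv_cancel: "Mk_of_K0 (x * K0_L ^ m) * Mk_Linv ^ (a + m) = Mk_of_K0 x * Mk_Linv ^ a"
proof -
  have p: "Mk_of_K0 (K0_L ^ m) = (Mk_of_K0 K0_L ^ m :: 'a Mk)"
    by (induction m) (simp_all add: Mk_of_K0_hom)
  have "Mk_of_K0 (x * K0_L ^ m) * Mk_Linv ^ (a + m) = (Mk_of_K0 x * Mk_Linv ^ a) * (Mk_of_K0 K0_L * Mk_Linv) ^ m"
    by (simp only: Mk_of_K0_hom p power_add power_mult_distrib mult_ac)
  then show ?thesis by (simp add: Mk_L_Linv)
qed

abbreviation jet_coords :: "nat \<Rightarrow> ('n \<times> nat) set" where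
  "jet_coords n \<equiv> UNIV \<times> {..n}"

definition jet_arc :: "('n \<times> nat \<Rightarrow> 'k::field_char_0 alg_closure) \<Rightarrow> ('n, 'k) arc" where
  "jet_arc x = (\<lambda>j. Abs_fps (\<lambda>i. x (j, i)))"

lemma arc_trunc_jet_arc: "x \<in> aff_points (jet_coords n) \<Longrightarrow> arc_trunc n (jet_arc x) = x"
  by (auto simp: arc_trunc_def jet_arc_def aff_points_def fun_eq_iff)

lemma arc_trunc_aff: "arc_trunc n \<gamma> \<in> aff_points (jet_coords n)"
  by (auto simp: arc_trunc_def aff_points_def)

lemma reindex_arc_trunc: "n \<le> m \<Longrightarrow> reindex id (jet_coords n) (arc_trunc m \<gamma>) = arc_trunc n \<gamma>"
  by (auto simp: arc_trunc_def reindex_def fun_eq_iff)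

text \<open>Every jet of level m is the truncation of an arc, so a set of arcs determines its set of
  jets at each level that describes it.\<close>

lemma cyl_of_arcs:
  assumes "n \<le> m" "C' \<subseteq> aff_points (jet_coords m)"
    and eq: "{\<gamma>. arc_trunc n \<gamma> \<in> C} = {\<gamma>. arc_trunc m \<gamma> \<in> C'}"
  shows "C' = cyl (jet_coords n) (jet_coords m) C"
proof -
  have "x \<in> C' \<longleftrightarrow> reindex id (jet_coords n) x \<in> C" if "x \<in> aff_points (jet_coords m)" for x
  proof -
    have "jet_arc x \<in> {\<gamma>. arc_trunc n \<gamma> \<in> C} \<longleftrightarrow> jet_arc x \<in> {\<gamma>. arc_trunc m \<gamma> \<in> C'}" by (simp only: eq)
    then show ?thesis
      using reindex_arc_trunc[OF assms(1), of "jet_arc x"] arc_trunc_jet_arc[OF that] by simp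
  qed
  then show ?thesis using assms(2) by (auto simp: cyl_def)
qed

lemma cls_cyl_jets:
  fixes T :: "('n::finite \<times> nat \<Rightarrow> 'k::field_char_0 alg_closure) set"
  assumes T: "loc_closed T" "T \<subseteq> aff_points (jet_coords n)" and "n \<le> m"
  shows "cls (cyl (jet_coords n) (jet_coords m) T) = cls T * K0_L ^ ((m - n) * CARD('n))"
proof -
  have "jet_coords m = (jet_coords n \<union> UNIV \<times> {n<..m} :: ('n \<times> nat) set)" using assms(3) by auto
  moreover have "card (UNIV \<times> {n<..m} :: ('n \<times> nat) set) = (m - n) * CARD('n)" by (simp add: card_cartesian_product)
  moreover have "cls (cyl (jet_coords n) (jet_coords n \<union> UNIV \<times> {n<..m}) T) = cls T * K0_L ^ card (UNIV \<times> {n<..m} :: ('n \<times> nat) set)"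
    by (rule cls_cyl[OF T]) auto
  ultimately show ?thesis by (simp only:)
qed

text \<open>Any other description of M, at a level m, is compared with the given one at level n: the
  one at the higher level is a cylinder over the other, and the additional powers of L
  cancel.\<close>

lemma motivic_measure_eq:
  fixes P :: "'a \<Rightarrow> ('n::finite \<times> nat \<Rightarrow> 'k::field_char_0 alg_closure) set"
  assumes A: "finite A" "disjoint_family_on P A"
    and P: "\<And>a. a \<in> A \<Longrightarrow> loc_closed (P a)" "\<And>a. a \<in> A \<Longrightarrow> P a \<subseteq> aff_points (jet_coords n)"
    and M: "M = {\<gamma>. arc_trunc n \<gamma> \<in> (\<Union>a\<in>A. P a)}"
  shows "motivic_measure M = Mk_of_K0 (\<Sum>a\<in>A. cls (P a)) * Mk_Linv ^ ((n + 1) * CARD('n))"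
  unfolding motivic_measure_def
proof (rule the_equality)
  let ?C = "\<Union>a\<in>A. P a" and ?d = "CARD('n)"
  have fin: "finite (jet_coords m :: ('n \<times> nat) set)" for m by simp
  have "constructible (jet_coords n) ?C"
    unfolding constructible_def using A(1) P by (intro exI[of _ "P ` A"]) (auto simp: locally_closedin_zariski)
  then show "\<exists>m C. constructible (jet_coords m) C \<and> M = {\<gamma>. arc_trunc m \<gamma> \<in> C} \<and>
      Mk_of_K0 (\<Sum>a\<in>A. cls (P a)) * Mk_Linv ^ ((n + 1) * ?d)
        = Mk_of_K0 (constructible_class (jet_coords m) C) * Mk_Linv ^ ((m + 1) * ?d)"
    using M constructible_class_eq[OF fin A P refl] by (intro exI[of _ n] exI[of _ ?C]) simp
  fix c assume "\<exists>m C. constructible (jet_coords m) C \<and> M = {\<gamma>. arc_trunc m \<gamma> \<in> C} \<and>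
      c = Mk_of_K0 (constructible_class (jet_coords m) C) * Mk_Linv ^ ((m + 1) * ?d)"
  then obtain m C where C: "constructible (jet_coords m) C" "M = {\<gamma>. arc_trunc m \<gamma> \<in> C}"
    and c: "c = Mk_of_K0 (constructible_class (jet_coords m) C) * Mk_Linv ^ ((m + 1) * ?d)" by blast
  have CI: "C \<subseteq> aff_points (jet_coords m)"
    using C(1) unfolding constructible_def locally_closedin_zariski by blast
  have PI: "?C \<subseteq> aff_points (jet_coords n)" using P(2) by blast
  show "c = Mk_of_K0 (\<Sum>a\<in>A. cls (P a)) * Mk_Linv ^ ((n + 1) * ?d)"
  proof (cases "n \<le> m")
    case True
    let ?Q = "\<lambda>a. cyl (jet_coords n) (jet_coords m) (P a)"
    have "C = cyl (jet_coords n) (jet_coords m) ?C"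
      by (rule cyl_of_arcs[OF True CI]) (use M C(2) in simp)
    then have "C = (\<Union>a\<in>A. ?Q a)" by (auto simp: cyl_def)
    then have "constructible_class (jet_coords m) C = (\<Sum>a\<in>A. cls (?Q a))"
      using A(2) P(1) by (intro constructible_class_eq[OF fin A(1)])
        (auto simp: disjoint_family_on_def cyl_def intro: loc_closed_cyl[unfolded cyl_def])
    also have "\<dots> = (\<Sum>a\<in>A. cls (P a)) * K0_L ^ ((m - n) * ?d)"
      unfolding sum_distrib_right by (rule sum.cong) (simp_all add: cls_cyl_jets[OF P True])
    moreover have "(m + 1) * ?d = (n + 1) * ?d + (m - n) * ?d"
      using True by (simp flip: add_mult_distrib)
    ultimately show ?thesis unfolding c by (simp only: Mk_Linv_cancel)
  next
    case False
    then have le: "m \<le> n" by simp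
    \<comment> \<open>The pieces P a need not be cylinders over level m. C is partitioned by their
      slices, on which the coordinates above level m vanish, and the cylinders over these slices
      form a second partition of the same set.\<close>
    let ?P = "\<lambda>a. P a \<inter> aff_points (jet_coords m)"
    let ?Q = "\<lambda>a. cyl (jet_coords m) (jet_coords n) (?P a)"
    have eq: "?C = cyl (jet_coords m) (jet_coords n) C"
      by (rule cyl_of_arcs[OF le PI]) (use M C(2) in simp)
    have sub: "aff_points (jet_coords m) \<subseteq> (aff_points (jet_coords n) :: ('n \<times> nat \<Rightarrow> 'k alg_closure) set)"
      using le by (auto simp: aff_points_def)
    have "reindex id (jet_coords m) x = x" if "x \<in> aff_points (jet_coords m)" for x :: "'n \<times> nat \<Rightarrow> 'k alg_closure"
      using that by (auto simp: reindex_def aff_points_def)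
    then have "x \<in> C \<longleftrightarrow> x \<in> ?C" if "x \<in> aff_points (jet_coords m)" for x
      using that subsetD[OF sub that] unfolding eq cyl_def by simp
    then have C': "C = (\<Union>a\<in>A. ?P a)" using CI by auto
    have lP: "loc_closed (?P a)" "?P a \<subseteq> aff_points (jet_coords m)" if "a \<in> A" for a
      using P(1)[OF that] loc_closed_Int[OF _ loc_closed_aff_points] by auto
    have dP: "disjoint_family_on ?P A" using A(2) by (auto simp: disjoint_family_on_def)
    have "(\<Sum>a\<in>A. cls (P a)) = (\<Sum>a\<in>A. cls (?Q a))"
    proof (rule sum_cls_unique[OF A _ A(1)])
      show "disjoint_family_on ?Q A" using dP by (auto simp: disjoint_family_on_def cyl_def)
      show "\<Union> (P ` A) = \<Union> (?Q ` A)" unfolding eq C' by (auto simp: cyl_def)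
      show "quasi_affine (P a)" if "a \<in> A" for a using quasi_affineI[OF P(1) fin P(2)] that by blast
      show "quasi_affine (?Q a)" if "a \<in> A" for a
        using quasi_affineI[OF loc_closed_cyl[OF lP(1)] fin[of n]] that by (auto simp: cyl_def)
    qed
    also have "\<dots> = (\<Sum>a\<in>A. cls (?P a)) * K0_L ^ ((n - m) * ?d)"
      unfolding sum_distrib_right by (rule sum.cong) (simp_all only: cls_cyl_jets[OF lP le])
    also have "(\<Sum>a\<in>A. cls (?P a)) = constructible_class (jet_coords m) C"
      by (rule constructible_class_eq[OF fin A(1) dP lP C', symmetric])
    finally have "(\<Sum>a\<in>A. cls (P a)) = constructible_class (jet_coords m) C * K0_L ^ ((n - m) * ?d)" .
    moreover have "(n + 1) * ?d = (m + 1) * ?d + (n - m) * ?d"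
      using le by (simp flip: add_mult_distrib)
    ultimately show ?thesis unfolding c by (simp only: Mk_Linv_cancel)
  qed
qed

section \<open>Newton polyhedra\<close>

definition weight :: "('n::finite \<Rightarrow> nat) \<Rightarrow> ('n \<Rightarrow>\<^sub>0 nat) \<Rightarrow> nat" where
  "weight k a = (\<Sum>j\<in>UNIV. k j * poly_mapping.lookup a j)"

text \<open>The value m_h(k) as a natural number, so that it can serve as an exponent of t;
  \<open>newton_min_nat_vec\<close> identifies the two for non-zero h.\<close>

definition min_weight :: "('n::finite, 'k::zero) mpoly \<Rightarrow> ('n \<Rightarrow> nat) \<Rightarrow> nat" where
  "min_weight h k = Min (weight k ` Poly_Mapping.keys h)"

abbreviation face_at :: "('n::finite, 'k::zero) mpoly \<Rightarrow> ('n \<Rightarrow> nat) \<Rightarrow> (real ^ 'n) set" where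
  "face_at h k \<equiv> newton_face h (nat_vec k)"

lemma inner_nat_vec: "nat_vec k \<bullet> exponent_vec a = real (weight k a)"
  by (simp add: nat_vec_def exponent_vec_def weight_def inner_vec_def)

lemma inner_nat_vec_nonneg: "(\<And>i. 0 \<le> vec_nth v i) \<Longrightarrow> 0 \<le> nat_vec k \<bullet> v"
  by (auto simp: nat_vec_def inner_vec_def intro!: sum_nonneg)

lemma min_weight_le: "a \<in> Poly_Mapping.keys h \<Longrightarrow> min_weight h k \<le> weight k a"
  unfolding min_weight_def by (intro Min_le) auto

lemma min_weight_attained:
  assumes "h \<noteq> 0" shows "\<exists>a\<in>Poly_Mapping.keys h. weight k a = min_weight h k"
proof -
  have "min_weight h k \<in> weight k ` Poly_Mapping.keys h"
    unfolding min_weight_def by (rule Min_in) (use assms in auto)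
  then show ?thesis by auto
qed

lemma exponent_vec_in_newton: "a \<in> Poly_Mapping.keys h \<Longrightarrow> exponent_vec a \<in> newton_polyhedron h"
  unfolding newton_polyhedron_def
  by (rule hull_inc, rule UN_I[of a]) (auto intro!: exI[of _ 0])

lemma convex_newton: "convex (newton_polyhedron h)"
  unfolding newton_polyhedron_def by (rule convex_convex_hull)

text \<open>A half-space is convex, so it contains the hull as soon as it contains the translated
  orthants; these lie in it because k has no negative entries.\<close>

lemma newton_ge_min_weight:
  fixes h :: "('n::finite, 'k::zero) mpoly"
  assumes "x \<in> newton_polyhedron h" shows "real (min_weight h k) \<le> nat_vec k \<bullet> x"
proof -
  have "newton_polyhedron h \<subseteq> {x. nat_vec k \<bullet> x \<ge> real (min_weight h k)}"
    unfolding newton_polyhedron_def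
  proof (rule hull_minimal)
    show "(\<Union>a\<in>Poly_Mapping.keys h. {exponent_vec a + v |v. \<forall>i. 0 \<le> vec_nth v i})
        \<subseteq> {x. real (min_weight h k) \<le> nat_vec k \<bullet> x}"
    proof clarsimp
      fix a and v :: "real ^ 'n"
      assume "a \<in> Poly_Mapping.keys h" "\<forall>i. 0 \<le> vec_nth v i"
      then show "real (min_weight h k) \<le> nat_vec k \<bullet> (exponent_vec a + v)"
        using min_weight_le[of a h k] inner_nat_vec_nonneg[of v k] by (simp add: inner_add_right inner_nat_vec)
    qed
    show "convex {x. nat_vec k \<bullet> x \<ge> real (min_weight h k)}" by (rule convex_halfspace_ge)
  qed
  then show ?thesis using assms by blast
qed

lemma newton_min_nat_vec:
  assumes "h \<noteq> 0" shows "newton_min h (nat_vec k) = real (min_weight h k)"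
proof -
  obtain a where "a \<in> Poly_Mapping.keys h" "weight k a = min_weight h k"
    using min_weight_attained[OF assms] by blast
  then have "real (min_weight h k) \<in> (\<lambda>x. nat_vec k \<bullet> x) ` newton_polyhedron h"
    using exponent_vec_in_newton inner_nat_vec by (metis image_eqI)
  then show ?thesis unfolding newton_min_def
    by (intro cInf_eq_minimum) (auto intro: newton_ge_min_weight)
qed

lemma exponent_vec_in_face_at:
  "h \<noteq> 0 \<Longrightarrow> a \<in> Poly_Mapping.keys h \<Longrightarrow> exponent_vec a \<in> face_at h k \<longleftrightarrow> weight k a = min_weight h k"
  by (simp add: newton_face_def exponent_vec_in_newton newton_min_nat_vec inner_nat_vec)

text \<open>In a convex combination that attains the minimum, only points attaining it carry weight.
  Such a point is an exponent plus a vector v with non-negative entries and k . v = 0, and v = 0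
  because all k_j are positive.\<close>

lemma face_at_subset_hull:
  assumes "h \<noteq> 0" and k: "\<And>j. 0 < k j"
  shows "face_at h k \<subseteq> convex hull (exponent_vec ` {a \<in> Poly_Mapping.keys h. weight k a = min_weight h k})"
    (is "_ \<subseteq> convex hull ?E")
proof
  let ?m = "real (min_weight h k)" and ?k = "nat_vec k"
  fix x assume x: "x \<in> face_at h k"
  let ?G = "\<Union>a\<in>Poly_Mapping.keys h. {exponent_vec a + v |v. \<forall>i. 0 \<le> vec_nth v i}"
  have "x \<in> convex hull ?G" and kx: "?k \<bullet> x = ?m"
    using x by (auto simp: newton_face_def newton_min_nat_vec[OF assms(1)] newton_polyhedron_def)
  then obtain S u where S: "finite S" "S \<subseteq> ?G" "\<forall>s\<in>S. 0 \<le> u s" "sum u S = 1" "(\<Sum>s\<in>S. u s *\<^sub>R s) = x"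
    unfolding convex_hull_explicit by blast
  have ge: "?m \<le> ?k \<bullet> s" if "s \<in> S" for s
    by (rule newton_ge_min_weight, unfold newton_polyhedron_def, rule hull_inc) (use S(2) that in blast)
  have "(\<Sum>s\<in>S. u s * (?k \<bullet> s - ?m)) = ?k \<bullet> x - sum u S * ?m"
    by (simp add: S(5)[symmetric] inner_sum_right sum_subtractf right_diff_distrib sum_distrib_right)
  also have "\<dots> = 0" using kx S(4) by simp
  finally have "\<forall>s\<in>S. u s * (?k \<bullet> s - ?m) = 0"
    using S(1,3) ge by (subst (asm) sum_nonneg_eq_0_iff) auto
  then have on: "?k \<bullet> s = ?m" if "s \<in> S" "u s \<noteq> 0" for s using that by auto
  have E: "s \<in> ?E" if s: "s \<in> S" "u s \<noteq> 0" for s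
  proof -
    obtain a v where a: "a \<in> Poly_Mapping.keys h" "s = exponent_vec a + v" "\<forall>i. 0 \<le> vec_nth v i"
      using s S(2) by blast
    have "real (weight k a) + ?k \<bullet> v = ?m" using on[OF s] by (simp add: a(2) inner_add_right inner_nat_vec)
    moreover have "0 \<le> ?k \<bullet> v" using inner_nat_vec_nonneg a(3) by blast
    ultimately have kv: "?k \<bullet> v = 0" "weight k a = min_weight h k"
      using min_weight_le[OF a(1), of k] by linarith+
    have "\<forall>i. real (k i) * vec_nth v i = 0"
      using kv(1) a(3) by (simp add: nat_vec_def inner_vec_def sum_nonneg_eq_0_iff)
    then have "vec_nth v i = 0" for i using k[of i] by (metis less_irrefl mult_eq_0_iff of_nat_0_eq_iff)
    then have "v = 0" by (simp add: vec_eq_iff)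
    then show ?thesis using a kv by auto
  qed
  let ?S = "{s \<in> S. u s \<noteq> 0}"
  have "sum u ?S = sum u S" by (rule sum.mono_neutral_left) (use S(1) in auto)
  moreover have "(\<Sum>s\<in>?S. u s *\<^sub>R s) = (\<Sum>s\<in>S. u s *\<^sub>R s)"
    by (rule sum.mono_neutral_left) (use S(1) in auto)
  moreover have "?S \<subseteq> ?E" using E by blast
  ultimately show "x \<in> convex hull ?E"
    unfolding convex_hull_explicit using S by (intro CollectI exI[of _ ?S] exI[of _ u]) simp
qed

text \<open>Positivity of k is what makes the face compact: it is the hull of finitely many
  exponents.\<close>

lemma face_at_compact_face:
  assumes "h \<noteq> 0" and k: "\<And>j. 0 < k j" shows "face_at h k \<in> compact_faces h"
proof -
  let ?E = "exponent_vec ` {a \<in> Poly_Mapping.keys h. weight k a = min_weight h k}"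
  have eq: "face_at h k = newton_polyhedron h \<inter> {x. nat_vec k \<bullet> x = real (min_weight h k)}"
    by (auto simp: newton_face_def newton_min_nat_vec[OF assms(1)])
  have face: "face_at h k face_of newton_polyhedron h"
    unfolding eq by (rule face_of_Int_supporting_hyperplane_ge[OF convex_newton newton_ge_min_weight])
  have "convex hull ?E \<subseteq> face_at h k"
    by (rule hull_minimal) (use exponent_vec_in_face_at[OF assms(1)] face_of_imp_convex[OF face] in auto)
  then have "face_at h k = convex hull ?E" using face_at_subset_hull[of h k] assms by blast
  moreover have "compact (convex hull ?E)" by (rule finite_imp_compact_convex_hull) simp
  moreover have "?E \<noteq> {}" using min_weight_attained[OF assms(1), of k] by blast
  ultimately show ?thesis using face unfolding compact_faces_def by simp
qed

text \<open>A point a + v with v non-zero is the midpoint of a and a + 2v, both of which lie in the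
  polyhedron.\<close>

lemma extreme_point_of_newton:
  assumes x: "x extreme_point_of newton_polyhedron h" shows "\<exists>a\<in>Poly_Mapping.keys h. x = exponent_vec a"
proof -
  have "x \<in> (\<Union>a\<in>Poly_Mapping.keys h. {exponent_vec a + v |v. \<forall>i. 0 \<le> vec_nth v i})"
    using x unfolding newton_polyhedron_def by (rule extreme_point_of_convex_hull)
  then obtain a v where a: "a \<in> Poly_Mapping.keys h" "x = exponent_vec a + v" "\<forall>i. 0 \<le> vec_nth v i" by blast
  have "v = 0"
  proof (rule ccontr)
    assume v: "v \<noteq> 0"
    let ?y = "exponent_vec a + 2 *\<^sub>R v"
    have "?y \<in> newton_polyhedron h"
      unfolding newton_polyhedron_def
      by (rule hull_inc, rule UN_I[OF a(1)]) (use a(3) in \<open>auto intro!: exI[of _ "2 *\<^sub>R v"]\<close>)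
    moreover have "x \<in> open_segment (exponent_vec a) ?y"
      using v a(2) by (auto simp: in_segment algebra_simps intro!: exI[of _ "1/2"])
    ultimately show False
      using x exponent_vec_in_newton[OF a(1)] unfolding extreme_point_of_def by blast
  qed
  then show ?thesis using a by auto
qed

text \<open>By Minkowski's theorem a compact face is the hull of its extreme points, and these are
  among the finitely many exponents of h.\<close>

lemma finite_compact_faces: "finite (compact_faces h)"
proof (rule finite_subset)
  let ?E = "exponent_vec ` Poly_Mapping.keys h"
  show "compact_faces h \<subseteq> (\<lambda>E. convex hull E) ` Pow ?E"
  proof
    fix \<tau> assume "\<tau> \<in> compact_faces h"
    then have \<tau>: "\<tau> face_of newton_polyhedron h" "compact \<tau>" by (auto simp: compact_faces_def)
    have "\<tau> = convex hull {x. x extreme_point_of \<tau>}"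
      by (rule Krein_Milman_Minkowski[OF \<tau>(2) face_of_imp_convex[OF \<tau>(1)]])
    moreover have "{x. x extreme_point_of \<tau>} \<subseteq> ?E"
      using extreme_point_of_newton extreme_point_of_face[OF \<tau>(1)] by blast
    ultimately show "\<tau> \<in> (\<lambda>E. convex hull E) ` Pow ?E" by blast
  qed
qed simp

lemma compact_faces_0: "compact_faces (0 :: ('n::finite, 'k::zero) mpoly) = {}"
proof -
  have "newton_polyhedron (0 :: ('n, 'k) mpoly) = {}" by (simp add: newton_polyhedron_def)
  then show ?thesis by (auto simp: compact_faces_def dest: face_of_imp_subset)
qed


section \<open>Arcs of given order\<close>

lemma lookup_face_poly:
  "poly_mapping.lookup (face_poly h \<tau>) a = (if exponent_vec a \<in> \<tau> then poly_mapping.lookup h a else 0)"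
proof -
  have "poly_mapping.lookup (face_poly h \<tau>) a
      = (\<Sum>b | b \<in> Poly_Mapping.keys h \<and> exponent_vec b \<in> \<tau>. if b = a then poly_mapping.lookup h b else 0)"
    unfolding face_poly_def by (simp add: lookup_sum lookup_single when_def)
  also have "\<dots> = (if a \<in> Poly_Mapping.keys h \<and> exponent_vec a \<in> \<tau> then poly_mapping.lookup h a else 0)"
    by (subst sum.delta) auto
  finally show ?thesis by (auto simp: in_keys_iff)
qed

lemma keys_face_poly: "Poly_Mapping.keys (face_poly h \<tau>) = {a \<in> Poly_Mapping.keys h. exponent_vec a \<in> \<tau>}"
  by (auto simp: in_keys_iff lookup_face_poly split: if_splits)

lemma eval_face_poly:
  fixes h :: "('n::finite, 'k::field_char_0) mpoly"
  shows "mp_eval to_ac (face_poly h \<tau>) u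
    = (\<Sum>a\<in>{a \<in> Poly_Mapping.keys h. exponent_vec a \<in> \<tau>}. to_ac (poly_mapping.lookup h a) * monomial_at a u)"
  unfolding mp_eval_def keys_face_poly monomial_at_def by (rule sum.cong) (simp_all add: lookup_face_poly)

lemma eval_deriv_face_poly:
  fixes h :: "('n::finite, 'k::field_char_0) mpoly"
  shows "mp_eval to_ac (mp_deriv p (face_poly h \<tau>)) u
    = (\<Sum>a\<in>{a \<in> Poly_Mapping.keys h. exponent_vec a \<in> \<tau>}.
        to_ac (of_nat (poly_mapping.lookup a p) * poly_mapping.lookup h a) * monomial_at (a - Poly_Mapping.single p 1) u)"
  unfolding mp_deriv_def to_ac.eval_sum to_ac.eval_single keys_face_poly
  by (rule sum.cong) (simp_all add: lookup_face_poly)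

lemma monomial_at_UNIV: "monomial_at a u = (\<Prod>j\<in>UNIV. u j ^ poly_mapping.lookup a j)" for u :: "'n::finite \<Rightarrow> 'r::comm_ring_1"
  by (rule monomial_at_superset) auto

lemma monomial_at_split:
  fixes u :: "'n::finite \<Rightarrow> 'r::comm_ring_1"
  shows "monomial_at a u = u p ^ poly_mapping.lookup a p * (\<Prod>j\<in>UNIV - {p}. u j ^ poly_mapping.lookup a j)"
  unfolding monomial_at_UNIV by (rule prod.remove) auto

lemma monomial_at_deriv:
  fixes u :: "'n::finite \<Rightarrow> 'r::comm_ring_1"
  shows "monomial_at (a - Poly_Mapping.single p 1) u
    = u p ^ (poly_mapping.lookup a p - 1) * (\<Prod>j\<in>UNIV - {p}. u j ^ poly_mapping.lookup a j)"
  unfolding monomial_at_split[of _ _ p]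
  by (simp add: lookup_minus lookup_single)

text \<open>First-order Taylor expansion of the N-th power in the direction t^i. For i \<ge> 1 the
  higher terms contain a further factor t^i and do not reach the constant coefficient of Q.\<close>

lemma fps_power_perturb:
  fixes w :: "'r::comm_ring_1 fps"
  assumes "1 \<le> i"
  shows "\<exists>Q. (w + fps_const s * fps_X ^ i) ^ N = w ^ N + fps_X ^ i * Q \<and>
    fps_nth Q 0 = of_nat N * s * fps_nth w 0 ^ (N - 1)"
proof (induction N)
  case 0
  show ?case by (rule exI[of _ 0]) simp
next
  case (Suc N)
  then obtain Q where Q: "(w + fps_const s * fps_X ^ i) ^ N = w ^ N + fps_X ^ i * Q"
    "fps_nth Q 0 = of_nat N * s * fps_nth w 0 ^ (N - 1)" by blast
  have "(w + fps_const s * fps_X ^ i) ^ Suc N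
      = w ^ Suc N + fps_X ^ i * (w * Q + fps_const s * w ^ N + fps_const s * fps_X ^ i * Q)"
    by (simp add: Q(1) algebra_simps)
  moreover have "fps_nth (w * Q + fps_const s * w ^ N + fps_const s * fps_X ^ i * Q) 0
      = of_nat (Suc N) * s * fps_nth w 0 ^ (Suc N - 1)"
    using assms by (cases N) (simp_all add: Q(2) fps_power_zeroth power_0_left algebra_simps)
  ultimately show ?case by blast
qed

section \<open>Coefficients of h along an arc as polynomials on jets\<close>

definition jet_coeff :: "('n::finite, 'k::field_char_0) mpoly \<Rightarrow> nat \<Rightarrow> ('n \<times> nat \<Rightarrow> 'k alg_closure) \<Rightarrow> 'k alg_closure" where
  "jet_coeff h i x = fps_nth (comp_arc h (jet_arc x)) i"

lemma comp_arc_mon: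
  "comp_arc h \<gamma> = (\<Sum>a\<in>Poly_Mapping.keys h. fps_const (to_ac (poly_mapping.lookup h a)) * monomial_at a \<gamma>)"
  by (simp add: comp_arc_def mp_eval_def monomial_at_def)

text \<open>Series whose coefficients are polynomial functions of a parameter; they are closed under
  products because each coefficient of a product is a finite sum.\<close>

definition PF_fps :: "(('i \<Rightarrow> 'k::field_char_0 alg_closure) \<Rightarrow> 'k alg_closure fps) set" where
  "PF_fps = {F. \<forall>i. (\<lambda>x. fps_nth (F x) i) \<in> PF}"

lemma PF_fps_const: "(\<lambda>_. fps_const (to_ac c)) \<in> PF_fps"
  unfolding PF_fps_def mem_Collect_eq
proof
  fix i
  show "(\<lambda>_. fps_nth (fps_const (to_ac c)) i) \<in> PF" by (cases "i = 0") (simp_all add: PF_const PF_0)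
qed

lemma PF_fps_mult:
  assumes "F \<in> PF_fps" "G \<in> PF_fps" shows "(\<lambda>x. F x * G x) \<in> PF_fps"
  unfolding PF_fps_def mem_Collect_eq fps_mult_nth
proof (intro allI PF_sum PF_mult)
  show "(\<lambda>x. fps_nth (F x) i) \<in> PF" "(\<lambda>x. fps_nth (G x) i) \<in> PF" for i
    using assms by (simp_all add: PF_fps_def)
qed

lemma PF_fps_power: "F \<in> PF_fps \<Longrightarrow> (\<lambda>x. F x ^ n) \<in> PF_fps"
proof (induction n)
  case 0
  show ?case using PF_fps_const[of 1] by simp
next
  case (Suc n)
  from PF_fps_mult[OF Suc.prems Suc.IH[OF Suc.prems]] show ?case by simp
qed

lemma PF_fps_prod: "(\<And>j. j \<in> A \<Longrightarrow> F j \<in> PF_fps) \<Longrightarrow> (\<lambda>x. \<Prod>j\<in>A. F j x) \<in> PF_fps"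
proof (induction A rule: infinite_finite_induct)
  case (insert j A)
  from PF_fps_mult[of "F j" "\<lambda>x. \<Prod>j\<in>A. F j x"] insert show ?case by simp
qed (use PF_fps_const[of 1] in simp_all)

lemma jet_coeff_PF:
  fixes h :: "('n::finite, 'k::field_char_0) mpoly"
  shows "jet_coeff h i \<in> PF"
proof -
  have 1: "(\<lambda>x :: 'n \<times> nat \<Rightarrow> 'k alg_closure. jet_arc x j) \<in> PF_fps" for j
    unfolding PF_fps_def jet_arc_def by (simp add: PF_var)
  have 2: "(\<lambda>x :: 'n \<times> nat \<Rightarrow> 'k alg_closure. monomial_at a (jet_arc x)) \<in> PF_fps" for a
    unfolding monomial_at_def by (rule PF_fps_prod, rule PF_fps_power, rule 1)
  have "(\<lambda>x. \<Sum>a\<in>Poly_Mapping.keys h. fps_nth (fps_const (to_ac (poly_mapping.lookup h a)) * monomial_at a (jet_arc x)) i) \<in> PF"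
  proof (rule PF_sum)
    fix a
    show "(\<lambda>x. fps_nth (fps_const (to_ac (poly_mapping.lookup h a)) * monomial_at a (jet_arc x)) i) \<in> PF"
      using PF_fps_mult[OF PF_fps_const 2, of "poly_mapping.lookup h a" a]
      unfolding PF_fps_def mem_Collect_eq by (rule spec)
  qed
  then show ?thesis unfolding jet_coeff_def comp_arc_mon fps_sum_nth .
qed

text \<open>Congruence modulo t^(M+1).\<close>

definition agree :: "nat \<Rightarrow> 'a::zero fps \<Rightarrow> 'a fps \<Rightarrow> bool" where
  "agree M F G \<longleftrightarrow> (\<forall>i\<le>M. fps_nth F i = fps_nth G i)"

lemma agree_mult: "agree M F F' \<Longrightarrow> agree M G G' \<Longrightarrow> agree M (F * G) (F' * G')" for F :: "'a::comm_ring_1 fps"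
  unfolding agree_def fps_mult_nth by (auto intro!: sum.cong)

lemma agree_power: "agree M F F' \<Longrightarrow> agree M (F ^ n) (F' ^ n)" for F :: "'a::comm_ring_1 fps"
  by (induction n) (simp_all add: agree_mult, simp add: agree_def)

lemma agree_prod: "(\<And>j. j \<in> A \<Longrightarrow> agree M (F j) (F' j)) \<Longrightarrow> agree M (\<Prod>j\<in>A. F j) (\<Prod>j\<in>A. F' j)"
  for F :: "'b \<Rightarrow> 'a::comm_ring_1 fps"
  by (induction A rule: infinite_finite_induct) (simp_all add: agree_mult, simp_all add: agree_def)

lemma comp_arc_agree:
  assumes "\<And>j. agree M (\<gamma> j) (\<gamma>' j)" shows "agree M (comp_arc h \<gamma>) (comp_arc h \<gamma>')"
proof -
  have "agree M (fps_const (to_ac c) * monomial_at a \<gamma>) (fps_const (to_ac c) * monomial_at a \<gamma>')" for a c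
    unfolding monomial_at_def by (intro agree_mult agree_prod agree_power assms) (simp add: agree_def)
  then show ?thesis unfolding agree_def comp_arc_mon fps_sum_nth by (auto intro!: sum.cong)
qed

lemma jet_coeff_arc_trunc:
  assumes "i \<le> M" shows "jet_coeff h i (arc_trunc M \<gamma>) = fps_nth (comp_arc h \<gamma>) i"
proof -
  have "agree M (jet_arc (arc_trunc M \<gamma>) j) (\<gamma> j)" for j
    by (simp add: agree_def jet_arc_def arc_trunc_def)
  then show ?thesis using comp_arc_agree[of M "jet_arc (arc_trunc M \<gamma>)" \<gamma> h] assms
    by (simp add: agree_def jet_coeff_def)
qed

section \<open>Arcs with prescribed lower bounds on their orders\<close>

definition vanishing :: "('n \<Rightarrow> nat) \<Rightarrow> ('n \<times> nat \<Rightarrow> 'k::field_char_0 alg_closure) \<Rightarrow> bool" where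
  "vanishing k x \<longleftrightarrow> (\<forall>j. \<forall>i<k j. x (j, i) = 0)"

definition lead :: "('n \<Rightarrow> nat) \<Rightarrow> ('n \<times> nat \<Rightarrow> 'k::field_char_0 alg_closure) \<Rightarrow> 'n \<Rightarrow> 'k alg_closure" where
  "lead k x = (\<lambda>j. x (j, k j))"

text \<open>A unit where the leading coefficient is non-zero; at a capped order that coefficient may
  vanish.\<close>

definition unit_part :: "('n \<Rightarrow> nat) \<Rightarrow> ('n \<times> nat \<Rightarrow> 'k::field_char_0 alg_closure) \<Rightarrow> 'n \<Rightarrow> 'k alg_closure fps" where
  "unit_part k x = (\<lambda>j. Abs_fps (\<lambda>i. x (j, k j + i)))"

text \<open>The series \<open>t\<^sup>-\<^sup>m h(\<phi>)\<close>, where \<open>m\<close> is the minimal weight, for an arc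
  \<open>\<phi>\<^sub>j = t\<^bsup>k\<^sub>j\<^esup> u\<^sub>j\<close>.\<close>

definition reduced :: "('n::finite, 'k::field_char_0) mpoly \<Rightarrow> ('n \<Rightarrow> nat) \<Rightarrow> ('n \<Rightarrow> 'k alg_closure fps) \<Rightarrow> 'k alg_closure fps" where
  "reduced h k u = (\<Sum>a\<in>Poly_Mapping.keys h.
     fps_X ^ (weight k a - min_weight h k) * (fps_const (to_ac (poly_mapping.lookup h a)) * monomial_at a u))"

lemma jet_arc_vanishing: "vanishing k x \<Longrightarrow> jet_arc x j = fps_X ^ k j * unit_part k x j"
  by (rule fps_ext) (simp add: jet_arc_def unit_part_def fps_X_power_mult_nth vanishing_def)

lemma monomial_at_jet_arc:
  assumes "vanishing k x" shows "monomial_at a (jet_arc x) = fps_X ^ weight k a * monomial_at a (unit_part k x)"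
proof -
  have "monomial_at a (jet_arc x) = (\<Prod>j\<in>UNIV. fps_X ^ (k j * poly_mapping.lookup a j) * unit_part k x j ^ poly_mapping.lookup a j)"
    unfolding monomial_at_UNIV by (simp add: jet_arc_vanishing[OF assms] power_mult_distrib power_mult)
  also have "\<dots> = fps_X ^ weight k a * monomial_at a (unit_part k x)"
    by (simp add: prod.distrib monomial_at_UNIV weight_def power_sum)
  finally show ?thesis .
qed

lemma comp_arc_reduced:
  assumes "vanishing k x"
  shows "comp_arc h (jet_arc x) = fps_X ^ min_weight h k * reduced h k (unit_part k x)"
proof -
  have "fps_X ^ weight k a = fps_X ^ min_weight h k * (fps_X ^ (weight k a - min_weight h k) :: 'b alg_closure fps)"
    if "a \<in> Poly_Mapping.keys h" for a
    using min_weight_le[OF that, of k] by (simp flip: power_add)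
  then show ?thesis
    unfolding comp_arc_mon reduced_def sum_distrib_left monomial_at_jet_arc[OF assms]
    by (intro sum.cong refl) (simp add: mult_ac)
qed

lemma jet_coeff_below:
  "vanishing k x \<Longrightarrow> i < min_weight h k \<Longrightarrow> jet_coeff h i x = 0"
  by (simp add: jet_coeff_def comp_arc_reduced fps_X_power_mult_nth)

lemma jet_coeff_reduced:
  "vanishing k x \<Longrightarrow> jet_coeff h (min_weight h k + i) x = fps_nth (reduced h k (unit_part k x)) i"
  by (simp add: jet_coeff_def comp_arc_reduced fps_X_power_mult_nth)

lemma monomial_at_nth_0: "fps_nth (monomial_at a u) 0 = monomial_at a (\<lambda>j. fps_nth (u j) 0)" for u :: "'i \<Rightarrow> 'r::comm_ring_1 fps"
proof -
  have "fps_nth (\<Prod>j\<in>A. u j ^ f j) 0 = (\<Prod>j\<in>A. fps_nth (u j) 0 ^ f j)" for A and f :: "'i \<Rightarrow> nat"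
    by (induction A rule: infinite_finite_induct) (simp_all add: fps_power_zeroth)
  then show ?thesis by (simp add: monomial_at_def)
qed

text \<open>A positive power of t kills the constant coefficient, so only exponents of minimal
  weight remain, that is, those on the face.\<close>

lemma sum_face_keys:
  fixes h :: "('n::finite, 'k::field_char_0) mpoly" and F :: "_ \<Rightarrow> 'r::comm_ring_1 fps"
  assumes "h \<noteq> 0"
  shows "(\<Sum>a\<in>Poly_Mapping.keys h. fps_nth (fps_X ^ (weight k a - min_weight h k) * F a) 0)
    = (\<Sum>a\<in>{a \<in> Poly_Mapping.keys h. exponent_vec a \<in> face_at h k}. fps_nth (F a) 0)"
proof -
  have "fps_nth (fps_X ^ (weight k a - min_weight h k) * F a) 0
      = (if exponent_vec a \<in> face_at h k then fps_nth (F a) 0 else 0)" if "a \<in> Poly_Mapping.keys h" for a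
    using min_weight_le[OF that, of k] by (simp add: fps_X_power_mult_nth exponent_vec_in_face_at[OF assms that])
  then show ?thesis by (simp add: sum.inter_filter)
qed

lemma jet_coeff_min:
  assumes "h \<noteq> 0" "vanishing k x"
  shows "jet_coeff h (min_weight h k) x = mp_eval to_ac (face_poly h (face_at h k)) (lead k x)"
proof -
  have "jet_coeff h (min_weight h k) x = fps_nth (reduced h k (unit_part k x)) 0"
    using jet_coeff_reduced[OF assms(2), of h 0] by simp
  also have "\<dots> = (\<Sum>a\<in>{a \<in> Poly_Mapping.keys h. exponent_vec a \<in> face_at h k}.
      to_ac (poly_mapping.lookup h a) * monomial_at a (lead k x))"
    unfolding reduced_def fps_sum_nth sum_face_keys[OF assms(1)]
    by (simp add: monomial_at_nth_0 unit_part_def lead_def)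
  finally show ?thesis by (simp add: eval_face_poly)
qed

text \<open>Exponents off the face carry a further factor t, so to first order only h_tau is
  differentiated.\<close>

lemma reduced_perturb:
  fixes h :: "('n::finite, 'k::field_char_0) mpoly"
  assumes "h \<noteq> 0" "1 \<le> i"
  shows "\<exists>Q. reduced h k (u(p := u p + fps_const s * fps_X ^ i)) = reduced h k u + fps_X ^ i * Q \<and>
    fps_nth Q 0 = s * mp_eval to_ac (mp_deriv p (face_poly h (face_at h k))) (\<lambda>j. fps_nth (u j) 0)"
proof -
  let ?u = "u(p := u p + fps_const s * fps_X ^ i)" and ?v = "\<lambda>j. fps_nth (u j) 0"
  let ?l = poly_mapping.lookup
  define R where "R a = (\<Prod>j\<in>UNIV - {p}. u j ^ ?l a j)" for a :: "'n \<Rightarrow>\<^sub>0 nat"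
  define r where "r a = (\<Prod>j\<in>UNIV - {p}. ?v j ^ ?l a j)" for a :: "'n \<Rightarrow>\<^sub>0 nat"
  have R0: "fps_nth (R a) 0 = r a" for a
  proof -
    have "fps_nth (\<Prod>j\<in>A. u j ^ ?l a j) 0 = (\<Prod>j\<in>A. ?v j ^ ?l a j)" for A
      by (induction A rule: infinite_finite_induct) (simp_all add: fps_power_zeroth)
    then show ?thesis by (simp add: R_def r_def)
  qed
  have "\<forall>N. \<exists>Q. (u p + fps_const s * fps_X ^ i) ^ N = u p ^ N + fps_X ^ i * Q \<and>
      fps_nth Q 0 = of_nat N * s * fps_nth (u p) 0 ^ (N - 1)"
    using fps_power_perturb[OF assms(2)] by blast
  then obtain Q where Q: "\<And>N. (u p + fps_const s * fps_X ^ i) ^ N = u p ^ N + fps_X ^ i * Q N"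
    "\<And>N. fps_nth (Q N) 0 = of_nat N * s * fps_nth (u p) 0 ^ (N - 1)" by metis
  have monomial_at: "monomial_at a ?u = monomial_at a u + fps_X ^ i * (Q (?l a p) * R a)" for a
  proof -
    have "monomial_at a ?u = (u p + fps_const s * fps_X ^ i) ^ ?l a p * R a"
      unfolding monomial_at_split[of a ?u p] R_def by simp
    also have "\<dots> = u p ^ ?l a p * R a + fps_X ^ i * (Q (?l a p) * R a)"
      by (simp add: Q(1) algebra_simps)
    finally show ?thesis by (simp add: monomial_at_split[of a u p] R_def)
  qed
  let ?c = "\<lambda>a. fps_const (to_ac (?l h a))"
  define q where "q = (\<Sum>a\<in>Poly_Mapping.keys h. fps_X ^ (weight k a - min_weight h k) * (?c a * (Q (?l a p) * R a)))"
  have "reduced h k ?u = reduced h k u + fps_X ^ i * q"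
    unfolding reduced_def q_def sum_distrib_left sum.distrib[symmetric] monomial_at
    by (rule sum.cong) (simp_all add: algebra_simps)
  moreover have "fps_nth q 0 = (\<Sum>a\<in>{a \<in> Poly_Mapping.keys h. exponent_vec a \<in> face_at h k}.
      s * (to_ac (of_nat (?l a p) * ?l h a) * monomial_at (a - Poly_Mapping.single p 1) ?v))"
    unfolding q_def fps_sum_nth sum_face_keys[OF assms(1)] monomial_at_deriv r_def[symmetric]
    by (rule sum.cong) (simp_all add: Q(2) R0 mult_ac)
  then have "fps_nth q 0 = s * mp_eval to_ac (mp_deriv p (face_poly h (face_at h k))) ?v"
    unfolding eval_deriv_face_poly sum_distrib_left .
  ultimately show ?thesis by blast
qed

text \<open>Both claims compare with the value 0 of the coordinate and not with \<open>x\<close>: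
  this is the shape that \<open>cls_eliminate\<close> asks for, and \<open>x\<close> itself is the
  case where s is its own coordinate.\<close>

lemma jet_coeff_perturb:
  fixes h :: "('n::finite, 'k::field_char_0) mpoly"
  assumes h: "h \<noteq> 0" and x: "vanishing k x" and i: "1 \<le> i"
  shows "i' < i \<Longrightarrow> jet_coeff h (min_weight h k + i') (x((p, k p + i) := s)) = jet_coeff h (min_weight h k + i') (x((p, k p + i) := 0))"
    and "jet_coeff h (min_weight h k + i) (x((p, k p + i) := s)) = jet_coeff h (min_weight h k + i) (x((p, k p + i) := 0))
      + s * mp_eval to_ac (mp_deriv p (face_poly h (face_at h k))) (lead k x)"
proof -
  let ?x = "\<lambda>s. x((p, k p + i) := s)"
  have v: "vanishing k (?x s)" for s using x by (auto simp: vanishing_def)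
  \<comment> \<open>The jet coordinate \<open>(p, k p + i)\<close> is the coefficient of t^i in
    u_p.\<close>
  have up: "unit_part k (?x s) = (unit_part k (?x 0))(p := unit_part k (?x 0) p + fps_const s * fps_X ^ i)"
    by (auto simp: unit_part_def fun_eq_iff fps_eq_iff fps_X_power_iff)
  have l: "(\<lambda>j. fps_nth (unit_part k (?x 0) j) 0) = lead k x"
    by (rule ext, simp add: unit_part_def lead_def) (use i in auto)
  obtain Q where Q: "reduced h k (unit_part k (?x s)) = reduced h k (unit_part k (?x 0)) + fps_X ^ i * Q"
    "fps_nth Q 0 = s * mp_eval to_ac (mp_deriv p (face_poly h (face_at h k))) (lead k x)"
    using reduced_perturb[OF h i, of k "unit_part k (?x 0)" p s] unfolding l up[symmetric] by blast
  show "jet_coeff h (min_weight h k + i') (?x s) = jet_coeff h (min_weight h k + i') (?x 0)" if "i' < i"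
    using that by (simp add: jet_coeff_reduced[OF v] Q(1) fps_X_power_mult_nth)
  show "jet_coeff h (min_weight h k + i) (?x s) = jet_coeff h (min_weight h k + i) (?x 0)
      + s * mp_eval to_ac (mp_deriv p (face_poly h (face_at h k))) (lead k x)"
    by (simp add: jet_coeff_reduced[OF v] Q fps_X_power_mult_nth)
qed

section \<open>Classes of jets with prescribed leading coefficients\<close>

abbreviation mcls :: "('i \<Rightarrow> 'k::field_char_0 alg_closure) set \<Rightarrow> 'k Mk" where
  "mcls S \<equiv> Mk_of_K0 (cls S)"

text \<open>The orders are only bounded below by k; whether they are attained depends on D, which
  may contain points with zero coordinates.\<close>

definition lead_in :: "('n::finite \<Rightarrow> nat) \<Rightarrow> nat \<Rightarrow> ('n \<Rightarrow> 'k::field_char_0 alg_closure) set \<Rightarrow> ('n \<times> nat \<Rightarrow> 'k alg_closure) set" where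
  "lead_in k M D = {x \<in> aff_points (jet_coords M). vanishing k x \<and> lead k x \<in> D}"

lemma lead_PF: "(\<lambda>x. lead k x j) \<in> PF"
  unfolding lead_def by (rule PF_var)

lemma loc_closed_lead_in:
  assumes "loc_closed D" shows "loc_closed (lead_in k M D)"
proof -
  have "lead_in k M D = aff_points (UNIV \<times> {..M} \<inter> {(j, i). k j \<le> i}) \<inter> lead k -` D"
    by (auto simp: lead_in_def aff_points_def vanishing_def not_le)
  then show ?thesis
    using loc_closed_Int[OF loc_closed_aff_points loc_closed_vimage[where u = "lead k", OF assms lead_PF]] by simp
qed

lemma lead_in_aff: "lead_in k M D \<subseteq> aff_points (jet_coords M)"
  by (auto simp: lead_in_def)

lemma quasi_affine_lead_in: "loc_closed D \<Longrightarrow> quasi_affine (lead_in k M D)"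
  by (rule quasi_affineI[OF loc_closed_lead_in _ lead_in_aff]) simp_all

text \<open>Coordinates below k_j vanish, those in \<open>?I\<close> are the leading ones and carry
  D, and those in \<open>?K\<close> are free.\<close>

lemma cls_lead_in:
  fixes D :: "('n::finite \<Rightarrow> 'k::field_char_0 alg_closure) set"
  assumes D: "loc_closed D" and k: "\<And>j. k j \<le> M"
  shows "cls (lead_in k M D) = cls D * K0_L ^ (\<Sum>j\<in>UNIV. M - k j)"
proof -
  let ?I = "range (\<lambda>j. (j, k j)) :: ('n \<times> nat) set" and ?K = "Sigma UNIV (\<lambda>j. {k j<..M}) :: ('n \<times> nat) set"
  let ?D = "{x \<in> aff_points ?I. lead k x \<in> D}"
  have "?D = aff_points ?I \<inter> lead k -` D" by auto
  then have lD: "loc_closed ?D"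
    using loc_closed_Int[OF loc_closed_aff_points loc_closed_vimage[where u = "lead k", OF D lead_PF]] by simp
  have "lead_in k M D = cyl ?I (?I \<union> ?K) ?D"
  proof -
    have "x \<in> aff_points (jet_coords M) \<and> vanishing k x \<longleftrightarrow> x \<in> aff_points (?I \<union> ?K)" for x :: "'n \<times> nat \<Rightarrow> 'k alg_closure"
    proof -
      have eq: "(j, i) \<notin> ?I \<union> ?K \<longleftrightarrow> i > M \<or> i < k j" for i j using k[of j] by auto
      have "x \<in> aff_points (jet_coords M) \<and> vanishing k x \<longleftrightarrow> (\<forall>j i. i > M \<or> i < k j \<longrightarrow> x (j, i) = 0)"
        by (auto simp: aff_points_def vanishing_def not_le)
      also have "\<dots> \<longleftrightarrow> x \<in> aff_points (?I \<union> ?K)"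
        by (simp only: aff_points_def mem_Collect_eq split_paired_All eq)
      finally show ?thesis .
    qed
    moreover have "lead k (reindex id ?I x) = lead k x" for x :: "'n \<times> nat \<Rightarrow> 'k alg_closure"
      by (auto simp: lead_def reindex_def)
    ultimately show ?thesis unfolding lead_in_def cyl_def by (simp add: reindex_aff) blast
  qed
  also have "cls \<dots> = cls ?D * K0_L ^ card ?K" by (rule cls_cyl[OF lD]) auto
  also have "card ?K = (\<Sum>j\<in>UNIV. M - k j)" by (subst card_SigmaI) auto
  also have "cls ?D = cls {y \<in> aff_points UNIV. reindex fst ?I y \<in> ?D}"
    by (rule cls_reindex) (auto simp: bij_betw_def inj_on_def image_image)
  also have "{y \<in> aff_points UNIV. reindex fst ?I y \<in> ?D} = D"
  proof -
    have "lead k (reindex fst ?I y) = y" for y :: "'n \<Rightarrow> 'k alg_closure"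
      by (auto simp: lead_def reindex_def)
    then show ?thesis by (simp add: reindex_aff) (simp add: aff_points_def)
  qed
  finally show ?thesis .
qed

text \<open>Of the (M + 1) d jet coordinates, as many as the sum of the k_j vanish and d are
  leading; the free ones cancel against powers of L, so the measure does not depend on M.\<close>

lemma mcls_lead_in:
  fixes D :: "('n::finite \<Rightarrow> 'k::field_char_0 alg_closure) set"
  assumes D: "loc_closed D" and k: "\<And>j. k j \<le> M"
  shows "mcls (lead_in k M D) * Mk_Linv ^ ((M + 1) * CARD('n)) = Mk_Linv ^ (\<Sum>j\<in>UNIV. k j) * (Mk_Linv ^ CARD('n) * mcls D)"
proof -
  have "(\<Sum>j\<in>UNIV. M - k j) + (\<Sum>j\<in>UNIV. k j) = (\<Sum>j\<in>(UNIV :: 'n set). M)"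
    unfolding sum.distrib[symmetric] by (rule sum.cong) (simp_all add: k)
  then have "(M + 1) * CARD('n) = (CARD('n) + (\<Sum>j\<in>UNIV. k j)) + (\<Sum>j\<in>UNIV. M - k j)"
    by (simp add: mult.commute)
  then have "mcls (lead_in k M D) * Mk_Linv ^ ((M + 1) * CARD('n)) = mcls D * Mk_Linv ^ (CARD('n) + (\<Sum>j\<in>UNIV. k j))"
    by (simp only: cls_lead_in[OF D k] Mk_Linv_cancel)
  then show ?thesis by (simp add: power_add mult_ac)
qed

text \<open>The torus for J = {}. J will be the set of variables of capped order, whose leading
  coefficient is unrestricted.\<close>

definition punctured :: "'n set \<Rightarrow> ('n \<Rightarrow> 'k::field_char_0 alg_closure) set" where
  "punctured J = {u. \<forall>j. j \<notin> J \<longrightarrow> u j \<noteq> 0}"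

lemma loc_closed_punctured: "loc_closed (punctured J :: ('n::finite \<Rightarrow> 'k::field_char_0 alg_closure) set)"
proof -
  have "punctured J = (\<Inter>j\<in>- J. {u :: 'n \<Rightarrow> 'k alg_closure. u j \<noteq> 0})" by (auto simp: punctured_def)
  also have "loc_closed \<dots>" by (rule loc_closed_INT) (simp, rule loc_closed_neq0[OF PF_var])
  finally show ?thesis .
qed

lemma mcls_scissor:
  assumes "quasi_affine S" "b \<in> PF"
  shows "mcls (S \<inter> {x. b x \<noteq> 0}) = mcls S - mcls (S \<inter> {x. b x = 0})"
proof -
  have "S - {x. b x \<noteq> 0} = S \<inter> {x. b x = 0}" by auto
  then have "cls S = cls (S \<inter> {x. b x \<noteq> 0}) + cls (S \<inter> {x. b x = 0})"
    using cls_scissor[OF assms(1) zopen_UNIV_basic[OF assms(2)]] by simp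
  then show ?thesis by (simp add: Mk_of_K0_hom)
qed

lemma mcls_eliminated: "cls S = cls T * K0_L \<Longrightarrow> mcls T = mcls S * Mk_Linv"
  by (simp add: Mk_of_K0_hom mult.assoc Mk_L_Linv)

lemma Mk_of_K0_sum: "Mk_of_K0 (\<Sum>a\<in>A. f a) = (\<Sum>a\<in>A. Mk_of_K0 (f a))"
  by (induction A rule: infinite_finite_induct) (simp_all add: Mk_of_K0_hom)

definition face_zeros :: "('n::finite, 'k::field_char_0) mpoly \<Rightarrow> (real ^ 'n) set \<Rightarrow> 'n set \<Rightarrow> ('n \<Rightarrow> 'k alg_closure) set" where
  "face_zeros h \<tau> J = punctured J \<inter> {u. mp_eval to_ac (face_poly h \<tau>) u = 0}"

lemma loc_closed_face_zeros: "loc_closed (face_zeros h \<tau> J)"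
  unfolding face_zeros_def by (intro loc_closed_Int loc_closed_punctured loc_closed_eq0[OF PF_mp_eval])

text \<open>For M \<ge> k_j: jets of order exactly k_j for j outside J and at least k_j for j in J,
  along which h has order n.\<close>

definition piece :: "('n::finite, 'k::field_char_0) mpoly \<Rightarrow> ('n \<Rightarrow> nat) \<Rightarrow> 'n set \<Rightarrow> nat \<Rightarrow> nat \<Rightarrow> ('n \<times> nat \<Rightarrow> 'k alg_closure) set" where
  "piece h k J M n = lead_in k M (punctured J) \<inter> {x. (\<forall>i<n. jet_coeff h i x = 0) \<and> jet_coeff h n x \<noteq> 0}"

text \<open>For J = {} this is the coefficient of T^l in L_tau, see \<open>L_series_nth\<close>. For
  l > 0 the factor (L - 1) L^-l is L^-(l-1) - L^-l: beyond the initial coefficient, l - 1 further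
  ones vanish and the next does not.\<close>

definition piece_coeff :: "('n::finite, 'k::field_char_0) mpoly \<Rightarrow> (real ^ 'n) set \<Rightarrow> 'n set \<Rightarrow> nat \<Rightarrow> 'k Mk" where
  "piece_coeff h \<tau> J l = Mk_Linv ^ CARD('n) *
     (if l = 0 then mcls (punctured J) - mcls (face_zeros h \<tau> J)
      else (Mk_of_K0 K0_L - 1) * mcls (face_zeros h \<tau> J) * Mk_Linv ^ l)"

lemma loc_closed_piece: "loc_closed (piece h k J M n)"
proof -
  have "piece h k J M n = lead_in k M (punctured J) \<inter> ((\<Inter>i\<in>{..<n}. {x. jet_coeff h i x = 0}) \<inter> {x. jet_coeff h n x \<noteq> 0})"
    by (auto simp: piece_def)
  also have "loc_closed \<dots>"
    by (intro loc_closed_Int loc_closed_INT loc_closed_lead_in loc_closed_punctured loc_closed_eq0 loc_closed_neq0 jet_coeff_PF) simp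
  finally show ?thesis .
qed

lemma piece_vanishing: "x \<in> piece h k J M n \<Longrightarrow> vanishing k x"
  by (simp add: piece_def lead_in_def)

lemma piece_empty:
  assumes "n < min_weight h k" shows "piece h k J M n = {}"
proof (rule equals0I)
  fix x assume x: "x \<in> piece h k J M n"
  then have "jet_coeff h n x \<noteq> 0" by (simp add: piece_def)
  then show False using jet_coeff_below[OF piece_vanishing[OF x] assms] by simp
qed

lemma mcls_piece_0:
  fixes h :: "('n::finite, 'k::field_char_0) mpoly"
  assumes h: "h \<noteq> 0" and k: "\<And>j. k j \<le> M"
  shows "mcls (piece h k J M (min_weight h k)) * Mk_Linv ^ ((M + 1) * CARD('n))
    = Mk_Linv ^ (\<Sum>j\<in>UNIV. k j) * piece_coeff h (face_at h k) J 0"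
proof -
  let ?f = "mp_eval to_ac (face_poly h (face_at h k))"
  let ?D = "punctured J \<inter> {u. ?f u \<noteq> 0}"
  have "x \<in> piece h k J M (min_weight h k) \<longleftrightarrow> x \<in> lead_in k M ?D" for x :: "'n \<times> nat \<Rightarrow> 'k alg_closure"
    by (cases "vanishing k x")
      (simp_all add: piece_def lead_in_def jet_coeff_below jet_coeff_min[OF h] conj_ac)
  then have "piece h k J M (min_weight h k) = lead_in k M ?D" by blast
  moreover have "loc_closed ?D"
    by (intro loc_closed_Int loc_closed_punctured loc_closed_neq0[OF PF_mp_eval])
  moreover have "mcls ?D = mcls (punctured J) - mcls (face_zeros h (face_at h k) J)"
    unfolding face_zeros_def
    by (rule mcls_scissor[OF quasi_affine_finite[OF loc_closed_punctured] PF_mp_eval])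
  ultimately show ?thesis using mcls_lead_in[of ?D k M] k by (simp add: piece_coeff_def)
qed

section \<open>Elimination over the zeros of the face polynomial\<close>

context
  fixes h :: "('n::finite, 'k::field_char_0) mpoly" and k :: "'n \<Rightarrow> nat" and J :: "'n set" and M :: nat
  assumes h: "h \<noteq> 0"
begin

private abbreviation "m \<equiv> min_weight h k"
private abbreviation "dphi j \<equiv> mp_eval to_ac (mp_deriv j (face_poly h (face_at h k)))"

text \<open>Over the stratum of a non-empty G any p in G has an invertible derivative at every
  point. The strata are locally closed and indexed by the subsets of a finite type.\<close>

definition grad_support :: "'n set \<Rightarrow> ('n \<Rightarrow> 'k alg_closure) set" where
  "grad_support G = {u. \<forall>j. dphi j u \<noteq> 0 \<longleftrightarrow> j \<in> G}"

text \<open>Jets over the stratum G along which h vanishes to order greater than m + l; the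
  coefficient of t^m is covered by \<open>face_zeros\<close>.\<close>

definition stage :: "'n set \<Rightarrow> nat \<Rightarrow> ('n \<times> nat \<Rightarrow> 'k alg_closure) set" where
  "stage G l = lead_in k M (face_zeros h (face_at h k) J \<inter> grad_support G) \<inter> {x. \<forall>i. 1 \<le> i \<and> i \<le> l \<longrightarrow> jet_coeff h (m + i) x = 0}"

lemma loc_closed_grad_support: "loc_closed (grad_support G)"
proof -
  have "grad_support G = (\<Inter>j\<in>UNIV. if j \<in> G then {u. dphi j u \<noteq> 0} else {u. dphi j u = 0})"
    by (auto simp: grad_support_def)
  also have "loc_closed \<dots>"
    by (rule loc_closed_INT) (simp_all add: loc_closed_neq0[OF PF_mp_eval] loc_closed_eq0[OF PF_mp_eval])
  finally show ?thesis .
qed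

lemma loc_closed_stage: "loc_closed (stage G l)"
proof -
  have "stage G l = lead_in k M (face_zeros h (face_at h k) J \<inter> grad_support G) \<inter> (\<Inter>i\<in>{1..l}. {x. jet_coeff h (m + i) x = 0})"
    by (auto simp: stage_def)
  also have "loc_closed \<dots>"
    by (intro loc_closed_Int loc_closed_INT loc_closed_lead_in loc_closed_face_zeros loc_closed_grad_support
        loc_closed_eq0 jet_coeff_PF) simp
  finally show ?thesis .
qed

lemma stage_aff: "stage G l \<subseteq> aff_points (jet_coords M)"
  using lead_in_aff by (auto simp: stage_def)

text \<open>The coefficient of t^(l+1) in u_p enters linearly into the coefficient m + l + 1 of h
  and into none of the conditions of stage l. The bound on M ensures that this coordinate is present
  in the jet.\<close>

lemma cls_stage_Suc:
  assumes p: "p \<in> G" "k p + Suc l \<le> M"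
  shows "cls (stage G l) = cls (stage G (Suc l)) * K0_L"
proof -
  let ?q = "(p, k p + Suc l)" and ?c = "jet_coeff h (m + Suc l)" and ?g = "\<lambda>x. dphi p (lead k x)"
  have v: "vanishing k x" if "x \<in> stage G l" for x using that by (simp add: stage_def lead_in_def)
  have l: "lead k (x(?q := s)) = lead k x" for x :: "'n \<times> nat \<Rightarrow> 'k alg_closure" and s
    by (rule ext) (auto simp: lead_def)
  have "cls (stage G l) = cls {x \<in> stage G l. ?c x = 0} * K0_L"
  proof (rule cls_eliminate[where p = ?q and g = ?g, OF loc_closed_stage stage_aff])
    show "finite (jet_coords M :: ('n \<times> nat) set)" by simp
    show "?q \<in> jet_coords M" using p by simp
    show "?c \<in> PF" by (rule jet_coeff_PF)
    show "?g \<in> PF" by (rule PF_compose[OF PF_mp_eval lead_PF])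
    show "?g x \<noteq> 0" if "x \<in> stage G l" for x
      using that p(1) by (auto simp: stage_def lead_in_def grad_support_def)
    show "?c (x(?q := s)) = ?c (x(?q := 0)) + s * ?g (x(?q := 0))" if "x \<in> stage G l" for x s
      unfolding l by (rule jet_coeff_perturb(2)[OF h v[OF that]]) simp
    show "x(?q := s) \<in> stage G l" if x: "x \<in> stage G l" for x s
    proof -
      have "jet_coeff h (m + i) (x(?q := s)) = jet_coeff h (m + i) x" if "i \<le> l" for i
        using jet_coeff_perturb(1)[OF h v[OF x], of "Suc l" i p s]
          jet_coeff_perturb(1)[OF h v[OF x], of "Suc l" i p "x ?q"] that by simp
      moreover have "x(?q := s) \<in> aff_points (jet_coords M)" using x p(2) by (auto simp: stage_def lead_in_def aff_points_def)
      moreover have "vanishing k (x(?q := s))" using v[OF x] by (auto simp: vanishing_def)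
      ultimately show ?thesis using x by (simp add: stage_def lead_in_def l[simplified])
    qed
  qed
  also have "{x \<in> stage G l. ?c x = 0} = stage G (Suc l)"
    by (auto simp: stage_def le_Suc_eq)
  finally show ?thesis .
qed

lemma mcls_stage:
  assumes "p \<in> G" "k p + l \<le> M" shows "mcls (stage G l) = mcls (stage G 0) * Mk_Linv ^ l"
  using assms(2)
proof (induction l)
  case (Suc l)
  then show ?case
    using mcls_eliminated[OF cls_stage_Suc[OF assms(1), of l]] by (simp add: mult_ac)
qed simp

text \<open>Over a stratum the piece is \<open>stage G l\<close> without
  \<open>stage G (Suc l)\<close>. Both are multiples of stage 0 by powers of L^-1 that do not depend
  on G, so the strata can be summed up again to the whole zero set of h_tau.\<close>

lemma mcls_piece_Suc:
  assumes k: "\<And>j. k j + Suc l \<le> M"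
    and nd: "\<And>u. u \<in> punctured J \<Longrightarrow> \<exists>j. dphi j u \<noteq> 0"
  shows "mcls (piece h k J M (m + Suc l)) * Mk_Linv ^ ((M + 1) * CARD('n))
    = Mk_Linv ^ (\<Sum>j\<in>UNIV. k j) * piece_coeff h (face_at h k) J (Suc l)"
proof -
  let ?\<tau> = "face_at h k" and ?c = "jet_coeff h (m + Suc l)"
  let ?N = "face_zeros h ?\<tau> J"
  let ?T = "\<lambda>G. stage G l \<inter> {x. ?c x \<noteq> 0}"
  have qs: "quasi_affine (stage G l)" for G
    by (rule quasi_affineI[OF loc_closed_stage _ stage_aff]) simp
  have stage0: "stage G 0 = lead_in k M (?N \<inter> grad_support G)" for G by (auto simp: stage_def)
  have T: "mcls (?T G) = mcls (stage G 0) * (Mk_Linv ^ l - Mk_Linv ^ Suc l)" for G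
  proof (cases "G = {}")
    case True
    \<comment> \<open>Some partial derivative is non-zero at every point, so the stratum of the
      empty set is empty.\<close>
    have "?N \<inter> grad_support G = {}" using nd True by (auto simp: face_zeros_def grad_support_def)
    then have "stage G i = {}" for i by (simp add: stage_def lead_in_def)
    then show ?thesis by (simp add: cls_empty Mk_of_K0_hom)
  next
    case False
    then obtain p where p: "p \<in> G" by blast
    have "stage G l \<inter> {x. ?c x = 0} = stage G (Suc l)" by (auto simp: stage_def le_Suc_eq)
    then have "mcls (?T G) = mcls (stage G l) - mcls (stage G (Suc l))"
      using mcls_scissor[OF qs jet_coeff_PF, of G h "m + Suc l"] by simp
    also have "mcls (stage G l) = mcls (stage G 0) * Mk_Linv ^ l"
      by (rule mcls_stage[OF p]) (use k[of p] in simp)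
    also have "mcls (stage G (Suc l)) = mcls (stage G 0) * Mk_Linv ^ Suc l"
      by (rule mcls_stage[OF p k])
    finally show ?thesis by (simp only: right_diff_distrib)
  qed
  have piece: "piece h k J M (m + Suc l) = (\<Union>G\<in>UNIV. ?T G)"
  proof -
    \<comment> \<open>Coefficients below m vanish on their own, the one at m is the value of h_tau,
      and the remaining ones are the conditions of the stage.\<close>
    have "(\<forall>i<m + Suc l. jet_coeff h i x = 0) \<longleftrightarrow>
        mp_eval to_ac (face_poly h ?\<tau>) (lead k x) = 0 \<and> (\<forall>i. 1 \<le> i \<and> i \<le> l \<longrightarrow> jet_coeff h (m + i) x = 0)"
      if v: "vanishing k x" for x
    proof
      assume "\<forall>i<m + Suc l. jet_coeff h i x = 0"
      then show "mp_eval to_ac (face_poly h ?\<tau>) (lead k x) = 0 \<and> (\<forall>i. 1 \<le> i \<and> i \<le> l \<longrightarrow> jet_coeff h (m + i) x = 0)"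
        unfolding jet_coeff_min[OF h v, symmetric] by simp
    next
      assume *: "mp_eval to_ac (face_poly h ?\<tau>) (lead k x) = 0 \<and> (\<forall>i. 1 \<le> i \<and> i \<le> l \<longrightarrow> jet_coeff h (m + i) x = 0)"
      show "\<forall>i<m + Suc l. jet_coeff h i x = 0"
      proof (intro allI impI)
        fix i assume i: "i < m + Suc l"
        show "jet_coeff h i x = 0"
        proof (cases "i \<le> m")
          case True
          then show ?thesis using jet_coeff_below[OF v, of i h] jet_coeff_min[OF h v] conjunct1[OF *]
            by (cases "i = m") auto
        next
          case False
          then have "1 \<le> i - m \<and> i - m \<le> l" using i by linarith
          then have "jet_coeff h (m + (i - m)) x = 0" using conjunct2[OF *] by blast
          then show ?thesis using False by simp
        qed
      qed
    qed
    then have 1: "x \<in> piece h k J M (m + Suc l) \<longleftrightarrow> x \<in> ?T {j. dphi j (lead k x) \<noteq> 0}" for x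
      by (cases "vanishing k x")
        (simp_all add: piece_def stage_def lead_in_def face_zeros_def grad_support_def conj_ac)
    have 2: "G = {j. dphi j (lead k x) \<noteq> 0}" if "x \<in> ?T G" for x G
      using that by (auto simp: stage_def lead_in_def grad_support_def)
    show ?thesis
    proof (intro equalityI subsetI)
      fix x assume "x \<in> piece h k J M (m + Suc l)"
      then show "x \<in> (\<Union>G\<in>UNIV. ?T G)" using 1[of x] by (intro UN_I[OF UNIV_I]) (rule iffD1)
    next
      fix x assume "x \<in> (\<Union>G\<in>UNIV. ?T G)"
      then obtain G where G: "x \<in> ?T G" by (elim UN_E)
      show "x \<in> piece h k J M (m + Suc l)" using G unfolding 1 2[OF G, symmetric] .
    qed
  qed
  have disj: "disjoint_family_on (grad_support :: 'n set \<Rightarrow> _) UNIV"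
    by (auto simp: disjoint_family_on_def grad_support_def)
  have "cls (\<Union>G\<in>UNIV. ?T G) = (\<Sum>G\<in>UNIV. cls (?T G))"
  proof (rule cls_additive)
    show "disjoint_family_on ?T UNIV" using disj by (auto simp: disjoint_family_on_def stage_def lead_in_def)
    show "quasi_affine (?T G)" for G by (rule quasi_affine_Int[OF qs loc_closed_neq0[OF jet_coeff_PF]])
    have "quasi_affine (piece h k J M (m + Suc l))"
      by (rule quasi_affineI[OF loc_closed_piece, of "jet_coords M"]) (auto simp: piece_def lead_in_def)
    then show "quasi_affine (\<Union>G\<in>UNIV. ?T G)" by (simp only: piece)
  qed simp
  then have "mcls (piece h k J M (m + Suc l)) = (\<Sum>G\<in>UNIV. mcls (stage G 0)) * (Mk_Linv ^ l - Mk_Linv ^ Suc l)"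
    by (simp only: piece Mk_of_K0_sum T sum_distrib_right)
  also have "(\<Sum>G\<in>UNIV. mcls (stage G 0)) = mcls (lead_in k M ?N)"
  proof -
    have eq: "(\<Union>G\<in>UNIV. stage G 0) = lead_in k M ?N"
    proof -
      have "\<exists>G. u \<in> grad_support G" for u by (rule exI[of _ "{j. dphi j u \<noteq> 0}"]) (simp add: grad_support_def)
      then show ?thesis by (auto simp: stage0 lead_in_def)
    qed
    have "cls (\<Union>G\<in>UNIV. stage G 0) = (\<Sum>G\<in>UNIV. cls (stage G 0))"
    proof (rule cls_additive)
      show "disjoint_family_on (\<lambda>G. stage G 0) UNIV" using disj by (auto simp: disjoint_family_on_def stage_def lead_in_def)
      show "quasi_affine (stage G 0)" for G by (rule quasi_affineI[OF loc_closed_stage _ stage_aff]) simp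
      show "quasi_affine (\<Union>G\<in>UNIV. stage G 0)" unfolding eq by (rule quasi_affine_lead_in[OF loc_closed_face_zeros])
    qed simp
    then show ?thesis by (simp only: eq Mk_of_K0_sum)
  qed
  also have "Mk_Linv ^ l - Mk_Linv ^ Suc l = (Mk_of_K0 K0_L - 1) * (Mk_Linv ^ Suc l :: 'k Mk)"
  proof -
    have "Mk_of_K0 K0_L * (Mk_Linv ^ Suc l :: 'k Mk) = Mk_Linv ^ l"
      by (simp add: Mk_L_Linv flip: mult.assoc)
    then show ?thesis by (simp add: left_diff_distrib)
  qed
  finally have "mcls (piece h k J M (m + Suc l)) * Mk_Linv ^ ((M + 1) * CARD('n))
      = mcls (lead_in k M ?N) * Mk_Linv ^ ((M + 1) * CARD('n)) * ((Mk_of_K0 K0_L - 1) * Mk_Linv ^ Suc l)"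
    by (simp only: mult_ac)
  also have "mcls (lead_in k M ?N) * Mk_Linv ^ ((M + 1) * CARD('n)) = Mk_Linv ^ (\<Sum>j\<in>UNIV. k j) * (Mk_Linv ^ CARD('n) * mcls ?N)"
  proof (rule mcls_lead_in[OF loc_closed_face_zeros])
    show "k j \<le> M" for j using k[of j] by simp
  qed
  finally show ?thesis by (simp add: piece_coeff_def mult_ac)
qed

end

text \<open>The variables in J do not occur in h_tau, so replacing them by 1 changes none of its
  derivatives and moves the point into the torus.\<close>

lemma nondegenerate_punctured:
  fixes h :: "('n::finite, 'k::field_char_0) mpoly"
  assumes nd: "nondegenerate h" and \<tau>: "\<tau> \<in> compact_faces h"
    and J: "\<And>a j. a \<in> Poly_Mapping.keys h \<Longrightarrow> exponent_vec a \<in> \<tau> \<Longrightarrow> j \<in> J \<Longrightarrow> poly_mapping.lookup a j = 0"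
    and u: "u \<in> punctured J"
  shows "\<exists>j. mp_eval to_ac (mp_deriv j (face_poly h \<tau>)) u \<noteq> 0"
proof -
  define v where "v = (\<lambda>j. if j \<in> J then 1 else u j)"
  have "v \<in> torus" using u by (simp add: v_def punctured_def torus_def)
  moreover have "{x \<in> torus. \<forall>i. mp_eval to_ac (mp_deriv i (face_poly h \<tau>)) x = 0} = {}"
    using nd \<tau> unfolding nondegenerate_def by (rule bspec)
  ultimately obtain j where j: "mp_eval to_ac (mp_deriv j (face_poly h \<tau>)) v \<noteq> 0" by blast
  \<comment> \<open>Subtraction of exponents is truncated, so an exponent 0 at a variable of J stays
    0 even when j itself lies in J.\<close>
  have "monomial_at (a - Poly_Mapping.single j 1) v = monomial_at (a - Poly_Mapping.single j 1) u"
    if "a \<in> Poly_Mapping.keys h" "exponent_vec a \<in> \<tau>" for a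
    unfolding monomial_at_UNIV
  proof (rule prod.cong[OF refl])
    fix i
    show "v i ^ poly_mapping.lookup (a - Poly_Mapping.single j 1) i = u i ^ poly_mapping.lookup (a - Poly_Mapping.single j 1) i"
      using J[OF that, of i] by (simp add: v_def lookup_minus)
  qed
  then have "mp_eval to_ac (mp_deriv j (face_poly h \<tau>)) v = mp_eval to_ac (mp_deriv j (face_poly h \<tau>)) u"
    unfolding eval_deriv_face_poly by (intro sum.cong refl) simp
  then show ?thesis using j by auto
qed

section \<open>Bounded orders and capped pieces\<close>

definition order_box :: "nat \<Rightarrow> ('n::finite \<Rightarrow> nat) set" where
  "order_box B = {k. \<forall>j. 1 \<le> k j \<and> k j \<le> B}"

lemma finite_order_box: "finite (order_box B :: ('n::finite \<Rightarrow> nat) set)"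
proof -
  have "(order_box B :: ('n \<Rightarrow> nat) set) = PiE UNIV (\<lambda>_. {1..B})" by (auto simp: order_box_def PiE_def)
  then show ?thesis by (simp add: finite_PiE)
qed

text \<open>Orders exceeding \<open>B\<close> are represented by the value \<open>B + 1\<close>.\<close>

definition capped :: "nat \<Rightarrow> ('n \<Rightarrow> nat) \<Rightarrow> 'n set" where
  "capped B k = {j. k j = Suc B}"

text \<open>A single factor of a variable of order B + 1 already contributes more than B to the
  weight.\<close>

lemma lookup_capped:
  assumes "a \<in> Poly_Mapping.keys h" "weight k a \<le> B" "j \<in> capped B k"
  shows "poly_mapping.lookup a j = 0"
proof (rule ccontr)
  assume "poly_mapping.lookup a j \<noteq> 0"
  then have "k j * 1 \<le> k j * poly_mapping.lookup a j" by (intro mult_le_mono2) simp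
  then have "Suc B \<le> k j * poly_mapping.lookup a j"
    using assms(3) unfolding capped_def mem_Collect_eq by (metis mult.right_neutral)
  also have "\<dots> \<le> weight k a" unfolding weight_def by (rule member_le_sum) auto
  finally show False using assms(2) by simp
qed

text \<open>The level \<open>Suc B + n\<close> leaves room for the coordinates
  \<open>k j + l\<close> with \<open>k j \<le> Suc B\<close> and l \<le> n that the elimination
  uses.\<close>

definition capped_piece :: "('n::finite, 'k::field_char_0) mpoly \<Rightarrow> nat \<Rightarrow> nat \<Rightarrow> ('n \<Rightarrow> nat) \<Rightarrow> ('n \<times> nat \<Rightarrow> 'k alg_closure) set" where
  "capped_piece h B n k = piece h k (capped B k) (Suc B + n) n"

text \<open>The normalised class of the piece as computed by elimination; the case distinction keeps
  the subtraction of natural numbers meaningful.\<close>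

definition piece_measure :: "('n::finite, 'k::field_char_0) mpoly \<Rightarrow> nat \<Rightarrow> nat \<Rightarrow> ('n \<Rightarrow> nat) \<Rightarrow> 'k Mk" where
  "piece_measure h B n k = (if min_weight h k \<le> n
     then Mk_Linv ^ (\<Sum>j\<in>UNIV. k j) * piece_coeff h (face_at h k) (capped B k) (n - min_weight h k) else 0)"

text \<open>If the minimal weight is at most n, the exponents on the face have weight at most B and
  avoid the capped variables, so \<open>nondegenerate_punctured\<close> applies. If it exceeds n,
  the piece is empty.\<close>

lemma mcls_capped_piece:
  fixes h :: "('n::finite, 'k::field_char_0) mpoly"
  assumes h: "h \<noteq> 0" and nd: "nondegenerate h" and B: "n \<le> B" and k: "k \<in> order_box (Suc B)"
  shows "mcls (capped_piece h B n k) * Mk_Linv ^ ((Suc B + n + 1) * CARD('n)) = piece_measure h B n k"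
proof (cases "min_weight h k \<le> n")
  case False
  then show ?thesis by (simp add: piece_measure_def capped_piece_def piece_empty cls_empty Mk_of_K0_hom)
next
  case True
  have kB: "k j \<le> Suc B" "0 < k j" for j using k by (auto simp: order_box_def Suc_le_eq)
  have nd': "\<exists>j. mp_eval to_ac (mp_deriv j (face_poly h (face_at h k))) u \<noteq> 0" if u: "u \<in> punctured (capped B k)" for u
  proof (rule nondegenerate_punctured[OF nd face_at_compact_face[OF h kB(2)] _ u])
    show "poly_mapping.lookup a j = 0"
      if a: "a \<in> Poly_Mapping.keys h" "exponent_vec a \<in> face_at h k" "j \<in> capped B k" for a j
      using lookup_capped[OF a(1) _ a(3)] exponent_vec_in_face_at[OF h a(1), of k] a(2) True B by simp
  qed
  show ?thesis
  proof (cases "n - min_weight h k")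
    case 0
    have "n = min_weight h k" using 0 True by simp
    have "k j \<le> Suc B + n" for j using kB(1) by (rule trans_le_add1)
    from mcls_piece_0[where J = "capped B k" and k = k, OF h this] show ?thesis
      using True by (simp only: piece_measure_def capped_piece_def \<open>n = min_weight h k\<close>[symmetric] if_True diff_self_eq_0)
  next
    case (Suc l)
    then have n: "n = min_weight h k + Suc l" using True by simp
    have "k j + Suc l \<le> Suc B + n" for j using kB(1)[of j] n by simp
    from mcls_piece_Suc[where J = "capped B k" and k = k, OF h this nd'] show ?thesis
      using True by (simp only: piece_measure_def capped_piece_def Suc n[symmetric] if_True)
  qed
qed

lemma has_order_iff: "has_order F n \<longleftrightarrow> (\<forall>i<n. fps_nth F i = 0) \<and> fps_nth F n \<noteq> 0"
proof
  assume "has_order F n"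
  then show "(\<forall>i<n. fps_nth F i = 0) \<and> fps_nth F n \<noteq> 0"
    unfolding has_order_def using nth_less_subdegree_zero nth_subdegree_nonzero by blast
next
  assume *: "(\<forall>i<n. fps_nth F i = 0) \<and> fps_nth F n \<noteq> 0"
  then have "subdegree F = n" by (intro subdegreeI) auto
  then show "has_order F n" using * by (auto simp: has_order_def)
qed

text \<open>A factor with exponent 0 is 1 even if its base is the zero series; this admits
  components of infinite order.\<close>

lemma has_order_power_prod:
  fixes F :: "'a \<Rightarrow> 'r::field fps"
  assumes "finite A" "\<And>j. j \<in> A \<Longrightarrow> e j = 0 \<or> has_order (F j) (k j)"
  shows "has_order (\<Prod>j\<in>A. F j ^ e j) (\<Sum>j\<in>A. e j * k j)"
  using assms
proof (induction A)
  case empty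
  show ?case by (simp add: has_order_def)
next
  case (insert j A)
  have "has_order (F j ^ e j) (e j * k j)"
    using insert.prems[of j] by (auto simp: has_order_def)
  then show ?case using insert by (simp add: has_order_def)
qed

lemma has_order_unique: "has_order F m \<Longrightarrow> has_order F n \<Longrightarrow> m = n"
  by (simp add: has_order_def)

section \<open>Arcs of given contact orders as a union of capped pieces\<close>

lemma keys_monomial_multiple:
  fixes f :: "('n::finite, 'k::field_char_0) mpoly"
  assumes h: "h = (\<Prod>j\<in>UNIV. mvar j ^ N j) * f" and j: "N j \<noteq> 0" and a: "a \<in> Poly_Mapping.keys h"
  shows "1 \<le> poly_mapping.lookup a j"
proof -
  have "(\<Prod>j\<in>UNIV. mvar j ^ N j :: ('n, 'k) mpoly) = mvar j ^ N j * (\<Prod>i\<in>UNIV - {j}. mvar i ^ N i)"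
    by (rule prod.remove) auto
  also have "mvar j ^ N j = mvar j * (mvar j ^ (N j - 1) :: ('n, 'k) mpoly)"
    using j by (cases "N j") simp_all
  finally have "h = mvar j * (mvar j ^ (N j - 1) * (\<Prod>i\<in>UNIV - {j}. mvar i ^ N i) * f)"
    by (simp add: h mult.assoc)
  then obtain b c where "a = b + c" "b \<in> Poly_Mapping.keys (mvar j :: ('n, 'k) mpoly)"
    using a keys_mult[of "mvar j :: ('n, 'k) mpoly"] by blast
  then show ?thesis by (auto simp: mvar_def lookup_add split: if_splits)
qed

text \<open>The order of omega along arcs of orders k; for \<nu> j \<ge> 1 the truncated subtraction
  is exact.\<close>

definition form_weight :: "('n::finite \<Rightarrow> nat) \<Rightarrow> ('n \<Rightarrow> nat) \<Rightarrow> nat" where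
  "form_weight \<nu> k = (\<Sum>j\<in>UNIV. (\<nu> j - 1) * k j)"

context
  fixes h f :: "('n::finite, 'k::field_char_0) mpoly" and N \<nu> :: "'n \<Rightarrow> nat"
  assumes h: "h \<noteq> 0" and hf: "h = (\<Prod>j\<in>UNIV. mvar j ^ N j) * f"
    and nd: "nondegenerate h" and \<nu>: "\<And>j. 1 \<le> \<nu> j" and N\<nu>: "\<And>j. N j = 0 \<Longrightarrow> \<nu> j = 1"
begin

text \<open>For N_j > 0 every monomial of h contains x_j; but in a non-empty piece a monomial of
  least weight has weight at most n \<le> B and avoids the capped variables.\<close>

lemma capped_form:
  assumes B: "n \<le> B" and j: "j \<in> capped B k" and x: "x \<in> capped_piece h B n k"
  shows "\<nu> j = 1"
proof (rule N\<nu>, rule ccontr)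
  assume Nj: "N j \<noteq> 0"
  obtain a where a: "a \<in> Poly_Mapping.keys h" "weight k a = min_weight h k" using min_weight_attained[OF h] by blast
  have "min_weight h k \<le> n"
    using piece_empty[of n h k "capped B k" "Suc B + n"] x unfolding capped_piece_def by fastforce
  then have "poly_mapping.lookup a j = 0" using lookup_capped[OF a(1) _ j] a(2) B by simp
  then show False using keys_monomial_multiple[OF hf Nj a(1)] by simp
qed

lemma capped_piece_order:
  assumes k: "k \<in> order_box (Suc B)" and j: "j \<notin> capped B k" and x: "arc_trunc (Suc B + n) \<gamma> \<in> capped_piece h B n k"
  shows "has_order (\<gamma> j) (k j)"
proof -
  let ?x = "arc_trunc (Suc B + n) \<gamma>"
  have v: "\<forall>i<k j. ?x (j, i) = 0" and l: "?x (j, k j) \<noteq> 0"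
    using x j by (auto simp: capped_piece_def piece_def lead_in_def vanishing_def punctured_def lead_def)
  have "k j \<le> Suc B" using k by (simp add: order_box_def)
  then have "k j \<le> Suc B + n" by simp
  then show ?thesis using v l by (auto simp: has_order_iff arc_trunc_def)
qed

lemma capped_piece_form:
  assumes B: "n \<le> B" and k: "k \<in> order_box (Suc B)" and x: "arc_trunc (Suc B + n) \<gamma> \<in> capped_piece h B n k"
  shows "has_order (form_arc \<nu> \<gamma>) (form_weight \<nu> k)"
  unfolding form_arc_def form_weight_def
proof (rule has_order_power_prod)
  fix j
  show "\<nu> j - 1 = 0 \<or> has_order (\<gamma> j) (k j)"
    using capped_form[OF B _ x, of j] capped_piece_order[OF k _ x, of j] by (cases "j \<in> capped B k") simp_all
qed simp

lemma capped_piece_comp: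
  "arc_trunc (Suc B + n) \<gamma> \<in> capped_piece h B n k \<Longrightarrow> has_order (comp_arc h \<gamma>) n"
  unfolding capped_piece_def piece_def has_order_iff by (simp add: jet_coeff_arc_trunc)

lemma contact_arcs_eq:
  assumes B: "n \<le> B"
  shows "contact_arcs h \<nu> n m = {\<gamma>. arc_trunc (Suc B + n) \<gamma> \<in> (\<Union>k\<in>{k \<in> order_box (Suc B). form_weight \<nu> k = m}. capped_piece h B n k)}"
proof (intro equalityI subsetI)
  fix \<gamma> assume \<gamma>: "\<gamma> \<in> contact_arcs h \<nu> n m"
  let ?x = "arc_trunc (Suc B + n) \<gamma>"
  \<comment> \<open>A component that vanishes identically has infinite order and falls under the cap
    as well.\<close>
  define k where "k j = (if \<gamma> j = 0 then Suc B else min (subdegree (\<gamma> j)) (Suc B))" for j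
  have pos: "1 \<le> k j" for j
  proof -
    have "fps_nth (\<gamma> j) 0 = 0" using \<gamma> by (simp add: contact_arcs_def)
    then have "\<gamma> j \<noteq> 0 \<Longrightarrow> subdegree (\<gamma> j) \<noteq> 0" by (metis nth_subdegree_nonzero)
    then show ?thesis by (auto simp: k_def)
  qed
  then have kb: "k \<in> order_box (Suc B)" by (auto simp: order_box_def k_def)
  have "vanishing k ?x"
    by (auto simp: vanishing_def arc_trunc_def k_def split: if_splits intro: nth_less_subdegree_zero)
  moreover have "lead k ?x \<in> punctured (capped B k)"
  proof -
    have "?x (j, k j) \<noteq> 0" if "k j \<noteq> Suc B" for j
    proof -
      have "\<gamma> j \<noteq> 0" "k j = subdegree (\<gamma> j)" "k j \<le> Suc B" using that by (auto simp: k_def split: if_splits)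
      then show ?thesis by (auto simp: arc_trunc_def)
    qed
    then show ?thesis by (simp add: punctured_def capped_def lead_def)
  qed
  moreover have "has_order (comp_arc h \<gamma>) n" using \<gamma> by (simp add: contact_arcs_def)
  ultimately have x: "?x \<in> capped_piece h B n k"
    unfolding capped_piece_def piece_def lead_in_def has_order_iff by (simp add: jet_coeff_arc_trunc arc_trunc_aff)
  have "has_order (form_arc \<nu> \<gamma>) m" using \<gamma> by (simp add: contact_arcs_def)
  then have "form_weight \<nu> k = m" using capped_piece_form[OF B kb x] has_order_unique by blast
  then show "\<gamma> \<in> {\<gamma>. arc_trunc (Suc B + n) \<gamma> \<in> (\<Union>k\<in>{k \<in> order_box (Suc B). form_weight \<nu> k = m}. capped_piece h B n k)}"
    using kb x by (intro CollectI UN_I[of k]) simp_all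
next
  fix \<gamma> assume "\<gamma> \<in> {\<gamma>. arc_trunc (Suc B + n) \<gamma> \<in> (\<Union>k\<in>{k \<in> order_box (Suc B). form_weight \<nu> k = m}. capped_piece h B n k)}"
  then obtain k where k: "k \<in> order_box (Suc B)" "form_weight \<nu> k = m" "arc_trunc (Suc B + n) \<gamma> \<in> capped_piece h B n k"
    by auto
  have "fps_nth (\<gamma> j) 0 = 0" for j
  proof -
    have "0 < k j" using k(1) by (auto simp: order_box_def Suc_le_eq)
    then have "arc_trunc (Suc B + n) \<gamma> (j, 0) = 0"
      using k(3) by (auto simp: capped_piece_def piece_def lead_in_def vanishing_def)
    then show ?thesis by (simp add: arc_trunc_def)
  qed
  then show "\<gamma> \<in> contact_arcs h \<nu> n m"
    using capped_piece_comp[OF k(3)] capped_piece_form[OF B k(1,3)] k(2) by (simp add: contact_arcs_def)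
qed

text \<open>Where \<open>k j < k' j\<close>, the order \<open>k j\<close> is not capped, so the
  coefficient at \<open>k j\<close> is non-zero on one piece and zero on the other.\<close>

lemma disjoint_capped_pieces: "disjoint_family_on (capped_piece h B n) (order_box (Suc B))"
proof -
  have le: "k' j \<le> k j" if k: "k' \<in> order_box (Suc B)" and x: "x \<in> capped_piece h B n k" "x \<in> capped_piece h B n k'" for k k' x j
  proof (rule ccontr)
    assume "\<not> k' j \<le> k j"
    then have lt: "k j < k' j" by simp
    then have "j \<notin> capped B k" using k by (auto simp: order_box_def capped_def dest!: spec[of _ j])
    then have "x (j, k j) \<noteq> 0" using x(1) by (auto simp: capped_piece_def piece_def lead_in_def punctured_def lead_def)
    then show False using x(2) lt by (auto simp: capped_piece_def piece_def lead_in_def vanishing_def)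
  qed
  have "k = k'" if "k \<in> order_box (Suc B)" "k' \<in> order_box (Suc B)" "x \<in> capped_piece h B n k" "x \<in> capped_piece h B n k'" for k k' x
    by (rule ext, rule antisym) (use le that in blast)+
  then show ?thesis unfolding disjoint_family_on_def by blast
qed

lemma motivic_measure_contact:
  assumes B: "n \<le> B"
  shows "motivic_measure (contact_arcs h \<nu> n m) = (\<Sum>k\<in>{k \<in> order_box (Suc B). form_weight \<nu> k = m}. piece_measure h B n k)"
proof -
  let ?K = "{k \<in> order_box (Suc B). form_weight \<nu> k = m}"
  have "motivic_measure (contact_arcs h \<nu> n m) = Mk_of_K0 (\<Sum>k\<in>?K. cls (capped_piece h B n k)) * Mk_Linv ^ ((Suc B + n + 1) * CARD('n))"
  proof (rule motivic_measure_eq[OF _ _ _ _ contact_arcs_eq[OF B]])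
    show "finite ?K" by (rule finite_subset[OF _ finite_order_box[of "Suc B"]]) auto
    show "disjoint_family_on (capped_piece h B n) ?K"
      using disjoint_capped_pieces by (rule disjoint_family_on_mono[rotated]) auto
    show "loc_closed (capped_piece h B n k)" for k unfolding capped_piece_def by (rule loc_closed_piece)
    show "capped_piece h B n k \<subseteq> aff_points (jet_coords (Suc B + n))" for k
      unfolding capped_piece_def piece_def using lead_in_aff by blast
  qed
  also have "\<dots> = (\<Sum>k\<in>?K. piece_measure h B n k)"
    unfolding Mk_of_K0_sum sum_distrib_right
    by (rule sum.cong[OF refl], rule mcls_capped_piece[OF h nd B]) simp
  finally show ?thesis .
qed

end

section \<open>Limits in the completed ring\<close>

lemma Mhat_of_Mk_hom:
  "Mhat_of_Mk 0 = 0" "Mhat_of_Mk 1 = 1" "Mhat_of_Mk (a + b) = Mhat_of_Mk a + Mhat_of_Mk b"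
  "Mhat_of_Mk (- a) = - Mhat_of_Mk a" "Mhat_of_Mk (a * b) = Mhat_of_Mk a * Mhat_of_Mk b"
  by (simp_all add: Mhat_of_Mk.abs_eq zero_Mhat_def one_Mhat_def plus_Mhat.abs_eq uminus_Mhat.abs_eq
      times_Mhat.abs_eq Mhat_eq_refl Mk_cauchy_const)

lemma Mhat_of_Mk_diff: "Mhat_of_Mk (a - b) = Mhat_of_Mk a - Mhat_of_Mk b"
  by (metis Mhat_of_Mk_hom(3,4) diff_conv_add_uminus)

lemma Mhat_of_Mk_power: "Mhat_of_Mk (a ^ n) = Mhat_of_Mk a ^ n"
  by (induction n) (simp_all add: Mhat_of_Mk_hom)

lemma Mhat_of_Mk_sum: "Mhat_of_Mk (\<Sum>a\<in>A. f a) = (\<Sum>a\<in>A. Mhat_of_Mk (f a))"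
  by (induction A rule: infinite_finite_induct) (simp_all add: Mhat_of_Mk_hom)

lemma Linv_power: "Linv ^ n = Mhat_of_Mk (Mk_Linv ^ n)"
  by (simp add: Linv_def Mhat_of_Mk_power)

text \<open>L^-n is the class of the point times L^-n, and the point has dimension 0: in a one-point
  space the point is the only irreducible closed set.\<close>

lemma Mk_fil_Linv_power: "Mk_fil (int n) (Mk_Linv ^ n :: 'k::field_char_0 Mk)"
proof -
  let ?P = "{\<lambda>_. 0} :: (nat \<Rightarrow> 'k alg_closure) set"
  have "?P = aff_points {}" by (auto simp: aff_points_def)
  then have P: "loc_closed ?P" "?P \<subseteq> aff_points {..<0}" by (simp_all add: loc_closed_aff_points)
  let ?T = "ztop (qspace ?P)"
  have irr: "Z = ?P" if "irreducible_closedin ?T Z" for Z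
  proof -
    have "Z \<subseteq> ?P" "Z \<noteq> {}" using that closedin_subset[of ?T Z] by (auto simp: irreducible_closedin_def)
    then show ?thesis by blast
  qed
  have "\<exists>Z. (\<forall>i\<le>0. irreducible_closedin ?T (Z i)) \<and> (\<forall>i<0. Z i \<subset> Z (Suc i))"
    using closedin_topspace[of ?T] by (intro exI[of _ "\<lambda>_. ?P"]) (auto simp: irreducible_closedin_def)
  moreover have "l = 0" if "\<forall>i\<le>l. irreducible_closedin ?T (Z i)" "\<forall>i<l. Z i \<subset> Z (Suc i)" for l :: nat and Z
  proof (rule ccontr)
    assume "l \<noteq> 0"
    then have "Z 0 \<subset> Z (Suc 0)" "Z 0 = ?P" "Z (Suc 0) = ?P" using that irr by auto
    then show False by simp
  qed
  ultimately have "{l. \<exists>Z. (\<forall>i\<le>l. irreducible_closedin ?T (Z i)) \<and> (\<forall>i<l. Z i \<subset> Z (Suc i))} = {0 :: nat}"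
    by (intro equalityI subsetI insertI1 singletonI) (elim CollectE exE conjE, simp, simp)
  then have "var_dim (nat_model ?P) = 0"
    unfolding var_dim_def Rep_nat_model[OF P] krull_dim_def by simp
  then have "Mk_fil (int n) (Mk_of_K0 (abs_K0 (mvar (nat_model ?P))) * Mk_Linv ^ n)"
    by (intro Mk_fil.gen) simp
  moreover have "abs_K0 (mvar (nat_model ?P)) = 1"
    using cls_nat_model[OF P] cls_point by metis
  ultimately show ?thesis by (simp add: Mk_of_K0_hom)
qed

lemma Mk_fil_sum: "(\<And>a. a \<in> A \<Longrightarrow> Mk_fil N (f a)) \<Longrightarrow> Mk_fil N (\<Sum>a\<in>A. f a)"
  by (induction A rule: infinite_finite_induct) (auto intro: Mk_fil.zero Mk_fil.add)

lemma Mk_fil_bounded_finite: "finite A \<Longrightarrow> \<exists>c. \<forall>a\<in>A. Mk_fil c (f a)"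
proof (induction A rule: finite_induct)
  case (insert a A)
  then obtain c where c: "\<forall>a\<in>A. Mk_fil c (f a)" by blast
  obtain d where d: "Mk_fil d (f a)" using Mk_fil_bounded by blast
  have "\<forall>b\<in>insert a A. Mk_fil (min c d) (f b)"
    using c Mk_fil_mono[OF d, of "min c d"] Mk_fil_mono[of c _ "min c d"] by auto
  then show ?case ..
qed simp

lemma Mhat_fil_Mk: "Mk_fil N a \<Longrightarrow> Mhat_fil N (Mhat_of_Mk a)"
  unfolding Mhat_fil_def
  by (intro exI[of _ "\<lambda>_. a"]) (simp add: Mhat_of_Mk.abs_eq Mk_cauchy_const)

lemma Mhat_fil_sum: "(\<And>a. a \<in> A \<Longrightarrow> Mhat_fil N (f a)) \<Longrightarrow> Mhat_fil N (\<Sum>a\<in>A. f a)"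
  by (induction A rule: infinite_finite_induct) (auto intro: Mhat_fil_zero Mhat_fil_add)

lemma Mhat_fil_mult_Mk:
  assumes a: "Mk_fil c a" and y: "Mhat_fil N y" shows "Mhat_fil (c + N) (Mhat_of_Mk a * y)"
proof -
  obtain s where s: "Mk_cauchy s" "y = abs_Mhat s" "\<forall>i. Mk_fil N (s i)" using y unfolding Mhat_fil_def by blast
  have "Mhat_of_Mk a * y = abs_Mhat (\<lambda>i. a * s i)"
    by (simp add: s(2) Mhat_of_Mk.abs_eq times_Mhat.abs_eq Mhat_eq_refl Mk_cauchy_const s(1))
  then show ?thesis
    unfolding Mhat_fil_def using Mk_cauchy_mult[OF Mk_cauchy_const s(1)] s(3) Mk_fil.mult[OF a]
    by (intro exI[of _ "\<lambda>i. a * s i"]) simp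
qed

text \<open>Passing to a shifted sequence does not change the class, so membership in the filtration
  step is required only from some index on.\<close>

lemma Mhat_fil_abs:
  assumes s: "Mk_cauchy s" and fil: "\<And>i. i \<ge> i0 \<Longrightarrow> Mk_fil N (s i)"
  shows "Mhat_fil N (abs_Mhat s)"
proof -
  let ?t = "\<lambda>i. s (i + i0)"
  have t: "Mk_cauchy ?t"
    unfolding Mk_cauchy_def
  proof
    fix K
    obtain n0 where "\<forall>i\<ge>n0. \<forall>j\<ge>n0. Mk_fil K (s i - s j)" using s unfolding Mk_cauchy_def by blast
    then show "\<exists>n0. \<forall>i\<ge>n0. \<forall>j\<ge>n0. Mk_fil K (?t i - ?t j)" by (intro exI[of _ n0]) simp
  qed
  have "Mk_null (\<lambda>i. s i - ?t i)"
    unfolding Mk_null_def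
  proof
    fix K
    obtain n0 where "\<forall>i\<ge>n0. \<forall>j\<ge>n0. Mk_fil K (s i - s j)" using s unfolding Mk_cauchy_def by blast
    then show "\<exists>n0. \<forall>i\<ge>n0. Mk_fil K (s i - ?t i)" by (intro exI[of _ n0]) simp
  qed
  then have "Mhat_eq s ?t" using s t by (simp add: Mhat_eq_def)
  then have "abs_Mhat s = abs_Mhat ?t" by (rule Quotient_rel_abs[OF Quotient_Mhat])
  then show ?thesis unfolding Mhat_fil_def using t fil by (intro exI[of _ ?t]) simp
qed

text \<open>Convergence tested on the closures of the filtration steps, which form a neighbourhood
  basis of 0.\<close>

definition Mhat_lim :: "(nat \<Rightarrow> 'k::field_char_0 Mhat) \<Rightarrow> 'k Mhat \<Rightarrow> bool" where
  "Mhat_lim s x \<longleftrightarrow> (\<forall>N. \<exists>b0. \<forall>b\<ge>b0. Mhat_fil N (s b - x))"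

lemma Mhat_lim_unique:
  assumes "Mhat_lim s x" "Mhat_lim s y" shows "x = y"
proof -
  have "Mhat_fil N (x - y)" for N
  proof -
    obtain b0 b1 where b: "\<forall>b\<ge>b0. Mhat_fil N (s b - x)" "\<forall>b\<ge>b1. Mhat_fil N (s b - y)"
      using assms unfolding Mhat_lim_def by blast
    have "Mhat_fil N (s (max b0 b1) - y)" using b(2) by simp
    moreover have "Mhat_fil N (- (s (max b0 b1) - x))" by (rule Mhat_fil_uminus) (use b(1) in simp)
    ultimately have "Mhat_fil N (s (max b0 b1) - y + - (s (max b0 b1) - x))" by (rule Mhat_fil_add)
    then show ?thesis by simp
  qed
  then have "x - y = 0" by (rule Mhat_fil_separated)
  then show ?thesis by simp
qed

lemma Mhat_lim_0: "Mhat_lim (\<lambda>_. 0) 0"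
  by (simp add: Mhat_lim_def Mhat_fil_zero)

lemma Mhat_lim_add:
  assumes "Mhat_lim s x" "Mhat_lim t y" shows "Mhat_lim (\<lambda>b. s b + t b) (x + y)"
  unfolding Mhat_lim_def
proof
  fix N
  obtain b0 b1 where b: "\<forall>b\<ge>b0. Mhat_fil N (s b - x)" "\<forall>b\<ge>b1. Mhat_fil N (t b - y)"
    using assms unfolding Mhat_lim_def by blast
  have "Mhat_fil N (s b + t b - (x + y))" if "b \<ge> max b0 b1" for b
    using Mhat_fil_add[of N "s b - x" "t b - y"] b that by (simp add: add_diff_add)
  then show "\<exists>b0. \<forall>b\<ge>b0. Mhat_fil N (s b + t b - (x + y))" by blast
qed

lemma Mhat_lim_sum: "(\<And>a. a \<in> A \<Longrightarrow> Mhat_lim (s a) (x a)) \<Longrightarrow> Mhat_lim (\<lambda>b. \<Sum>a\<in>A. s a b) (\<Sum>a\<in>A. x a)"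
  by (induction A rule: infinite_finite_induct) (auto intro: Mhat_lim_0 Mhat_lim_add)

lemma Mhat_lim_mult_Mk:
  assumes "Mhat_lim s x" shows "Mhat_lim (\<lambda>b. Mhat_of_Mk a * s b) (Mhat_of_Mk a * x)"
  unfolding Mhat_lim_def
proof
  fix N
  obtain c where c: "Mk_fil c a" using Mk_fil_bounded by blast
  obtain b0 where b0: "\<forall>b\<ge>b0. Mhat_fil (N - c) (s b - x)" using assms unfolding Mhat_lim_def by blast
  have "Mhat_fil N (Mhat_of_Mk a * s b - Mhat_of_Mk a * x)" if "b \<ge> b0" for b
    using Mhat_fil_mult_Mk[OF c, of "N - c" "s b - x"] b0 that by (simp add: right_diff_distrib)
  then show "\<exists>b0. \<forall>b\<ge>b0. Mhat_fil N (Mhat_of_Mk a * s b - Mhat_of_Mk a * x)" by blast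
qed

text \<open>Outside \<open>order_box b\<close> some k_j, and with it \<sigma> k, exceeds b, so
  finite partial sums there lie in step b of the filtration. Hence the box sums are Cauchy and their
  class is the unordered sum; without such summability \<open>infsum\<close> would be its default
  value 0.\<close>

lemma Linv_series:
  fixes A :: "('n::finite \<Rightarrow> nat) set" and \<sigma> :: "('n \<Rightarrow> nat) \<Rightarrow> nat"
  assumes A: "\<And>k j. k \<in> A \<Longrightarrow> 1 \<le> k j" and \<sigma>: "\<And>k j. k \<in> A \<Longrightarrow> k j \<le> \<sigma> k"
  shows "Mhat_lim (\<lambda>b. \<Sum>k\<in>A \<inter> order_box b. Linv ^ \<sigma> k) (\<Sum>\<^sub>\<infinity>k\<in>A. Linv ^ \<sigma> k :: 'k::field_char_0 Mhat)"
proof -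
  define s where "s b = (\<Sum>k\<in>A \<inter> order_box b. Mk_Linv ^ \<sigma> k :: 'k Mk)" for b
  have tail: "Mk_fil (int b) (\<Sum>k\<in>F. Mk_Linv ^ \<sigma> k :: 'k Mk)" if "F \<subseteq> A" "F \<inter> order_box b = {}" for F b
  proof (rule Mk_fil_sum)
    fix k assume k: "k \<in> F"
    then have "k \<notin> order_box b" using that by blast
    moreover have "\<forall>j. 1 \<le> k j" using A k that(1) by blast
    ultimately obtain j where "\<not> k j \<le> b" unfolding order_box_def by blast
    then have "b \<le> \<sigma> k" using \<sigma>[of k j] k that(1) by force
    then show "Mk_fil (int b) (Mk_Linv ^ \<sigma> k :: 'k Mk)" by (intro Mk_fil_mono[OF Mk_fil_Linv_power]) simp
  qed
  have mono: "order_box b \<subseteq> order_box c" if "b \<le> c" for b c :: nat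
    using that by (auto simp: order_box_def intro: le_trans)
  have split: "(\<Sum>k\<in>F. Mk_Linv ^ \<sigma> k :: 'k Mk) - s b = (\<Sum>k\<in>F - order_box b. Mk_Linv ^ \<sigma> k)"
    if "finite F" "A \<inter> order_box b \<subseteq> F" "F \<subseteq> A" for F b
  proof -
    have "F - A \<inter> order_box b = F - order_box b" using that by blast
    then show ?thesis using sum.subset_diff[OF that(2,1), of "\<lambda>k. Mk_Linv ^ \<sigma> k :: 'k Mk"] by (simp add: s_def)
  qed
  have diff: "Mk_fil (int b) (s c - s b)" if "b \<le> c" for b c
  proof -
    have "s c - s b = (\<Sum>k\<in>A \<inter> order_box c - order_box b. Mk_Linv ^ \<sigma> k)"
      unfolding s_def[of c] by (rule split) (use mono[OF that] finite_order_box in auto)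
    also have "Mk_fil (int b) \<dots>" by (rule tail) auto
    finally show ?thesis .
  qed
  have cauchy: "Mk_cauchy s"
    unfolding Mk_cauchy_def
  proof
    fix N :: int
    have "Mk_fil N (s i - s j)" if "nat N \<le> i" "nat N \<le> j" for i j
    proof -
      have "Mk_fil (int (nat N)) ((s i - s (nat N)) - (s j - s (nat N)))"
        by (intro Mk_fil_diff diff that)
      then show ?thesis by (auto intro: Mk_fil_mono)
    qed
    then show "\<exists>n0. \<forall>i\<ge>n0. \<forall>j\<ge>n0. Mk_fil N (s i - s j)" by blast
  qed
  define x where "x = abs_Mhat s"
  have close: "Mhat_fil (int b) (Mhat_of_Mk (s b) - x)" for b
  proof -
    have "x - Mhat_of_Mk (s b) = abs_Mhat (\<lambda>i. s i + - s b)"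
      by (simp add: x_def Mhat_of_Mk.abs_eq diff_conv_add_uminus[of "abs_Mhat s"] uminus_Mhat.abs_eq plus_Mhat.abs_eq
          Mhat_eq_refl Mk_cauchy_const cauchy del: add_uminus_conv_diff)
    also have "Mhat_fil (int b) \<dots>"
    proof (rule Mhat_fil_abs)
      show "Mk_cauchy (\<lambda>i. s i + - s b)" by (intro Mk_cauchy_add cauchy Mk_cauchy_const)
      show "Mk_fil (int b) (s i + - s b)" if "b \<le> i" for i using diff[OF that] by simp
    qed
    finally have "Mhat_fil (int b) (- (x - Mhat_of_Mk (s b)))" by (rule Mhat_fil_uminus)
    then show ?thesis by simp
  qed
  have "((\<lambda>k. Linv ^ \<sigma> k) has_sum x) A"
    unfolding has_sum_def tendsto_def
  proof (intro allI impI)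
    fix U :: "'k Mhat set" assume "open U" "x \<in> U"
    then obtain N where N: "\<And>y. Mhat_fil N (y - x) \<Longrightarrow> y \<in> U" unfolding open_Mhat_def by blast
    let ?b = "nat N"
    have "(\<Sum>k\<in>Y. Linv ^ \<sigma> k) \<in> U" if Y: "finite Y" "A \<inter> order_box ?b \<subseteq> Y" "Y \<subseteq> A" for Y
    proof (rule N)
      have "(\<Sum>k\<in>Y. Linv ^ \<sigma> k) = Mhat_of_Mk (\<Sum>k\<in>Y. Mk_Linv ^ \<sigma> k :: 'k Mk)"
        by (simp add: Linv_power Mhat_of_Mk_sum)
      then have eq: "(\<Sum>k\<in>Y. Linv ^ \<sigma> k) - x = Mhat_of_Mk ((\<Sum>k\<in>Y. Mk_Linv ^ \<sigma> k) - s ?b) + (Mhat_of_Mk (s ?b) - x)"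
        by (simp add: Mhat_of_Mk_diff)
      have "Mk_fil (int ?b) ((\<Sum>k\<in>Y. Mk_Linv ^ \<sigma> k) - s ?b)"
        unfolding split[OF Y] by (rule tail) (use Y in auto)
      then have "Mhat_fil (int ?b) ((\<Sum>k\<in>Y. Linv ^ \<sigma> k) - x)"
        unfolding eq by (intro Mhat_fil_add Mhat_fil_Mk close)
      then show "Mhat_fil N ((\<Sum>k\<in>Y. Linv ^ \<sigma> k) - x)" by (rule Mhat_fil_mono) simp
    qed
    then show "\<forall>\<^sub>F F in finite_subsets_at_top A. sum (\<lambda>k. Linv ^ \<sigma> k) F \<in> U"
      unfolding eventually_finite_subsets_at_top
      using finite_order_box by (intro exI[of _ "A \<inter> order_box ?b"]) auto
  qed
  then have "(\<Sum>\<^sub>\<infinity>k\<in>A. Linv ^ \<sigma> k) = x" by (rule infsumI)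
  moreover have "(\<Sum>k\<in>A \<inter> order_box b. Linv ^ \<sigma> k) = Mhat_of_Mk (s b)" for b
    by (simp add: s_def Linv_power Mhat_of_Mk_sum)
  moreover have "Mhat_lim (\<lambda>b. Mhat_of_Mk (s b)) x"
    unfolding Mhat_lim_def
  proof
    fix N
    have "Mhat_fil N (Mhat_of_Mk (s b) - x)" if "nat N \<le> b" for b
      by (rule Mhat_fil_mono[OF close]) (use that in linarith)
    then show "\<exists>b0. \<forall>b\<ge>b0. Mhat_fil N (Mhat_of_Mk (s b) - x)" by blast
  qed
  ultimately show ?thesis by simp
qed

section \<open>Comparison of the coefficients\<close>

text \<open>Removing from a cylinder its slice \<open>x p = 0\<close> leaves L - 1 times the class
  of the slice.\<close>

lemma cls_punctured_axes:
  assumes "finite A"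
  shows "mcls {x \<in> aff_points A. \<forall>j\<in>A. x j \<noteq> 0} = (Mk_of_K0 K0_L - 1 :: 'k::field_char_0 Mk) ^ card A"
  using assms
proof (induction A)
  case empty
  have "{x \<in> aff_points {}. \<forall>j\<in>{}. x j \<noteq> 0} = {\<lambda>_ :: 'a. 0 :: 'k alg_closure}" by (auto simp: aff_points_def)
  then show ?case by (simp only: cls_point Mk_of_K0_hom card.empty power_0)
next
  case (insert p A)
  let ?X = "{x \<in> aff_points A. \<forall>j\<in>A. x j \<noteq> 0} :: ('a \<Rightarrow> 'k alg_closure) set"
  let ?Y = "{x \<in> aff_points (insert p A). \<forall>j\<in>A. x j \<noteq> 0} :: ('a \<Rightarrow> 'k alg_closure) set"
  have "?Y = aff_points (insert p A) \<inter> (\<Inter>j\<in>A. {x. x j \<noteq> 0})" by auto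
  also have "loc_closed \<dots>"
    by (intro loc_closed_Int loc_closed_aff_points loc_closed_INT[OF insert.hyps(1)] loc_closed_neq0[OF PF_var])
  finally have lY: "loc_closed ?Y" .
  have aY: "?Y \<subseteq> aff_points (insert p A)" by auto
  have fin: "finite (insert p A)" using insert.hyps(1) by simp
  have "cls ?Y = cls {x \<in> ?Y. x p = 0} * K0_L"
    by (rule cls_cylinder[OF lY aY fin]) (use insert.hyps in \<open>auto simp: aff_points_def\<close>)
  also have "{x \<in> ?Y. x p = 0} = ?X" using insert.hyps(2) by (auto simp: aff_points_def)
  finally have Y: "mcls ?Y = mcls ?X * Mk_of_K0 K0_L" by (simp add: Mk_of_K0_hom)
  have "mcls (?Y \<inter> {x. x p \<noteq> 0}) = mcls ?Y - mcls (?Y \<inter> {x. x p = 0})"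
    by (rule mcls_scissor[OF quasi_affineI[OF lY fin aY] PF_var])
  also have "?Y \<inter> {x. x p = 0} = ?X" using insert.hyps(2) by (auto simp: aff_points_def)
  also have "?Y \<inter> {x. x p \<noteq> 0} = {x \<in> aff_points (insert p A). \<forall>j\<in>insert p A. x j \<noteq> 0}" by auto
  finally have "mcls {x \<in> aff_points (insert p A). \<forall>j\<in>insert p A. x j \<noteq> 0} = mcls ?X * (Mk_of_K0 K0_L - 1)"
    by (simp only: Y right_diff_distrib mult_1_right)
  also have "\<dots> = (Mk_of_K0 K0_L - 1) ^ card (insert p A)"
    unfolding insert.IH card_insert_disjoint[OF insert.hyps] power_Suc by (rule mult.commute)
  finally show ?case .
qed

lemma mcls_torus: "mcls (punctured {} :: ('n::finite \<Rightarrow> 'k::field_char_0 alg_closure) set) = (Mk_of_K0 K0_L - 1) ^ CARD('n)"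
proof -
  have "(punctured {} :: ('n \<Rightarrow> 'k alg_closure) set) = {x \<in> aff_points UNIV. \<forall>j\<in>UNIV. x j \<noteq> 0}"
    by (auto simp: punctured_def aff_points_def)
  then show ?thesis by (simp only: cls_punctured_axes[OF finite])
qed

lemma N_class_eq: "N_class h \<tau> = Mhat_of_Mk (mcls (face_zeros h \<tau> {}))"
proof -
  have "{x \<in> torus. mp_eval to_ac (face_poly h \<tau>) x = 0} = face_zeros h \<tau> {}"
    by (auto simp: torus_def face_zeros_def punctured_def)
  moreover have "fsub (aff_space UNIV) (face_zeros h \<tau> {}) = qspace (face_zeros h \<tau> {})"
    by (rule fsub_aff_space) (simp add: aff_points_def)
  ultimately show ?thesis by (simp add: N_class_def mclass_def)
qed

lemma L_series_nth:
  fixes h :: "('n::finite, 'k::field_char_0) mpoly"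
  shows "fps_nth (L_series h \<tau>) i = Mhat_of_Mk (piece_coeff h \<tau> {} i)"
proof -
  have LL1: "LL - 1 = Mhat_of_Mk (Mk_of_K0 K0_L - 1)"
    by (simp add: LL_def Mhat_of_Mk_diff Mhat_of_Mk_hom)
  show ?thesis
  proof (cases i)
    case 0
    then show ?thesis
      by (simp add: L_series_def piece_coeff_def mcls_torus N_class_eq LL1 Linv_power
          Mhat_of_Mk_hom Mhat_of_Mk_diff Mhat_of_Mk_power fps_mult_nth_0)
  next
    case (Suc l)
    have X: "fps_nth (fps_const Linv * fps_X) j = (if j = 1 then Linv else 0 :: 'k Mhat)" for j
      by (simp add: fps_mult_left_const_nth)
    \<comment> \<open>In the convolution only the coefficient of T in the first factor is
      non-zero.\<close>
    have "fps_nth ((fps_const Linv * fps_X) * geom_fps Linv) (Suc l)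
        = (\<Sum>j\<in>{1}. fps_nth (fps_const Linv * fps_X) j * (Linv :: 'k Mhat) ^ (Suc l - j))"
      unfolding fps_mult_nth[of "fps_const Linv * fps_X"] geom_fps_def fps_nth_Abs_fps
      by (rule sum.mono_neutral_right) (auto simp: X)
    then have "fps_nth ((fps_const Linv * fps_X) * geom_fps Linv) (Suc l) = (Linv :: 'k Mhat) ^ Suc l"
      by (simp add: X)
    then have "fps_nth (L_series h \<tau>) (Suc l) = Linv ^ CARD('n) * (LL - 1) * N_class h \<tau> * Linv ^ Suc l"
      unfolding L_series_def by (simp only: fps_add_nth fps_mult_left_const_nth) simp
    also have "\<dots> = Mhat_of_Mk (piece_coeff h \<tau> {} (Suc l))"
      by (simp only: piece_coeff_def N_class_eq LL1 Linv_power Mhat_of_Mk_hom mult.assoc nat.distinct if_False)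
    finally show ?thesis using Suc by simp
  qed
qed

lemma piece_measure_uncapped:
  assumes "k \<in> order_box B"
  shows "piece_measure h B n k = (if min_weight h k \<le> n
     then Mk_Linv ^ (\<Sum>j\<in>UNIV. k j) * piece_coeff h (face_at h k) {} (n - min_weight h k) else 0)"
proof -
  have "k j \<noteq> Suc B" for j using assms by (auto simp: order_box_def dest!: spec[of _ j])
  then have "capped B k = {}" by (simp add: capped_def)
  then show ?thesis by (simp add: piece_measure_def)
qed

section \<open>Box sums and their limit\<close>

context
  fixes h f :: "('n::finite, 'k::field_char_0) mpoly" and N \<nu> :: "'n \<Rightarrow> nat"
  assumes h: "h \<noteq> 0" and hf: "h = (\<Prod>j\<in>UNIV. mvar j ^ N j) * f"
    and nd: "nondegenerate h" and \<nu>: "\<And>j. 1 \<le> \<nu> j" and N\<nu>: "\<And>j. N j = 0 \<Longrightarrow> \<nu> j = 1"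
begin

private abbreviation "\<sigma> k \<equiv> \<Sum>j\<in>UNIV. \<nu> j * k j"
private abbreviation "fw \<equiv> form_weight \<nu>"

text \<open>A finite box of capped orders admits only finitely many orders m of omega, so the sum
  over m is finite and regroups into a sum over the box.\<close>

lemma Z_DL_nth:
  assumes B: "n \<le> B"
  shows "fps_nth (Z_DL h \<nu>) n = (\<Sum>k\<in>order_box (Suc B). Mhat_of_Mk (Mk_Linv ^ fw k * piece_measure h B n k))"
proof -
  let ?K = "order_box (Suc B) :: ('n \<Rightarrow> nat) set"
  let ?g = "\<lambda>k. Mhat_of_Mk (Mk_Linv ^ fw k * piece_measure h B n k)"
  let ?F = "\<lambda>m. Linv ^ m * Mhat_of_Mk (motivic_measure (contact_arcs h \<nu> n m))"
  have F: "?F m = (\<Sum>k\<in>{k \<in> ?K. fw k = m}. ?g k)" for m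
  proof -
    have "?F m = Mhat_of_Mk (\<Sum>k\<in>{k \<in> ?K. fw k = m}. Mk_Linv ^ m * piece_measure h B n k)"
      by (simp only: motivic_measure_contact[OF h hf nd \<nu> N\<nu> B] Linv_power Mhat_of_Mk_hom(5)[symmetric] sum_distrib_left)
    also have "\<dots> = Mhat_of_Mk (\<Sum>k\<in>{k \<in> ?K. fw k = m}. Mk_Linv ^ fw k * piece_measure h B n k)"
      by (rule arg_cong[where f = Mhat_of_Mk], rule sum.cong) auto
    finally show ?thesis by (simp only: Mhat_of_Mk_sum)
  qed
  have "fps_nth (Z_DL h \<nu>) n = infsum ?F UNIV" by (simp add: Z_DL_def)
  also have "\<dots> = infsum ?F (fw ` ?K)"
  proof (rule infsum_cong_neutral)
    fix m assume "m \<in> UNIV - fw ` ?K"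
    then have "{k \<in> ?K. fw k = m} = {}" by auto
    then show "?F m = 0" unfolding F by (simp only: sum.empty)
  qed auto
  also have "\<dots> = sum ?F (fw ` ?K)" by (rule infsum_finite) (simp add: finite_order_box)
  also have "\<dots> = (\<Sum>m\<in>fw ` ?K. \<Sum>k\<in>{k \<in> ?K. fw k = m}. ?g k)" by (simp only: F)
  also have "\<dots> = sum ?g ?K" by (rule sum.group) (simp_all add: finite_order_box)
  finally show ?thesis .
qed

lemma sigma_eq: "\<sigma> k = fw k + (\<Sum>j\<in>UNIV. k j)"
proof -
  have "(\<nu> j - 1) * k j + k j = \<nu> j * k j" for j using \<nu>[of j] by (cases "\<nu> j") simp_all
  then show ?thesis by (simp only: form_weight_def sum.distrib[symmetric])
qed

lemma sigma_ge: "k j \<le> \<sigma> k"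
proof -
  have "k j \<le> \<nu> j * k j" using \<nu>[of j] by (cases "\<nu> j") simp_all
  also have "\<dots> \<le> \<sigma> k" by (rule member_le_sum) auto
  finally show ?thesis .
qed

text \<open>The index set of the coefficient of T^q in \<open>S_series\<close>, expressed through
  natural numbers.\<close>

definition cone_points :: "(real ^ 'n) set \<Rightarrow> nat \<Rightarrow> ('n \<Rightarrow> nat) set" where
  "cone_points \<tau> q = {k. (\<forall>j. 1 \<le> k j) \<and> face_at h k = \<tau> \<and> min_weight h k = q}"

lemma S_series_lim:
  "Mhat_lim (\<lambda>b. \<Sum>k\<in>cone_points \<tau> q \<inter> order_box b. Linv ^ \<sigma> k) (fps_nth (S_series h \<nu> \<tau>) q)"
proof -
  have "{k. (\<forall>i. 0 < k i) \<and> nat_vec k \<in> dual_cone h \<tau> \<and> newton_min h (nat_vec k) = real q} = cone_points \<tau> q"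
    by (auto simp: cone_points_def dual_cone_def nat_vec_def[of "_ :: 'n \<Rightarrow> nat", THEN arg_cong[where f = "\<lambda>v. vec_nth v _"]]
        newton_min_nat_vec[OF h] Suc_le_eq)
  then have "fps_nth (S_series h \<nu> \<tau>) q = (\<Sum>\<^sub>\<infinity>k\<in>cone_points \<tau> q. Linv ^ \<sigma> k)"
    by (simp add: S_series_def)
  moreover have "Mhat_lim (\<lambda>b. \<Sum>k\<in>cone_points \<tau> q \<inter> order_box b. Linv ^ \<sigma> k) (\<Sum>\<^sub>\<infinity>k\<in>cone_points \<tau> q. Linv ^ \<sigma> k)"
    by (rule Linv_series[OF _ sigma_ge]) (simp add: cone_points_def)
  ultimately show ?thesis by simp
qed

text \<open>The coefficient of T^n on the right side of the theorem, with every cone restricted to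
  orders at most b.\<close>

definition box_sum :: "nat \<Rightarrow> nat \<Rightarrow> 'k Mhat" where
  "box_sum n b = (\<Sum>\<tau>\<in>compact_faces h. \<Sum>i=0..n. Mhat_of_Mk (piece_coeff h \<tau> {} i) *
     (\<Sum>k\<in>cone_points \<tau> (n - i) \<inter> order_box b. Linv ^ \<sigma> k))"

lemma box_sum_lim: "Mhat_lim (box_sum n) (fps_nth (\<Sum>\<tau>\<in>compact_faces h. L_series h \<tau> * S_series h \<nu> \<tau>) n)"
  unfolding box_sum_def fps_sum_nth fps_mult_nth L_series_nth
  by (intro Mhat_lim_sum Mhat_lim_mult_Mk S_series_lim)

text \<open>Each k of the box lies in exactly one dual cone, that of \<open>face_at h k\<close>, a
  compact face because k is positive. If m_h(k) \<le> n, it is met once, at i = n - m_h(k), and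
  otherwise never.\<close>

lemma box_sum_eq:
  "box_sum n b = (\<Sum>k\<in>order_box b. Mhat_of_Mk (Mk_Linv ^ fw k * piece_measure h b n k))"
proof -
  let ?K = "order_box b :: ('n \<Rightarrow> nat) set"
  let ?t = "\<lambda>\<tau> i k. Mhat_of_Mk (piece_coeff h \<tau> {} i) * Linv ^ \<sigma> k :: 'k Mhat"
  have "box_sum n b = (\<Sum>\<tau>\<in>compact_faces h. \<Sum>i=0..n. \<Sum>k\<in>?K. if k \<in> cone_points \<tau> (n - i) then ?t \<tau> i k else 0)"
    unfolding box_sum_def sum_distrib_left
    by (simp add: sum.inter_restrict[OF finite_order_box, symmetric] Int_commute)
  also have "\<dots> = (\<Sum>k\<in>?K. \<Sum>\<tau>\<in>compact_faces h. \<Sum>i=0..n. if k \<in> cone_points \<tau> (n - i) then ?t \<tau> i k else 0)"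
    unfolding sum.swap[of _ ?K] ..
  also have "\<dots> = (\<Sum>k\<in>?K. Mhat_of_Mk (Mk_Linv ^ fw k * piece_measure h b n k))"
  proof (rule sum.cong[OF refl])
    fix k assume k: "k \<in> ?K"
    then have k1: "1 \<le> k j" "0 < k j" for j by (auto simp: order_box_def Suc_le_eq)
    let ?m = "min_weight h k" and ?\<tau> = "face_at h k"
    have "(\<Sum>i=0..n. if k \<in> cone_points \<tau> (n - i) then ?t \<tau> i k else 0)
        = (if \<tau> = ?\<tau> then (if ?m \<le> n then ?t \<tau> (n - ?m) k else 0) else 0)" for \<tau>
    proof -
      have "(\<Sum>i=0..n. if k \<in> cone_points \<tau> (n - i) then ?t \<tau> i k else 0)
          = (\<Sum>i=0..n. if i = n - ?m then (if \<tau> = ?\<tau> \<and> ?m \<le> n then ?t \<tau> i k else 0) else 0)"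
        by (rule sum.cong) (auto simp: cone_points_def Suc_le_eq k1(2))
      also have "\<dots> = (if \<tau> = ?\<tau> \<and> ?m \<le> n then ?t \<tau> (n - ?m) k else 0)"
        by (subst sum.delta) auto
      finally show ?thesis by simp
    qed
    then have "(\<Sum>\<tau>\<in>compact_faces h. \<Sum>i=0..n. if k \<in> cone_points \<tau> (n - i) then ?t \<tau> i k else 0)
        = (\<Sum>\<tau>\<in>compact_faces h. if \<tau> = ?\<tau> then (if ?m \<le> n then ?t \<tau> (n - ?m) k else 0) else 0)"
      by simp
    also have "\<dots> = (if ?m \<le> n then ?t ?\<tau> (n - ?m) k else 0)"
      using face_at_compact_face[OF h k1(2)] by (subst sum.delta) (simp_all add: finite_compact_faces)
    also have "\<dots> = Mhat_of_Mk (Mk_Linv ^ fw k * piece_measure h b n k)"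
      unfolding piece_measure_uncapped[OF k] sigma_eq
      by (simp add: Linv_power Mhat_of_Mk_hom power_add mult_ac)
    finally show "(\<Sum>\<tau>\<in>compact_faces h. \<Sum>i=0..n. if k \<in> cone_points \<tau> (n - i) then ?t \<tau> i k else 0)
        = Mhat_of_Mk (Mk_Linv ^ fw k * piece_measure h b n k)" .
  qed
  finally show ?thesis .
qed

text \<open>The pieces with some order larger than \<open>b\<close> tend to \<open>0\<close> with \<open>b\<close>: up to a power of
  \<open>L\<^sup>-\<^sup>1\<close> there are only finitely many of them.\<close>

lemma box_sum_lim_Z: "Mhat_lim (box_sum n) (fps_nth (Z_DL h \<nu>) n)"
proof -
  let ?X = "compact_faces h \<times> (UNIV :: 'n set set) \<times> {..n}"
  have "finite ?X" by (simp add: finite_compact_faces)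
  \<comment> \<open>One c serves for all b: the values of \<open>piece_coeff\<close> that occur form
    a finite set independent of b.\<close>
  then obtain c where c: "\<And>\<tau> J l. \<tau> \<in> compact_faces h \<Longrightarrow> l \<le> n \<Longrightarrow> Mk_fil c (piece_coeff h \<tau> J l)"
    using Mk_fil_bounded_finite[of ?X "\<lambda>(\<tau>, J, l). piece_coeff h \<tau> J l"] by auto
  have "Mhat_fil (int b + c) (box_sum n b - fps_nth (Z_DL h \<nu>) n)" if b: "n \<le> b" for b
  proof -
    let ?g = "\<lambda>k. Mk_Linv ^ fw k * piece_measure h b n k"
    let ?K = "order_box b :: ('n \<Rightarrow> nat) set" and ?K' = "order_box (Suc b) :: ('n \<Rightarrow> nat) set"
    have sub: "?K \<subseteq> ?K'" by (auto simp: order_box_def le_SucI)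
    have g: "Mk_fil (int b + c) (?g k)" if k: "k \<in> ?K' - ?K" for k
    proof (cases "min_weight h k \<le> n")
      case False
      then show ?thesis by (simp add: piece_measure_def Mk_fil.zero)
    next
      case True
      have k1: "1 \<le> k j" for j using k by (simp add: order_box_def)
      obtain j where "\<not> k j \<le> b" using k k1 unfolding order_box_def by blast
      then have "b \<le> \<sigma> k" using sigma_ge[of k j] by linarith
      then have "Mk_fil (int b) (Mk_Linv ^ \<sigma> k :: 'k Mk)" by (intro Mk_fil_mono[OF Mk_fil_Linv_power]) (simp only: of_nat_le_iff)
      moreover have "face_at h k \<in> compact_faces h"
        by (rule face_at_compact_face[OF h]) (use k1 in \<open>simp add: Suc_le_eq\<close>)
      ultimately have "Mk_fil (int b + c) (Mk_Linv ^ \<sigma> k * piece_coeff h (face_at h k) (capped b k) (n - min_weight h k))"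
        by (intro Mk_fil.mult c) simp_all
      then show ?thesis using True by (simp add: piece_measure_def sigma_eq power_add mult.assoc)
    qed
    \<comment> \<open>With the cap at b the represented orders run up to \<open>Suc b\<close>; the
      points of \<open>?K' - ?K\<close> are those with a capped order.\<close>
    have "fps_nth (Z_DL h \<nu>) n = (\<Sum>k\<in>?K'. Mhat_of_Mk (?g k))" by (rule Z_DL_nth[OF b])
    also have "\<dots> = (\<Sum>k\<in>?K' - ?K. Mhat_of_Mk (?g k)) + box_sum n b"
      unfolding box_sum_eq by (rule sum.subset_diff[OF sub finite_order_box])
    finally have eq: "box_sum n b - fps_nth (Z_DL h \<nu>) n = - (\<Sum>k\<in>?K' - ?K. Mhat_of_Mk (?g k))" by simp
    show ?thesis
      unfolding eq by (intro Mhat_fil_uminus Mhat_fil_sum Mhat_fil_Mk g)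
  qed
  note close = this
  show ?thesis
    unfolding Mhat_lim_def
  proof
    fix K
    have "Mhat_fil K (box_sum n b - fps_nth (Z_DL h \<nu>) n)" if "b \<ge> max n (nat (K - c))" for b
      by (rule Mhat_fil_mono[OF close]) (use that in linarith)+
    then show "\<exists>b0. \<forall>b\<ge>b0. Mhat_fil K (box_sum n b - fps_nth (Z_DL h \<nu>) n)" by blast
  qed
qed

text \<open>Coefficient by coefficient, both sides are limits of the same box sums, and limits are
  unique because the filtration is separated.\<close>

lemma Z_DL_eq: "Z_DL h \<nu> = (\<Sum>\<tau>\<in>compact_faces h. L_series h \<tau> * S_series h \<nu> \<tau>)"
  by (rule fps_ext) (rule Mhat_lim_unique[OF box_sum_lim_Z box_sum_lim])

end

lemma motivic_measure_empty: "motivic_measure ({} :: ('n::finite, 'k::field_char_0) arc set) = 0"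
  using motivic_measure_eq[of "{}" "\<lambda>_ :: unit. {}" 0 "{} :: ('n, 'k) arc set"]
  by (simp add: Mk_of_K0_hom disjoint_family_on_def)

theorem mainTheorem2:
  fixes h f :: "('n::finite, 'k::field_char_0) mpoly" and N \<nu> :: "'n \<Rightarrow> nat"
  assumes "h = (\<Prod>j\<in>UNIV. mvar j ^ N j) * f"
    and "\<And>j. \<not> mvar j dvd f"
    and "nondegenerate h"
    and "\<And>j. 1 \<le> \<nu> j"
    and "\<And>j. N j = 0 \<Longrightarrow> \<nu> j = 1"
  shows "Z_DL h \<nu> = (\<Sum>\<tau>\<in>compact_faces h. L_series h \<tau> * S_series h \<nu> \<tau>)"
proof (cases "h = 0")
  case True
  \<comment> \<open>No arc has a finite contact order with 0, and the Newton polyhedron of 0 is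
    empty: both sides are 0.\<close>
  have "contact_arcs h \<nu> n m = {}" for n m
    by (auto simp: contact_arcs_def True comp_arc_def has_order_def)
  then have "Z_DL h \<nu> = 0"
    by (intro fps_ext) (simp add: Z_DL_def motivic_measure_empty Mhat_of_Mk_hom)
  then show ?thesis by (simp add: True compact_faces_0)
next
  case False
  then show ?thesis using assms(1,3-5) by (rule Z_DL_eq)
qed

end
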